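(* Let $k\ge1$, let $\mathsf{F}$ be a field, and let $\Lambda$ be a row-finite $k$-graph without sources such that $|\Lambda^0|<\infty$. Then the following statements are equivalent: (i) the $\mathbb{Z}^k$-graded algebra $\mathrm{KP}_{\mathsf{F}}(\Lambda)$ is locally finite; (ii) $\Lambda$ has Condition (HNE), i.e. no loop in $\Lambda$ has an entrance; (iii) for any $0\neq a\in T_\Lambda$ and $i=1,2,\dots,k$, there exists $n_i\in\mathbb{N}\setminus\{0\}$ such that ${}^{n_i\mathbf{e}_i}a=a$. Moreover, if $\Lambda=f^*(E^* )$ for a directed graph $E$ and a surjective monoid homomorphism $f:\mathbb{N}^k\to\mathbb{N}$, and any one of (i)--(iii) holds, then there exist positive integers $t$ and $m_i$, $i=1,2,\dots,t$, such that, as $\mathsf{F}$-algebras, $$\mathrm{KP}_{\mathsf{F}}(\Lambda)\cong\bigoplus_{i=1}^{t}\mathbb{M}_{m_i}(\mathsf{F}[\mathbb{Z}^k]).$$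
   Context: $\mathbb{N}=\{0,1,2,\dots\}$; $\mathbb{Z}^k$ has the coordinatewise order; $\mathbf{e}_i$ is the $i$-th unit vector. A $k$-graph is a countable small category $\Lambda$ with a functor $d:\Lambda\to\mathbb{N}^k$ (degree) such that whenever $d(\lambda)=\mathbf{n}+\mathbf{m}$ with $\mathbf{n},\mathbf{m}\in\mathbb{N}^k$ there are unique $\alpha,\beta\in\Lambda$ with $d(\alpha)=\mathbf{n}$, $d(\beta)=\mathbf{m}$, $\lambda=\alpha\beta$. The codomain and domain of a morphism (path) $\lambda$ are $r(\lambda)$ and $s(\lambda)$; $\lambda\mu$ is defined when $s(\lambda)=r(\mu)$. $\Lambda^{\mathbf{n}}=d^{-1}(\mathbf{n})$; elements of $\Lambda^0$ are identified with objects (vertices). $v\Lambda=\{\lambda:r(\lambda)=v\}$, $v\Lambda^{\mathbf{n}}=v\Lambda\cap\Lambda^{\mathbf{n}}$. $\Lambda$ is row-finite without sources if $0<|v\Lambda^{\mathbf{n}}|<\infty$ for all $v,\mathbf{n}$. For $0\le\mathbf{n}\le\mathbf{m}\le d(\lambda)$, $\lambda(\mathbf{n},\mathbf{m})$ is the unique path of degree $\mathbf{m}-\mathbf{n}$ with $\lambda=\alpha\lambda(\mathbf{n},\mathbf{m})\beta$, $d(\alpha)=\mathbf{n}$, $d(\beta)=d(\lambda)-\mathbf{m}$. A loop is a path $\mu$ with $r(\mu)=s(\mu)$. An entrance to a loop $\mu$ is a path $\lambda\in s(\mu)\Lambda$ with $d(\lambda)\le d(\mu)$ and $\mu(0,d(\lambda))\ne\lambda$.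 The talented monoid $T_\Lambda$ is the commutative monoid generated by symbols $v(\mathbf{n})$ ($v\in\Lambda^0$, $\mathbf{n}\in\mathbb{Z}^k$) subject to $v(\mathbf{n})=\sum_{\alpha\in v\Lambda^{\mathbf{e}_i}}s(\alpha)(\mathbf{n}+\mathbf{e}_i)$ for all $v,\mathbf{n}$ and $1\le i\le k$; $\mathbb{Z}^k$ acts by ${}^{\mathbf{q}}v(\mathbf{n})=v(\mathbf{n}+\mathbf{q})$. $\mathrm{KP}_{\mathsf F}(\Lambda)$ is the universal associative $\mathsf{F}$-algebra generated by $p_v$ ($v\in\Lambda^0$), $s_\lambda,s_{\lambda^*}$ ($\lambda\in\Lambda\setminus\Lambda^0$) with relations: (KP1) $p_up_v=\delta_{u,v}p_u$; (KP2) $s_\lambda s_\mu=s_{\lambda\mu}$, $s_{\mu^*}s_{\lambda^*}=s_{(\lambda\mu)^*}$ when $s(\lambda)=r(\mu)$, $p_{r(\lambda)}s_\lambda=s_\lambda=s_\lambda p_{s(\lambda)}$, $p_{s(\lambda)}s_{\lambda^*}=s_{\lambda^*}=s_{\lambda^*}p_{r(\lambda)}$; (KP3) $s_{\lambda^*}s_\mu=\delta_{\lambda,\mu}p_{s(\lambda)}$ if $d(\lambda)=d(\mu)$; (KP4) $p_v=\sum_{\lambda\in v\Lambda^{\mathbf{n}}}s_\lambda s_{\lambda^*}$ for all $v$, $\mathbf{n}\ne0$. With $s_v=s_{v^*}=p_v$, it is $\mathbb{Z}^k$-graded with $\mathrm{KP}_{\mathsf F}(\Lambda)_{\mathbf{n}}=\mathrm{span}_{\mathsf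 F}\{s_\lambda s_{\mu^*}: d(\lambda)-d(\mu)=\mathbf{n}\}$. A graded $\mathsf{F}$-algebra is locally finite if every homogeneous component is finite-dimensional over $\mathsf{F}$. For a directed graph $E$, $E^*$ is the 1-graph given by its category of finite paths with $d=$ length. For an $\ell$-graph $\Gamma$ and a monoid homomorphism $f:\mathbb{N}^k\to\mathbb{N}^\ell$, the pullback $k$-graph is $f^*(\Gamma)=\{(\lambda,\mathbf{n})\in\Gamma\times\mathbb{N}^k: d(\lambda)=f(\mathbf{n})\}$ with $r(\lambda,\mathbf{n})=(r(\lambda),0)$, $s(\lambda,\mathbf{n})=(s(\lambda),0)$, $(\lambda,\mathbf{m})(\mu,\mathbf{n})=(\lambda\mu,\mathbf{m}+\mathbf{n})$ and degree $d(\lambda,\mathbf{n})=\mathbf{n}$. $\mathsf{F}[\mathbb{Z}^k]$ is the group algebra. *)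

theory Defs
  imports
    "HOL-Analysis.Finite_Cartesian_Product"
    "HOL-Library.Numeral_Type"
    "HOL-Library.Multiset"
    "HOL-Library.Countable_Set"
    "HOL-Library.Poly_Mapping"
    "HOL-Algebra.QuotRing"
    "Graph_Theory.Arc_Walk"
    "Jordan_Normal_Form.VS_Connect"
begin

section \<open>k-graphs\<close>

text \<open>
  A small category is given by its set of morphisms alone, each object being identified with
  its identity morphism; so range and source are maps from morphisms to morphisms.
  The composite of \<open>x\<close> and \<open>y\<close> (first \<open>y\<close>, then \<open>x\<close>) is meaningful when
  \<open>src x = rng y\<close>.
  The rank \<open>k\<close> is the cardinality of the index type \<open>'k\<close>.
\<close>

record ('a, 'k) kgraph =
  paths :: "'a set"
  rng :: "'a \<Rightarrow> 'a"
  src :: "'a \<Rightarrow> 'a"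
  cmp :: "'a \<Rightarrow> 'a \<Rightarrow> 'a"
  deg :: "'a \<Rightarrow> nat ^ 'k"

locale k_graph =
  fixes G :: "('a, 'k::finite) kgraph" (structure)
  assumes countable_paths: "countable (paths G)"
    and rng_closed: "x \<in> paths G \<Longrightarrow> rng G x \<in> paths G"
    and src_closed: "x \<in> paths G \<Longrightarrow> src G x \<in> paths G"
    and rng_rng: "x \<in> paths G \<Longrightarrow> rng G (rng G x) = rng G x"
    and src_rng: "x \<in> paths G \<Longrightarrow> src G (rng G x) = rng G x"
    and rng_src: "x \<in> paths G \<Longrightarrow> rng G (src G x) = src G x"
    and src_src: "x \<in> paths G \<Longrightarrow> src G (src G x) = src G x"
    and cmp_closed: "\<lbrakk>x \<in> paths G; y \<in> paths G; src G x = rng G y\<rbrakk> \<Longrightarrow> cmp G x y \<in> paths G"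
    and rng_cmp: "\<lbrakk>x \<in> paths G; y \<in> paths G; src G x = rng G y\<rbrakk> \<Longrightarrow> rng G (cmp G x y) = rng G x"
    and src_cmp: "\<lbrakk>x \<in> paths G; y \<in> paths G; src G x = rng G y\<rbrakk> \<Longrightarrow> src G (cmp G x y) = src G y"
    and cmp_rng: "x \<in> paths G \<Longrightarrow> cmp G (rng G x) x = x"
    and cmp_src: "x \<in> paths G \<Longrightarrow> cmp G x (src G x) = x"
    and cmp_assoc: "\<lbrakk>x \<in> paths G; y \<in> paths G; z \<in> paths G; src G x = rng G y; src G y = rng G z\<rbrakk>
          \<Longrightarrow> cmp G (cmp G x y) z = cmp G x (cmp G y z)"
    and deg_identity: "x \<in> paths G \<Longrightarrow> deg G (rng G x) = 0"
    and deg_cmp: "\<lbrakk>x \<in> paths G; y \<in> paths G; src G x = rng G y\<rbrakk>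
          \<Longrightarrow> deg G (cmp G x y) = deg G x + deg G y"
    and unique_factorization: "\<lbrakk>x \<in> paths G; deg G x = n + m\<rbrakk>
          \<Longrightarrow> \<exists>!(a, b). a \<in> paths G \<and> b \<in> paths G \<and> src G a = rng G b \<and>
                deg G a = n \<and> deg G b = m \<and> x = cmp G a b"

definition vertices :: "('a, 'k::finite) kgraph \<Rightarrow> 'a set" where
  "vertices G = {x \<in> paths G. deg G x = 0}"

definition paths_from :: "('a, 'k::finite) kgraph \<Rightarrow> 'a \<Rightarrow> nat ^ 'k \<Rightarrow> 'a set" where
  "paths_from G v n = {x \<in> paths G. rng G x = v \<and> deg G x = n}"

definition row_finite_without_sources :: "('a, 'k::finite) kgraph \<Rightarrow> bool" where
  "row_finite_without_sources G \<longleftrightarrow>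
     (\<forall>v \<in> vertices G. \<forall>n. finite (paths_from G v n) \<and> paths_from G v n \<noteq> {})"

definition segment :: "('a, 'k::finite) kgraph \<Rightarrow> 'a \<Rightarrow> nat ^ 'k \<Rightarrow> nat ^ 'k \<Rightarrow> 'a" where
  "segment G x n m = (THE y. y \<in> paths G \<and> deg G y = m - n \<and>
     (\<exists>a \<in> paths G. \<exists>b \<in> paths G. deg G a = n \<and> deg G b = deg G x - m \<and>
        src G a = rng G y \<and> src G y = rng G b \<and> x = cmp G a (cmp G y b)))"

definition is_loop :: "('a, 'k::finite) kgraph \<Rightarrow> 'a \<Rightarrow> bool" where
  "is_loop G x \<longleftrightarrow> x \<in> paths G \<and> rng G x = src G x"

definition is_entrance :: "('a, 'k::finite) kgraph \<Rightarrow> 'a \<Rightarrow> 'a \<Rightarrow> bool" where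
  "is_entrance G x y \<longleftrightarrow> y \<in> paths G \<and> rng G y = src G x \<and> deg G y \<le> deg G x \<and>
     segment G x 0 (deg G y) \<noteq> y"

definition condition_HNE :: "('a, 'k::finite) kgraph \<Rightarrow> bool" where
  "condition_HNE G \<longleftrightarrow> \<not> (\<exists>x y. is_loop G x \<and> is_entrance G x y)"

definition kgraph_isomorphic :: "('a, 'k::finite) kgraph \<Rightarrow> ('b, 'k) kgraph \<Rightarrow> bool" where
  "kgraph_isomorphic G H \<longleftrightarrow> (\<exists>h. bij_betw h (paths G) (paths H) \<and>
     (\<forall>x \<in> paths G. rng H (h x) = h (rng G x) \<and> src H (h x) = h (src G x) \<and>
        deg H (h x) = deg G x) \<and>
     (\<forall>x \<in> paths G. \<forall>y \<in> paths G. src G x = rng G y \<longrightarrow> h (cmp G x y) = cmp H (h x) (h y)))"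

text \<open>
  The category of finite paths of a directed graph. The triple \<open>(u, p, v)\<close> is a walk \<open>p\<close>
  from its source \<open>u\<close> to its range \<open>v\<close>, so a composite traverses the arcs of its right
  factor first.
\<close>

definition path_kgraph :: "('v, 'e) pre_digraph \<Rightarrow> ('v \<times> 'e list \<times> 'v, 1) kgraph" where
  "path_kgraph E = \<lparr>
     paths = {(u, p, v). pre_digraph.awalk E u p v},
     rng = (\<lambda>(u, p, v). (v, [], v)),
     src = (\<lambda>(u, p, v). (u, [], u)),
     cmp = (\<lambda>(u, p, v) (u', p', v'). (u', p' @ p, v)),
     deg = (\<lambda>(u, p, v). \<chi> i. length p)\<rparr>"

definition pullback ::
    "(nat ^ 'k \<Rightarrow> nat ^ 'l) \<Rightarrow> ('a, 'l::finite) kgraph \<Rightarrow> ('a \<times> (nat ^ 'k), 'k::finite) kgraph" where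
  "pullback f G = \<lparr>
     paths = {(x, n). x \<in> paths G \<and> deg G x = f n},
     rng = (\<lambda>(x, n). (rng G x, 0)),
     src = (\<lambda>(x, n). (src G x, 0)),
     cmp = (\<lambda>(x, m) (y, n). (cmp G x y, m + n)),
     deg = (\<lambda>(x, n). n)\<rparr>"

section \<open>The talented monoid\<close>

text \<open>
  The free commutative monoid on the symbols \<open>v(n)\<close> consists of the finite multisets of pairs
  \<open>(v, n)\<close>; the talented monoid is its quotient by the congruence generated by the defining
  relations.
\<close>

inductive talented_eq ::
    "('a, 'k::finite) kgraph \<Rightarrow> ('a \<times> (int ^ 'k)) multiset \<Rightarrow> ('a \<times> (int ^ 'k)) multiset \<Rightarrow> bool"
  for G where
  relation: "v \<in> vertices G \<Longrightarrow>
     talented_eq G {#(v, n)#} (\<Sum>x \<in> paths_from G v (axis i 1). {#(src G x, n + axis i 1)#})"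
| refl: "talented_eq G x x"
| sym: "talented_eq G x y \<Longrightarrow> talented_eq G y x"
| trans: "talented_eq G x y \<Longrightarrow> talented_eq G y z \<Longrightarrow> talented_eq G x z"
| add: "talented_eq G x x' \<Longrightarrow> talented_eq G y y' \<Longrightarrow> talented_eq G (x + y) (x' + y')"

definition talented_rel :: "('a, 'k::finite) kgraph \<Rightarrow> ('a \<times> (int ^ 'k)) multiset rel" where
  "talented_rel G = {(x, y). set_mset x \<subseteq> vertices G \<times> UNIV \<and> set_mset y \<subseteq> vertices G \<times> UNIV \<and>
     talented_eq G x y}"

text \<open>
  The operation of the monoid record is the addition of the talented monoid, and its unit is
  the zero element.
\<close>

definition talented_monoid :: "('a, 'k::finite) kgraph \<Rightarrow> ('a \<times> (int ^ 'k)) multiset set monoid" where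
  "talented_monoid G = \<lparr>
     carrier = {x. set_mset x \<subseteq> vertices G \<times> UNIV} // talented_rel G,
     mult = (\<lambda>A B. \<Union>x \<in> A. \<Union>y \<in> B. talented_rel G `` {x + y}),
     one = talented_rel G `` {{#}}\<rparr>"

definition talented_action ::
    "int ^ 'k \<Rightarrow> ('a \<times> (int ^ 'k::finite)) multiset set \<Rightarrow> ('a \<times> (int ^ 'k)) multiset set" where
  "talented_action q A = image_mset (\<lambda>(v, n). (v, n + q)) ` A"

definition talented_periodic :: "('a, 'k::finite) kgraph \<Rightarrow> bool" where
  "talented_periodic G \<longleftrightarrow>
     (\<forall>a \<in> carrier (talented_monoid G). a \<noteq> \<one>\<^bsub>talented_monoid G\<^esub> \<longrightarrow>
        (\<forall>i :: 'k. \<exists>n :: nat. n \<noteq> 0 \<and> talented_action (axis i (int n)) a = a))"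

section \<open>Algebras\<close>

text \<open>
  Algebras over a field are records of type \<open>module\<close>, which carry both a multiplication
  and a scalar multiplication.

  The algebra with generators \<open>X\<close> and relations \<open>R\<close> is the set of formal expressions
  in \<open>X\<close> modulo the congruence generated by \<open>R\<close> and the axioms of associative, not
  necessarily unital, algebras.
\<close>

datatype (scalars: 'f, gens: 'x) alg_term =
    Gen 'x
  | Zero
  | Plus "('f, 'x) alg_term" "('f, 'x) alg_term"
  | Scale 'f "('f, 'x) alg_term"
  | Times "('f, 'x) alg_term" "('f, 'x) alg_term"

inductive alg_eq ::
    "(('f::field, 'x) alg_term \<times> ('f, 'x) alg_term) set \<Rightarrow>
     ('f, 'x) alg_term \<Rightarrow> ('f, 'x) alg_term \<Rightarrow> bool"
  for R where
  relation: "(x, y) \<in> R \<Longrightarrow> alg_eq R x y"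
| refl: "alg_eq R x x"
| sym: "alg_eq R x y \<Longrightarrow> alg_eq R y x"
| trans: "alg_eq R x y \<Longrightarrow> alg_eq R y z \<Longrightarrow> alg_eq R x z"
| cong_plus: "alg_eq R x x' \<Longrightarrow> alg_eq R y y' \<Longrightarrow> alg_eq R (Plus x y) (Plus x' y')"
| cong_scale: "alg_eq R x x' \<Longrightarrow> alg_eq R (Scale c x) (Scale c x')"
| cong_times: "alg_eq R x x' \<Longrightarrow> alg_eq R y y' \<Longrightarrow> alg_eq R (Times x y) (Times x' y')"
| plus_assoc: "alg_eq R (Plus (Plus x y) z) (Plus x (Plus y z))"
| plus_comm: "alg_eq R (Plus x y) (Plus y x)"
| plus_zero: "alg_eq R (Plus Zero x) x"
| scale_plus: "alg_eq R (Scale c (Plus x y)) (Plus (Scale c x) (Scale c y))"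
| plus_scale: "alg_eq R (Scale (c + d) x) (Plus (Scale c x) (Scale d x))"
| scale_scale: "alg_eq R (Scale c (Scale d x)) (Scale (c * d) x)"
| scale_one: "alg_eq R (Scale 1 x) x"
| scale_zero: "alg_eq R (Scale 0 x) Zero"
| times_assoc: "alg_eq R (Times (Times x y) z) (Times x (Times y z))"
| times_plus: "alg_eq R (Times x (Plus y z)) (Plus (Times x y) (Times x z))"
| plus_times: "alg_eq R (Times (Plus x y) z) (Plus (Times x z) (Times y z))"
| scale_times: "alg_eq R (Times (Scale c x) y) (Scale c (Times x y))"
| times_scale: "alg_eq R (Times x (Scale c y)) (Scale c (Times x y))"

definition alg_rel ::
    "'x set \<Rightarrow> (('f::field, 'x) alg_term \<times> ('f, 'x) alg_term) set \<Rightarrow> ('f, 'x) alg_term rel" where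
  "alg_rel X R = {(x, y). gens x \<subseteq> X \<and> gens y \<subseteq> X \<and> alg_eq R x y}"

text \<open>
  The field \<open>one\<close> is the multiplicative identity if there is one, and is unspecified otherwise.
\<close>

definition presented_algebra ::
    "'x set \<Rightarrow> (('f::field, 'x) alg_term \<times> ('f, 'x) alg_term) set \<Rightarrow>
     ('f, ('f, 'x) alg_term set) module" where
  "presented_algebra X R = (let
       C = {x. gens x \<subseteq> X} // alg_rel X R;
       mul = (\<lambda>A B. \<Union>x \<in> A. \<Union>y \<in> B. alg_rel X R `` {Times x y})
     in \<lparr>
       carrier = C,
       mult = mul,
       one = (THE e. e \<in> C \<and> (\<forall>A \<in> C. mul e A = A \<and> mul A e = A)),
       zero = alg_rel X R `` {Zero},
       add = (\<lambda>A B. \<Union>x \<in> A. \<Union>y \<in> B. alg_rel X R `` {Plus x y}),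
       smult = (\<lambda>c A. \<Union>x \<in> A. alg_rel X R `` {Scale c x})\<rparr>)"

definition algebra_isomorphic :: "('f, 'a) module \<Rightarrow> ('f, 'b) module \<Rightarrow> bool" where
  "algebra_isomorphic A B \<longleftrightarrow>
     (\<exists>h \<in> ring_iso A B. \<forall>c. \<forall>x \<in> carrier A. h (c \<odot>\<^bsub>A\<^esub> x) = c \<odot>\<^bsub>B\<^esub> h x)"

definition locally_finite :: "('f::field, 'a) module \<Rightarrow> ('g \<Rightarrow> 'a set) \<Rightarrow> bool" where
  "locally_finite A component \<longleftrightarrow>
     (\<forall>n. vectorspace.fin_dim class_ring (A\<lparr>carrier := component n\<rparr>))"

definition direct_sum_algebra :: "'i set \<Rightarrow> ('i \<Rightarrow> ('f, 'a) module) \<Rightarrow> ('f, 'i \<Rightarrow> 'a) module" where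
  "direct_sum_algebra I A = \<lparr>
     carrier = (\<Pi>\<^sub>E i \<in> I. carrier (A i)),
     mult = (\<lambda>x y. \<lambda>i \<in> I. x i \<otimes>\<^bsub>A i\<^esub> y i),
     one = (\<lambda>i \<in> I. \<one>\<^bsub>A i\<^esub>),
     zero = (\<lambda>i \<in> I. \<zero>\<^bsub>A i\<^esub>),
     add = (\<lambda>x y. \<lambda>i \<in> I. x i \<oplus>\<^bsub>A i\<^esub> y i),
     smult = (\<lambda>c x. \<lambda>i \<in> I. c \<odot>\<^bsub>A i\<^esub> x i)\<rparr>"

text \<open>
  The group algebra of \<open>\<int>\<^sup>k\<close> is the type of finitely supported functions
  \<open>int ^ 'k \<Rightarrow>\<^sub>0 'f\<close> with convolution as multiplication; a scalar \<open>c\<close> embeds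
  as \<open>Poly_Mapping.single 0 c\<close>.
\<close>

definition group_algebra_matrices ::
    "nat \<Rightarrow> ('f::field, ((int ^ 'k::finite) \<Rightarrow>\<^sub>0 'f) mat) module" where
  "group_algebra_matrices m =
     ring_mat TYPE((int ^ 'k) \<Rightarrow>\<^sub>0 'f) m \<lparr>smult = \<lambda>c M. Poly_Mapping.single 0 c \<cdot>\<^sub>m M\<rparr>"

section \<open>The Kumjian-Pask algebra\<close>

text \<open>The generators \<open>p\<^sub>v\<close>, \<open>s\<^sub>x\<close> and \<open>s\<^bsub>x*\<^esub>\<close>.\<close>

datatype 'a kp_gen = Vert 'a | Path 'a | Ghost 'a

definition kp_gens :: "('a, 'k::finite) kgraph \<Rightarrow> 'a kp_gen set" where
  "kp_gens G = Vert ` vertices G \<union> Path ` (paths G - vertices G) \<union> Ghost ` (paths G - vertices G)"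

abbreviation kp_p :: "'a \<Rightarrow> ('f, 'a kp_gen) alg_term" where
  "kp_p v \<equiv> Gen (Vert v)"

text \<open>The convention \<open>s\<^sub>v = s\<^bsub>v*\<^esub> = p\<^sub>v\<close> for vertices.\<close>

definition kp_s :: "('a, 'k::finite) kgraph \<Rightarrow> 'a \<Rightarrow> ('f, 'a kp_gen) alg_term" where
  "kp_s G x = (if x \<in> vertices G then Gen (Vert x) else Gen (Path x))"

definition kp_s_star :: "('a, 'k::finite) kgraph \<Rightarrow> 'a \<Rightarrow> ('f, 'a kp_gen) alg_term" where
  "kp_s_star G x = (if x \<in> vertices G then Gen (Vert x) else Gen (Ghost x))"

text \<open>
  In \<open>KP4\<close> the finite sum is formed along an arbitrary enumeration of the summands; by
  commutativity they all denote the same element.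
\<close>

inductive_set kp_relations ::
    "('a, 'k::finite) kgraph \<Rightarrow> (('f::field, 'a kp_gen) alg_term \<times> ('f, 'a kp_gen) alg_term) set"
  for G where
  KP1: "\<lbrakk>u \<in> vertices G; v \<in> vertices G\<rbrakk> \<Longrightarrow>
     (Times (kp_p u) (kp_p v), if u = v then kp_p u else Zero) \<in> kp_relations G"
| KP2_path: "\<lbrakk>x \<in> paths G - vertices G; y \<in> paths G - vertices G; src G x = rng G y\<rbrakk> \<Longrightarrow>
     (Times (kp_s G x) (kp_s G y), kp_s G (cmp G x y)) \<in> kp_relations G"
| KP2_ghost: "\<lbrakk>x \<in> paths G - vertices G; y \<in> paths G - vertices G; src G x = rng G y\<rbrakk> \<Longrightarrow>
     (Times (kp_s_star G y) (kp_s_star G x), kp_s_star G (cmp G x y)) \<in> kp_relations G"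
| KP2_rng_path: "x \<in> paths G - vertices G \<Longrightarrow>
     (Times (kp_p (rng G x)) (kp_s G x), kp_s G x) \<in> kp_relations G"
| KP2_path_src: "x \<in> paths G - vertices G \<Longrightarrow>
     (Times (kp_s G x) (kp_p (src G x)), kp_s G x) \<in> kp_relations G"
| KP2_src_ghost: "x \<in> paths G - vertices G \<Longrightarrow>
     (Times (kp_p (src G x)) (kp_s_star G x), kp_s_star G x) \<in> kp_relations G"
| KP2_ghost_rng: "x \<in> paths G - vertices G \<Longrightarrow>
     (Times (kp_s_star G x) (kp_p (rng G x)), kp_s_star G x) \<in> kp_relations G"
| KP3: "\<lbrakk>x \<in> paths G - vertices G; y \<in> paths G - vertices G; deg G x = deg G y\<rbrakk> \<Longrightarrow>
     (Times (kp_s_star G x) (kp_s G y), if x = y then kp_p (src G x) else Zero) \<in> kp_relations G"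
| KP4: "\<lbrakk>v \<in> vertices G; n \<noteq> 0; distinct xs; set xs = paths_from G v n\<rbrakk> \<Longrightarrow>
     (kp_p v, foldr Plus (map (\<lambda>x. Times (kp_s G x) (kp_s_star G x)) xs) Zero) \<in> kp_relations G"

definition KP :: "'f::field itself \<Rightarrow> ('a, 'k::finite) kgraph \<Rightarrow>
    ('f, ('f, 'a kp_gen) alg_term set) module" where
  "KP F G = presented_algebra (kp_gens G) (kp_relations G)"

definition kp_class :: "('a, 'k::finite) kgraph \<Rightarrow> ('f::field, 'a kp_gen) alg_term \<Rightarrow>
    ('f, 'a kp_gen) alg_term set" where
  "kp_class G t = alg_rel (kp_gens G) (kp_relations G) `` {t}"

definition int_deg :: "('a, 'k::finite) kgraph \<Rightarrow> 'a \<Rightarrow> int ^ 'k" where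
  "int_deg G x = (\<chi> i. int (vec_nth (deg G x) i))"

definition KP_component :: "'f::field itself \<Rightarrow> ('a, 'k::finite) kgraph \<Rightarrow> int ^ 'k \<Rightarrow>
    ('f, 'a kp_gen) alg_term set set" where
  "KP_component F G n = LinearCombinations.module.span class_ring (KP F G)
     {kp_class G (Times (kp_s G x) (kp_s_star G y)) | x y.
        x \<in> paths G \<and> y \<in> paths G \<and> int_deg G x - int_deg G y = n}"

end

theory Submission
  imports Defs
begin

text \<open>
  If no loop has an entrance and there are finitely many vertices, then by the pigeonhole principle
  every path of large degree ends at a \<^emph>\<open>rigid\<close> vertex, from which exactly one path of each degree
  starts. Hence there are only finitely many infinite paths, and the algebra is spanned by the
  elements \<open>s\<^sub>p s\<^bsub>q*\<^esub>\<close> with \<open>s(p) = s(q)\<close> rigid. Such an element depends only on the infinite paths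
  \<open>x\<close>, \<open>y\<close> that continue \<open>p\<close>, \<open>q\<close> and on the lag \<open>n = d(p) - d(q)\<close>, so every component is finite-dimensional.
  The representation on functions of infinite paths with values in the group algebra sends it to the
  matrix unit \<open>(x, y)\<close> times \<open>n\<close>. So \<open>KP\<close> is the algebra of the groupoid of
  triples \<open>(x, n, y)\<close>, one matrix block per tail equivalence class, over the group algebra of the
  isotropy group. That group has finite index in \<open>\<int>\<^sup>k\<close>, because finitely many infinite paths
  cannot have pairwise distinct shifts, and is therefore isomorphic to \<open>\<int>\<^sup>k\<close>.

  Conversely, let \<open>\<mu>\<close> be a loop with an entrance, which we extend to a path \<open>\<lambda> \<noteq> \<mu>\<close> of the same
  degree. The projections onto \<open>\<mu>\<^sup>j\<lambda>\<close> are linearly independent in degree zero. In the talented monoid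
  \<open>v(0) = v(d(\<mu>)) + b\<close> with \<open>b \<noteq> 0\<close>, and periodicity would give \<open>v(0) = v(0) + b'\<close> with \<open>b' \<noteq> 0\<close>, which
  is refuted by counting paths of large degree.
\<close>

section \<open>Paths and infinite paths of a k-graph\<close>

text \<open>The obstacle is independence: a presentation lets equations be derived, not refuted.
  Every inequality in the algebra is therefore moved to operators on functions of infinite paths.
  Scalar values would not do: if \<mu> is a loop at a rigid vertex v, then prolonging the only
  infinite path from v by \<mu> gives that path again, and the generators of \<mu> and of v would
  act alike. Values in the group algebra separate them by degree, and the matrix entries then are
  the coefficients in the spanning set.

  The pigeonhole argument runs along the diagonal because the loop it yields must have positive
  degree in every coordinate; a loop in one direction says nothing about paths in the others.

  Within a block, the entry at (x, y) has its degrees in a coset of the isotropy group, not in the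
  group itself. Fixing a base point in each class and using lags to it trivializes these cosets.

  Condition (iii) gives periods along the axes, whereas a loop has a vector as degree; this is why
  the loop is repeated a suitable number of times before the two are compared.\<close>

lemmas cart_eq_iff = Finite_Cartesian_Product.vec_eq_iff
lemmas cart_le_iff = Finite_Cartesian_Product.less_eq_vec_def

section \<open>Vectors of natural numbers and the cofinal diagonal\<close>

lemma nat_vec_add_diff:
  fixes n m :: "nat ^ 'n::finite"
  shows "n \<le> m \<Longrightarrow> n + (m - n) = m"
  by (simp add: cart_le_iff cart_eq_iff)

lemma nat_vec_le_add [simp]:
  fixes n m :: "nat ^ 'n::finite"
  shows "n \<le> n + m" "n \<le> m + n" "0 \<le> n"
  by (simp_all add: cart_le_iff)

definition diag :: "nat \<Rightarrow> nat ^ 'n::finite" where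
  "diag j = (\<chi> i. j)"

text \<open>A scalar bound: \<open>n \<le> diag (vec_total n)\<close> shows that the diagonal is
  cofinal, so a construction along it reaches every degree. It is also the measure for induction on
  vectors.\<close>

definition vec_total :: "nat ^ 'n::finite \<Rightarrow> nat" where
  "vec_total n = (\<Sum>i\<in>UNIV. vec_nth n i)"

lemma diag_nth [simp]: "vec_nth (diag j) i = j"
  by (simp add: diag_def)

lemma diag_add: "diag (i + j) = diag i + diag j"
  by (simp add: cart_eq_iff)

lemma diag_0 [simp]: "diag 0 = 0"
  by (simp add: cart_eq_iff)

lemma diag_mono: "i \<le> j \<Longrightarrow> diag i \<le> diag j"
  by (simp add: cart_le_iff)

lemma le_diag_vec_total: "n \<le> diag (vec_total n)"
  unfolding cart_le_iff vec_total_def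
  by (auto intro: member_le_sum)

lemma vec_total_mono: "n \<le> m \<Longrightarrow> vec_total n \<le> vec_total m"
  unfolding cart_le_iff vec_total_def by (auto intro: sum_mono)

section \<open>Unique factorization and initial segments\<close>

context k_graph
begin

text \<open>Additivity of the degree and cancellation of vectors make the right degrees equal too,
  so both pairs are instances of one unique factorization.\<close>

lemma factor_unique:
  assumes "a \<in> paths G" "b \<in> paths G" "src G a = rng G b"
    "a' \<in> paths G" "b' \<in> paths G" "src G a' = rng G b'"
    "cmp G a b = cmp G a' b'" "deg G a = deg G a'"
  shows "a = a' \<and> b = b'"
proof -
  have d: "deg G a + deg G b = deg G a' + deg G b'"
    using assms deg_cmp by metis
  then have "deg G b = deg G b'" using assms(8) by simp
  moreover obtain z where z: "\<And>w. (case w of (c, d) \<Rightarrow> c \<in> paths G \<and> d \<in> paths G \<and> src G c = rng G d \<and>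
                deg G c = deg G a \<and> deg G d = deg G b \<and> cmp G a b = cmp G c d) \<Longrightarrow> w = z"
    using unique_factorization[OF cmp_closed[OF assms(1-3)] deg_cmp[OF assms(1-3)]] by (elim ex1E) blast
  ultimately have "(a, b) = z" "(a', b') = z"
    using assms by (auto intro!: z)
  then show ?thesis by auto
qed

text \<open>x = r(x)x and x = x s(x) are factorizations whose left factors r(x) and x both have
  degree 0, so they coincide. Hence degree 0 characterizes the identities, which justifies
  \<open>vertices\<close>.\<close>

lemma identity_of_deg_0:
  assumes "x \<in> paths G" "deg G x = 0"
  shows "rng G x = x" "src G x = x"
proof -
  have "src G (rng G x) = rng G x" "deg G (rng G x) = 0" "rng G (src G x) = src G x"
    using assms by (auto simp: src_rng deg_identity rng_src)
  then show "rng G x = x"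
    using factor_unique[of "rng G x" x x "src G x"] assms
    by (auto simp: cmp_rng cmp_src rng_closed src_closed)
  then show "src G x = x" using src_rng[of x] assms by simp
qed

lemma deg_src: "x \<in> paths G \<Longrightarrow> deg G (src G x) = 0"
  by (metis deg_identity rng_src src_closed)

lemma src_vertex [simp]: "x \<in> paths G \<Longrightarrow> src G x \<in> vertices G"
  by (simp add: vertices_def src_closed deg_src)

lemma rng_vertex [simp]: "x \<in> paths G \<Longrightarrow> rng G x \<in> vertices G"
  by (simp add: vertices_def rng_closed deg_identity)

lemma vertexD: "v \<in> vertices G \<Longrightarrow> v \<in> paths G \<and> deg G v = 0 \<and> rng G v = v \<and> src G v = v"
  using identity_of_deg_0 by (auto simp: vertices_def)

text \<open>\<open>pre x n\<close> is x(0,n) and \<open>suf x n\<close> is x(n,d(x)), each described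
  by a single composition. The three-fold factorization of \<open>segment\<close> is only translated
  into \<open>pre\<close>.\<close>

definition pre :: "'a \<Rightarrow> nat ^ 'k \<Rightarrow> 'a" where
  "pre x n = (THE a. a \<in> paths G \<and> deg G a = n \<and> (\<exists>b\<in>paths G. src G a = rng G b \<and> x = cmp G a b))"

definition suf :: "'a \<Rightarrow> nat ^ 'k \<Rightarrow> 'a" where
  "suf x n = (THE b. b \<in> paths G \<and> (\<exists>a\<in>paths G. deg G a = n \<and> src G a = rng G b \<and> x = cmp G a b))"

lemma pre_suf_cmp:
  assumes "a \<in> paths G" "b \<in> paths G" "src G a = rng G b"
  shows "pre (cmp G a b) (deg G a) = a" "suf (cmp G a b) (deg G a) = b"
  unfolding pre_def suf_def using assms factor_unique by (auto intro!: the_equality)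

lemma pre_suf:
  assumes "x \<in> paths G" "n \<le> deg G x"
  shows "pre x n \<in> paths G" "suf x n \<in> paths G" "deg G (pre x n) = n"
    "deg G (suf x n) = deg G x - n" "src G (pre x n) = rng G (suf x n)"
    "cmp G (pre x n) (suf x n) = x"
proof -
  have "deg G x = n + (deg G x - n)" using assms(2) by (simp add: nat_vec_add_diff)
  then obtain a b where *: "a \<in> paths G" "b \<in> paths G" "src G a = rng G b"
    "deg G a = n" "deg G b = deg G x - n" "x = cmp G a b"
    using ex1_implies_ex[OF unique_factorization[OF assms(1)]] by blast
  then have "pre x n = a" "suf x n = b" using pre_suf_cmp by auto
  with * show "pre x n \<in> paths G" "suf x n \<in> paths G" "deg G (pre x n) = n"
    "deg G (suf x n) = deg G x - n" "src G (pre x n) = rng G (suf x n)"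
    "cmp G (pre x n) (suf x n) = x" by auto
qed

lemma rng_pre: "x \<in> paths G \<Longrightarrow> n \<le> deg G x \<Longrightarrow> rng G (pre x n) = rng G x"
  by (metis pre_suf(1,2,5,6) rng_cmp)

lemma src_suf: "x \<in> paths G \<Longrightarrow> n \<le> deg G x \<Longrightarrow> src G (suf x n) = src G x"
  by (metis pre_suf(1,2,5,6) src_cmp)

lemma pre_cmp_le:
  assumes "a \<in> paths G" "b \<in> paths G" "src G a = rng G b" "n \<le> deg G a"
  shows "pre (cmp G a b) n = pre a n"
proof -
  note p = pre_suf[OF assms(1,4)]
  have s: "src G (suf a n) = rng G b" using assms src_suf by simp
  have "cmp G a b = cmp G (pre a n) (cmp G (suf a n) b)"
    using cmp_assoc[OF p(1,2) assms(2) p(5) s] p(6) by simp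
  then show ?thesis
    using pre_suf_cmp(1)[of "pre a n" "cmp G (suf a n) b"] p s assms(2)
    by (simp add: cmp_closed rng_cmp)
qed

lemma pre_pre:
  assumes "x \<in> paths G" "n \<le> m" "m \<le> deg G x"
  shows "pre (pre x m) n = pre x n"
  using pre_cmp_le[of "pre x m" "suf x m" n] pre_suf[OF assms(1,3)] assms(2) by simp

text \<open>The left factor in the defining factorization has degree 0, hence is an identity and
  disappears.\<close>

lemma segment_0:
  assumes "x \<in> paths G" "n \<le> deg G x"
  shows "segment G x 0 n = pre x n"
  unfolding segment_def
proof (rule the_equality)
  show "pre x n \<in> paths G \<and> deg G (pre x n) = n - 0 \<and>
    (\<exists>a\<in>paths G. \<exists>b\<in>paths G. deg G a = 0 \<and> deg G b = deg G x - n \<and>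
       src G a = rng G (pre x n) \<and> src G (pre x n) = rng G b \<and>
       x = cmp G a (cmp G (pre x n) b))"
  proof (intro conjI)
    show "\<exists>a\<in>paths G. \<exists>b\<in>paths G. deg G a = 0 \<and> deg G b = deg G x - n \<and>
       src G a = rng G (pre x n) \<and> src G (pre x n) = rng G b \<and>
       x = cmp G a (cmp G (pre x n) b)"
    proof (rule bexI[of _ "rng G x"], rule bexI[of _ "suf x n"], intro conjI)
      show "x = cmp G (rng G x) (cmp G (pre x n) (suf x n))"
        using pre_suf(6)[OF assms] cmp_rng[OF assms(1)] by simp
      show "src G (rng G x) = rng G (pre x n)"
        using rng_pre[OF assms] src_rng[OF assms(1)] by simp
    qed (use pre_suf[OF assms] assms in \<open>simp_all add: deg_identity rng_closed\<close>)
  qed (use pre_suf[OF assms] in \<open>auto simp: cart_eq_iff\<close>)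
next
  fix y
  assume "y \<in> paths G \<and> deg G y = n - 0 \<and>
    (\<exists>a\<in>paths G. \<exists>b\<in>paths G. deg G a = 0 \<and> deg G b = deg G x - n \<and>
       src G a = rng G y \<and> src G y = rng G b \<and> x = cmp G a (cmp G y b))"
  then obtain a b where *: "y \<in> paths G" "deg G y = n" "a \<in> paths G" "b \<in> paths G" "deg G a = 0"
    "src G a = rng G y" "src G y = rng G b" "x = cmp G a (cmp G y b)"
    by (auto simp: cart_eq_iff)
  then have "a = rng G (cmp G y b)" using identity_of_deg_0[of a] by (simp add: rng_cmp)
  then have "x = cmp G y b" using * by (simp add: cmp_rng cmp_closed)
  then show "y = pre x n" using * pre_suf_cmp by auto
qed

section \<open>Infinite paths, their shifts and extensions\<close>

text \<open>An infinite path is usually a degree-preserving functor on pairs m \<le> n. Here only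
  the values x(0,n) are kept, compatible under truncation; x(m,m+n) is recovered as
  \<open>shift m x n\<close>, and \<open>x 0\<close> is the range.\<close>

definition inf_paths :: "(nat ^ 'k \<Rightarrow> 'a) set" where
  "inf_paths = {x. (\<forall>n. x n \<in> paths G \<and> deg G (x n) = n) \<and> (\<forall>n m. pre (x (n + m)) n = x n)}"

definition shift :: "nat ^ 'k \<Rightarrow> (nat ^ 'k \<Rightarrow> 'a) \<Rightarrow> nat ^ 'k \<Rightarrow> 'a" where
  "shift m x = (\<lambda>n. suf (x (m + n)) m)"

text \<open>The composite of p and x(0,n) has degree d(p) + n, which is at least n, so it is cut
  back to degree n.\<close>

definition prepend :: "'a \<Rightarrow> (nat ^ 'k \<Rightarrow> 'a) \<Rightarrow> nat ^ 'k \<Rightarrow> 'a" where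
  "prepend p x = (\<lambda>n. pre (cmp G p (x n)) n)"

lemma inf_pathsD:
  assumes "x \<in> inf_paths"
  shows "x n \<in> paths G" "deg G (x n) = n" "pre (x (n + m)) n = x n"
  using assms by (auto simp: inf_paths_def)

lemma inf_pathsI:
  assumes "\<And>n. x n \<in> paths G" "\<And>n. deg G (x n) = n"
    "\<And>n m. \<exists>c\<in>paths G. src G (x n) = rng G c \<and> x (n + m) = cmp G (x n) c"
  shows "x \<in> inf_paths"
proof -
  have "pre (x (n + m)) n = x n" for n m
  proof -
    obtain c where "c \<in> paths G" "src G (x n) = rng G c" "x (n + m) = cmp G (x n) c"
      using assms(3) by blast
    then show ?thesis using pre_suf_cmp(1)[of "x n" c] assms by simp
  qed
  then show ?thesis using assms by (simp add: inf_paths_def)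
qed

lemma inf_path_split:
  assumes "x \<in> inf_paths"
  shows "shift m x n \<in> paths G" "deg G (shift m x n) = n" "src G (x m) = rng G (shift m x n)"
    "x (m + n) = cmp G (x m) (shift m x n)"
  using pre_suf[of "x (m + n)" m] inf_pathsD[OF assms] by (simp_all add: shift_def)

lemma shift_eqI:
  assumes "x \<in> inf_paths" "\<And>n. y n \<in> paths G" "\<And>n. src G (x m) = rng G (y n)"
    "\<And>n. x (m + n) = cmp G (x m) (y n)"
  shows "shift m x = y"
proof
  fix n
  show "shift m x n = y n"
    unfolding shift_def using assms pre_suf_cmp(2)[of "x m" "y n"] inf_pathsD[OF assms(1)] by simp
qed

text \<open>The degrees m + n are cofinal, and every x(0,n) is a truncation of x(0,n+m).\<close>

lemma inf_path_ext:
  assumes "x \<in> inf_paths" "y \<in> inf_paths" "\<And>n. x (m + n) = y (m + n)"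
  shows "x = y"
proof
  fix n
  have "x n = pre (x (n + m)) n" "y n = pre (y (n + m)) n"
    using assms inf_pathsD(3) by auto
  then show "x n = y n" using assms(3)[of n] by (simp add: add.commute)
qed

text \<open>x(0,m+n+k) is split at m and at m + n; cancelling the common left factor
  \<open>x m\<close> exhibits a later segment of the shift as an extension of an earlier
  one.\<close>

lemma shift_closed:
  assumes "x \<in> inf_paths"
  shows "shift m x \<in> inf_paths"
proof (rule inf_pathsI)
  note s = inf_path_split[OF assms]
  fix n k
  let ?c = "shift (m + n) x k"
  have r: "src G (shift m x n) = rng G ?c"
    using s(3)[of "m + n" k] s(4)[of m n] src_cmp[of "x m" "shift m x n"] s inf_pathsD[OF assms]
    by simp
  have "cmp G (x m) (shift m x (n + k)) = cmp G (x m) (cmp G (shift m x n) ?c)"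
    using s(4)[of m "n + k"] s(4)[of "m + n" k] s(4)[of m n]
      cmp_assoc[of "x m" "shift m x n" ?c] s(1,3) r inf_pathsD[OF assms] by (simp add: add.assoc)
  then have "shift m x (n + k) = cmp G (shift m x n) ?c"
    using factor_unique[OF inf_pathsD(1)[OF assms] s(1) s(3) inf_pathsD(1)[OF assms]
        cmp_closed[OF s(1) s(1) r]] rng_cmp[OF s(1) s(1) r] s(3)[of m n] by metis
  then show "\<exists>c\<in>paths G. src G (shift m x n) = rng G c \<and> shift m x (n + k) = cmp G (shift m x n) c"
    using r s(1) by auto
qed (use inf_path_split[OF assms] in auto)

lemma inf_path_rng:
  assumes "x \<in> inf_paths"
  shows "rng G (x n) = x 0" "x 0 \<in> vertices G"
proof -
  show v: "x 0 \<in> vertices G" using inf_pathsD[OF assms, of 0] by (simp add: vertices_def)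
  then have v: "src G (x 0) = x 0" "rng G (x 0) = x 0" using vertexD by auto
  have "rng G (x (0 + n)) = rng G (x 0)"
    unfolding inf_path_split(4)[OF assms, of 0 n]
    using inf_path_split[OF assms, of 0 n] inf_pathsD[OF assms, of 0] by (intro rng_cmp) auto
  then show "rng G (x n) = x 0" using v by simp
qed

lemma shift_start: "x \<in> inf_paths \<Longrightarrow> shift m x 0 = src G (x m)"
  using inf_path_rng[OF shift_closed] inf_path_split(3) by metis

lemma shift_0:
  assumes "x \<in> inf_paths"
  shows "shift 0 x = x"
proof (rule shift_eqI[OF assms])
  fix n
  note r = inf_path_rng[OF assms]
  show "x n \<in> paths G" using inf_pathsD[OF assms] by simp
  show "src G (x 0) = rng G (x n)" using vertexD[OF r(2)] r(1) by simp
  show "x (0 + n) = cmp G (x 0) (x n)" using cmp_rng[of "x n"] r(1) inf_pathsD[OF assms] by simp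
qed

lemma shift_shift:
  assumes "x \<in> inf_paths"
  shows "shift n (shift m x) = shift (m + n) x"
proof (rule HOL.sym, rule shift_eqI[OF assms])
  note s = inf_path_split[OF assms] and s' = inf_path_split[OF shift_closed[OF assms, of m]]
  fix k
  show "shift n (shift m x) k \<in> paths G" using s' by blast
  have "src G (x (m + n)) = src G (shift m x n)"
    unfolding s(4)[of m n] using s inf_pathsD[OF assms] by (intro src_cmp) auto
  then show "src G (x (m + n)) = rng G (shift n (shift m x) k)" using s'(3) by simp
  have "x (m + n + k) = cmp G (x m) (shift m x (n + k))" using s(4)[of m "n + k"] by (simp add: add.assoc)
  also have "\<dots> = cmp G (x m) (cmp G (shift m x n) (shift n (shift m x) k))" using s'(4) by simp
  also have "\<dots> = cmp G (cmp G (x m) (shift m x n)) (shift n (shift m x) k)"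
    using s s' inf_pathsD[OF assms] by (intro cmp_assoc[symmetric]) auto
  also have "\<dots> = cmp G (x (m + n)) (shift n (shift m x) k)" using s(4) by simp
  finally show "x (m + n + k) = cmp G (x (m + n)) (shift n (shift m x) k)" .
qed

lemma prepend_add:
  assumes "p \<in> paths G" "x \<in> inf_paths" "src G p = x 0"
  shows "prepend p x (deg G p + n) = cmp G p (x n)"
proof -
  note s = inf_path_split[OF assms(2)] and d = inf_pathsD[OF assms(2)] and r = inf_path_rng[OF assms(2)]
  have r': "rng G (shift n x (deg G p)) = src G (x n)" using s(3) by simp
  have "cmp G p (x (n + deg G p)) = cmp G (cmp G p (x n)) (shift n x (deg G p))"
    unfolding s(4) using s d r assms by (intro cmp_assoc[symmetric]) auto
  moreover have "deg G (cmp G p (x n)) = deg G p + n"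
    using deg_cmp[of p "x n"] assms d r by simp
  ultimately show ?thesis
    using pre_suf_cmp(1)[of "cmp G p (x n)" "shift n x (deg G p)"] assms r r' s d
    by (simp add: prepend_def cmp_closed src_cmp add.commute)
qed

lemma prepend_closed:
  assumes "p \<in> paths G" "x \<in> inf_paths" "src G p = x 0"
  shows "prepend p x \<in> inf_paths"
proof -
  note s = inf_path_split[OF assms(2)] and d = inf_pathsD[OF assms(2)] and r = inf_path_rng[OF assms(2)]
  have c: "cmp G p (x n) \<in> paths G" "n \<le> deg G (cmp G p (x n))" for n
    using assms d r by (auto simp: cmp_closed deg_cmp)
  have "pre (prepend p x (n + m)) n = prepend p x n" for n m
  proof -
    have "pre (prepend p x (n + m)) n = pre (cmp G p (x (n + m))) n"
      unfolding prepend_def using c[of "n + m"] by (intro pre_pre) auto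
    also have "cmp G p (x (n + m)) = cmp G (cmp G p (x n)) (shift n x m)"
      unfolding s(4) using s d r assms by (intro cmp_assoc[symmetric]) auto
    also have "pre \<dots> n = pre (cmp G p (x n)) n"
      using s d r assms c by (intro pre_cmp_le) (auto simp: src_cmp)
    finally show ?thesis by (simp add: prepend_def)
  qed
  then show ?thesis using c pre_suf by (simp add: inf_paths_def prepend_def)
qed

lemma shift_prepend:
  assumes "p \<in> paths G" "x \<in> inf_paths" "src G p = x 0"
  shows "shift (deg G p) (prepend p x) = x" "prepend p x (deg G p) = p" "prepend p x 0 = rng G p"
proof -
  note d = inf_pathsD[OF assms(2)] and r = inf_path_rng[OF assms(2)]
  have "prepend p x (deg G p + 0) = cmp G p (x 0)" by (rule prepend_add[OF assms])
  then show e: "prepend p x (deg G p) = p" using assms cmp_src[of p] by simp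
  show "shift (deg G p) (prepend p x) = x"
    using prepend_closed[OF assms] prepend_add[OF assms] d r e assms by (intro shift_eqI) auto
  show "prepend p x 0 = rng G p"
    using inf_path_rng(1)[OF prepend_closed[OF assms], of "deg G p"] e by simp
qed

lemma prepend_shift:
  assumes "x \<in> inf_paths"
  shows "prepend (x m) (shift m x) = x"
proof (rule inf_path_ext[of _ _ m])
  have *: "src G (x m) = shift m x 0" using shift_start[OF assms] by simp
  show "prepend (x m) (shift m x) \<in> inf_paths"
    using assms shift_closed inf_pathsD * by (intro prepend_closed) auto
  fix n
  show "prepend (x m) (shift m x) (m + n) = x (m + n)"
    using prepend_add[of "x m" "shift m x" n] assms shift_closed inf_pathsD[OF assms] *
      inf_path_split(4)[OF assms] by simp
qed fact

lemma prepend_prepend: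
  assumes "p \<in> paths G" "q \<in> paths G" "src G p = rng G q" "x \<in> inf_paths" "src G q = x 0"
  shows "prepend (cmp G p q) x = prepend p (prepend q x)"
proof (rule inf_path_ext[of _ _ "deg G (cmp G p q)"])
  have c: "cmp G p q \<in> paths G" "src G (cmp G p q) = x 0"
    using assms by (auto simp: cmp_closed src_cmp)
  show "prepend (cmp G p q) x \<in> inf_paths" using c assms by (intro prepend_closed) auto
  have q: "prepend q x \<in> inf_paths" "prepend q x 0 = rng G q"
    using assms prepend_closed shift_prepend by auto
  then show "prepend p (prepend q x) \<in> inf_paths" using assms by (intro prepend_closed) auto
  fix n
  have "prepend p (prepend q x) (deg G (cmp G p q) + n) = prepend p (prepend q x) (deg G p + (deg G q + n))"
    using assms by (simp add: deg_cmp add.assoc)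
  also have "\<dots> = cmp G p (cmp G q (x n))" using assms q by (simp add: prepend_add)
  also have "\<dots> = cmp G (cmp G p q) (x n)"
    using assms inf_pathsD inf_path_rng by (intro cmp_assoc[symmetric]) auto
  also have "\<dots> = prepend (cmp G p q) x (deg G (cmp G p q) + n)"
    using c assms by (intro prepend_add[symmetric]) auto
  finally show "prepend (cmp G p q) x (deg G (cmp G p q) + n) = prepend p (prepend q x) (deg G (cmp G p q) + n)" ..
qed

end

locale row_finite_k_graph = k_graph G for G :: "('a, 'k::finite) kgraph" +
  assumes row_finite: "row_finite_without_sources G"
begin

lemma finite_paths_from: "finite (paths_from G v n)"
proof (cases "v \<in> vertices G")
  case False
  then have "paths_from G v n = {}" by (auto simp: paths_from_def)
  then show ?thesis by simp
qed (use row_finite in \<open>simp add: row_finite_without_sources_def\<close>)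

lemma paths_from_nonempty: "v \<in> vertices G \<Longrightarrow> \<exists>p. p \<in> paths_from G v n"
  using row_finite by (auto simp: row_finite_without_sources_def)

text \<open>Without sources a path of degree (1,...,1) can always be appended. The resulting paths
  extend each other and their degrees are cofinal, so truncating them defines x at every
  degree.\<close>

lemma inf_path_exists:
  assumes "v \<in> vertices G"
  shows "\<exists>x\<in>inf_paths. x 0 = v"
proof -
  define y where "y = rec_nat v (\<lambda>j p. cmp G p (SOME e. e \<in> paths_from G (src G p) (diag 1)))"
  define e where "e j = (SOME e. e \<in> paths_from G (src G (y j)) (diag 1))" for j
  have y0: "y 0 = v" and ySuc: "y (Suc j) = cmp G (y j) (e j)" for j
    by (simp_all add: y_def e_def)
  have e_in: "e j \<in> paths_from G (src G (y j)) (diag 1)" if "src G (y j) \<in> vertices G" for j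
    unfolding e_def using paths_from_nonempty[OF that] by (rule someI_ex)
  have yj: "y j \<in> paths G \<and> deg G (y j) = diag j \<and> rng G (y j) = v \<and>
      e j \<in> paths G \<and> rng G (e j) = src G (y j) \<and> deg G (e j) = diag 1" for j
  proof (induction j)
    case 0
    have "e 0 \<in> paths_from G (src G (y 0)) (diag 1)"
      using vertexD[OF assms] assms by (intro e_in) (simp add: y0)
    then show ?case using vertexD[OF assms] by (simp add: y0 paths_from_def)
  next
    case (Suc j)
    have *: "y (Suc j) \<in> paths G"
      unfolding ySuc using Suc by (intro cmp_closed) auto
    then have "e (Suc j) \<in> paths_from G (src G (y (Suc j))) (diag 1)"
      by (intro e_in) simp
    moreover have "deg G (y (Suc j)) = diag (Suc j)" "rng G (y (Suc j)) = v"
      unfolding ySuc using Suc by (auto simp: deg_cmp rng_cmp cart_eq_iff)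
    ultimately show ?case using * by (simp add: paths_from_def)
  qed
  have y_pre: "pre (y (i + d)) (diag i) = y i" for i d
  proof (induction d)
    case 0
    show ?case using pre_suf_cmp(1)[of "y i" "src G (y i)"] yj[of i]
      by (simp add: cmp_src rng_src src_closed)
  next
    case (Suc d)
    have "pre (y (i + Suc d)) (diag i) = pre (y (i + d)) (diag i)"
      using yj[of "i + d"] by (simp add: ySuc pre_cmp_le diag_add)
    with Suc show ?case by simp
  qed
  have y_pre': "pre (y j) n = pre (y i) n" if "i \<le> j" "n \<le> diag i" for i j n
  proof -
    have "pre (y i) n = pre (pre (y j) (diag i)) n" using y_pre[of i "j - i"] that by simp
    then show ?thesis using that yj[of j] by (simp add: pre_pre diag_mono)
  qed
  \<comment> \<open>\<open>vec_total n\<close> is a stage whose diagonal degree dominates n; by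
    \<open>y_pre'\<close> every later stage gives the same segment.\<close>
  define x where "x n = pre (y (vec_total n)) n" for n
  have p: "x n \<in> paths G" "deg G (x n) = n" "rng G (x n) = v" for n
    using pre_suf[of "y (vec_total n)" n] rng_pre[of "y (vec_total n)" n] yj[of "vec_total n"]
    by (auto simp: x_def le_diag_vec_total)
  have "x \<in> inf_paths"
  proof -
    have "pre (x (n + m)) n = x n" for n m
    proof -
      have "pre (x (n + m)) n = pre (y (vec_total (n + m))) n"
        unfolding x_def using yj[of "vec_total (n + m)"] le_diag_vec_total[of "n + m"] by (intro pre_pre) auto
      then show ?thesis
        using y_pre'[OF vec_total_mono[OF nat_vec_le_add(1)[of n m]] le_diag_vec_total]
        by (simp add: x_def)
    qed
    then show ?thesis using p by (simp add: inf_paths_def)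
  qed
  moreover have "x 0 = v" using inf_path_rng(1)[OF \<open>x \<in> inf_paths\<close>, of 0] p(3)[of 0] by simp
  ultimately show ?thesis by blast
qed



section \<open>Rigid vertices and finiteness of the infinite path space\<close>

definition rigid :: "'a \<Rightarrow> bool" where
  "rigid u \<longleftrightarrow> u \<in> vertices G \<and> (\<forall>n. \<forall>p\<in>paths_from G u n. \<forall>q\<in>paths_from G u n. p = q)"

lemma rigidD:
  assumes "rigid u" "p \<in> paths G" "q \<in> paths G" "rng G p = u" "rng G q = u" "deg G p = deg G q"
  shows "p = q"
  using assms by (auto simp: rigid_def paths_from_def)

text \<open>Two paths of equal degree from s(p) become paths of equal degree from r(p) when composed
  with p; they then agree, and p cancels.\<close>

lemma rigid_src:
  assumes "rigid (rng G p)" "p \<in> paths G"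
  shows "rigid (src G p)"
proof -
  have "q = r" if "q \<in> paths G" "r \<in> paths G" "rng G q = src G p" "rng G r = src G p"
    "deg G q = deg G r" for q r
  proof -
    have "cmp G p q = cmp G p r"
      using assms that rigidD[OF assms(1), of "cmp G p q" "cmp G p r"]
      by (simp add: cmp_closed rng_cmp deg_cmp)
    then show ?thesis
      using factor_unique[OF assms(2) that(1) that(3)[symmetric] assms(2) that(2) that(4)[symmetric]] by blast
  qed
  then show ?thesis using src_vertex[OF assms(2)] unfolding rigid_def paths_from_def by blast
qed

lemma rigid_inf_path_unique:
  assumes "rigid u" "x \<in> inf_paths" "y \<in> inf_paths" "x 0 = u" "y 0 = u"
  shows "x = y"
proof
  fix n
  show "x n = y n"
    using inf_pathsD(1,2)[OF assms(2)] inf_pathsD(1,2)[OF assms(3)]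
      inf_path_rng(1)[OF assms(2)] inf_path_rng(1)[OF assms(3)] assms(4,5)
      rigidD[OF assms(1), of "x n" "y n"]
    by simp
qed

lemma HNE_pre:
  assumes "condition_HNE G" "is_loop G x" "q \<in> paths G" "rng G q = rng G x" "deg G q \<le> deg G x"
  shows "pre x (deg G q) = q"
proof -
  have "\<not> is_entrance G x q" using assms by (auto simp: condition_HNE_def)
  then show ?thesis using assms segment_0 by (auto simp: is_entrance_def is_loop_def)
qed

fun loop_power :: "'a \<Rightarrow> nat \<Rightarrow> 'a" where
  "loop_power x 0 = rng G x"
| "loop_power x (Suc j) = cmp G x (loop_power x j)"

lemma loop_power:
  assumes "is_loop G x"
  shows "loop_power x j \<in> paths G \<and> rng G (loop_power x j) = rng G x \<and>
    src G (loop_power x j) = rng G x \<and> (\<forall>i. vec_nth (deg G (loop_power x j)) i = j * vec_nth (deg G x) i)"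
  using assms
  by (induction j) (auto simp: is_loop_def src_closed rng_src src_src deg_src cmp_closed rng_cmp
      src_cmp deg_cmp)

text \<open>Powers of x are again loops, so without entrance, and since every coordinate of d(x) is
  positive they dominate every degree n. A path of degree n from the base vertex is forced to be an
  initial segment of such a power.\<close>

lemma HNE_loop_rigid:
  assumes "condition_HNE G" "is_loop G x" "\<And>i. 0 < vec_nth (deg G x) i"
  shows "rigid (rng G x)"
proof -
  have "q = pre (loop_power x (vec_total n)) n" if "q \<in> paths_from G (rng G x) n" for q n
  proof -
    \<comment> \<open>This exponent suffices: each coordinate of n is at most
      \<open>vec_total n\<close>, and each coordinate of d(x) is at least 1.\<close>
    let ?l = "loop_power x (vec_total n)"
    note l = loop_power[OF assms(2), of "vec_total n"]
    have "n \<le> deg G ?l"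
      unfolding cart_le_iff
    proof
      fix i
      have "vec_nth n i \<le> vec_total n" using le_diag_vec_total[of n]
        by (simp add: cart_le_iff)
      also have "\<dots> \<le> vec_total n * vec_nth (deg G x) i" using assms(3)[of i] by simp
      finally show "vec_nth n i \<le> vec_nth (deg G ?l) i" using l by simp
    qed
    then show ?thesis
      using HNE_pre[OF assms(1), of ?l q] l that by (simp add: is_loop_def paths_from_def)
  qed
  then show ?thesis using assms(2) rng_vertex unfolding rigid_def is_loop_def by blast
qed

text \<open>At the diagonal degrees 0, ..., \<open>card (vertices G)\<close> the path passes one
  vertex more than there are, so two agree. The segment between them is a loop of degree (j - i,
  ..., j - i), positive in every coordinate; its base is rigid, and rigidity spreads to the end of
  p.\<close>

lemma HNE_long_path_rigid:
  assumes "condition_HNE G" "finite (vertices G)" "p \<in> paths G" "diag (card (vertices G)) \<le> deg G p"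
  shows "rigid (src G p)"
proof -
  define f where "f j = src G (pre p (diag j))" for j
  have le: "diag j \<le> deg G p" if "j \<le> card (vertices G)" for j
    using that assms(4) order.trans[OF diag_mono[OF that]] by blast
  note P = pre_suf[OF assms(3) le]
  have "f ` {..card (vertices G)} \<subseteq> vertices G" using P(1) by (auto simp: f_def)
  then have "\<not> inj_on f {..card (vertices G)}"
    using card_inj_on_le[of f "{..card (vertices G)}" "vertices G"] assms(2) by auto
  then obtain i j where ij: "i < j" "j \<le> card (vertices G)" "f i = f j"
    unfolding inj_on_def by (metis atMost_iff nat_neq_iff)
  define l where "l = suf (pre p (diag j)) (diag i)"
  have Pj: "pre p (diag j) \<in> paths G" "deg G (pre p (diag j)) = diag j"
    "diag i \<le> deg G (pre p (diag j))"
    using P[OF ij(2)] ij(1) by (auto intro: diag_mono)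
  have "pre (pre p (diag j)) (diag i) = pre p (diag i)"
    using assms(3) le[OF ij(2)] ij(1) by (intro pre_pre) (auto intro: diag_mono)
  then have l: "l \<in> paths G" "rng G l = f i" "src G l = f j" "deg G l = diag j - diag i"
    using pre_suf[OF Pj(1,3)] src_suf[OF Pj(1,3)] Pj(2) by (simp_all add: l_def f_def)
  have "rigid (rng G l)"
    using assms(1) l ij by (intro HNE_loop_rigid) (auto simp: is_loop_def)
  then have "rigid (rng G (suf p (diag j)))"
    using l(2) ij(3) P(5)[OF ij(2)] by (simp add: f_def)
  then show ?thesis
    using rigid_src[OF _ P(2)[OF ij(2)]] unfolding src_suf[OF assms(3) le[OF ij(2)]] by blast
qed

text \<open>The initial segment of degree \<open>?N\<close> ends at a rigid vertex, which leaves no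
  choice for the rest; and there are only finitely many segments of that degree.\<close>

lemma HNE_finite_inf_paths:
  assumes "condition_HNE G" "finite (vertices G)"
  shows "finite inf_paths"
proof (rule inj_on_finite)
  let ?N = "diag (card (vertices G)) :: nat ^ 'k"
  show "inj_on (\<lambda>x. x ?N) inf_paths"
  proof (rule inj_onI)
    fix x y assume *: "x \<in> inf_paths" "y \<in> inf_paths" "x ?N = y ?N"
    have "rigid (src G (x ?N))"
      using inf_pathsD[OF *(1)] by (intro HNE_long_path_rigid[OF assms]) auto
    then have sh: "shift ?N x = shift ?N y"
      by (rule rigid_inf_path_unique[OF _ shift_closed[OF *(1)] shift_closed[OF *(2)] shift_start[OF *(1)]])
        (simp add: shift_start[OF *(2)] *(3))
    have "x = prepend (x ?N) (shift ?N x)" by (simp only: prepend_shift[OF *(1)])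
    also have "\<dots> = y" by (simp only: sh *(3) prepend_shift[OF *(2)])
    finally show "x = y" .
  qed
  show "(\<lambda>x. x ?N) ` inf_paths \<subseteq> (\<Union>v\<in>vertices G. paths_from G v ?N)"
    using inf_pathsD inf_path_rng by (auto simp: paths_from_def)
  show "finite (\<Union>v\<in>vertices G. paths_from G v ?N)"
    using assms(2) finite_paths_from by blast
qed

end

section \<open>The talented monoid\<close>

definition int_vec :: "nat ^ 'n::finite \<Rightarrow> int ^ 'n" where
  "int_vec n = (\<chi> i. int (vec_nth n i))"

lemma int_vec_nth [simp]: "vec_nth (int_vec n) i = int (vec_nth n i)"
  by (simp add: int_vec_def)

lemma int_vec_add: "int_vec (n + m) = int_vec n + int_vec m"
  by (simp add: cart_eq_iff)

lemma int_vec_0 [simp]: "int_vec 0 = 0"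
  by (simp add: cart_eq_iff)

lemma int_vec_axis [simp]: "int_vec (axis i n) = axis i (int n)"
  by (simp add: cart_eq_iff axis_def)

lemma axis_add: "axis i a + axis i b = (axis i (a + b) :: 'b::comm_monoid_add ^ 'n::finite)"
  by (simp add: cart_eq_iff axis_def)

lemma sum_axis: "(\<Sum>i\<in>UNIV. axis i (vec_nth x i)) = (x :: 'b::comm_monoid_add ^ 'n::finite)"
proof -
  have "(\<Sum>i\<in>UNIV. vec_nth (axis i (vec_nth x i)) j) = vec_nth x j" for j
  proof -
    have "(\<Sum>i\<in>UNIV. vec_nth (axis i (vec_nth x i)) j) = (\<Sum>i\<in>UNIV. if i = j then vec_nth x i else 0)"
      by (intro sum.cong) (auto simp: axis_def)
    then show ?thesis by (simp only: sum.delta' finite_class.finite_UNIV) simp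
  qed
  then show ?thesis by (simp only: cart_eq_iff sum_component) simp
qed

lemma nat_vec_induct [case_names zero axis_add]:
  fixes p :: "nat ^ 'n::finite"
  assumes "P 0" "\<And>i q. P q \<Longrightarrow> P (axis i 1 + q)"
  shows "P p"
proof (induction "vec_total p" arbitrary: p)
  case 0
  then have "p = 0" by (simp add: vec_total_def cart_eq_iff)
  then show ?case using assms(1) by simp
next
  case (Suc t)
  then obtain i where i: "vec_nth p i \<noteq> 0" by (fastforce simp: vec_total_def)
  define q where "q = (\<chi> j. if j = i then vec_nth p j - 1 else vec_nth p j)"
  have p: "p = axis i 1 + q"
    using i by (auto simp: cart_eq_iff axis_def q_def)
  have "vec_total (axis i 1 + q) = 1 + vec_total q"
    by (simp add: vec_total_def sum.distrib axis_def)
  then have "t = vec_total q" using Suc(2) p by simp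
  then show ?case using Suc(1) assms(2) p by blast
qed

section \<open>Translation and expansion of multisets of symbols\<close>

text \<open>The action on representatives; \<open>talented_action\<close> is the image of a whole
  class under this map.\<close>

definition translate :: "int ^ 'k \<Rightarrow> ('a \<times> (int ^ 'k::finite)) multiset \<Rightarrow> ('a \<times> (int ^ 'k)) multiset" where
  "translate q M = image_mset (\<lambda>(v, n). (v, n + q)) M"

lemma translate_simps [simp]:
  "translate q {#} = {#}" "translate q (M + N) = translate q M + translate q N"
  "translate q {#(v, n)#} = {#(v, n + q)#}"
  by (simp_all add: translate_def)

lemma translate_add: "translate q (translate r M) = translate (r + q) M"
  by (simp add: translate_def image_mset.compositionality comp_def case_prod_unfold add.assoc)

lemma translate_0 [simp]: "translate 0 M = M"
  by (simp add: translate_def)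

lemma translate_sum: "translate q (sum f S) = (\<Sum>x\<in>S. translate q (f x))"
  by (induction S rule: infinite_finite_induct) auto

lemma set_translate: "set_mset (translate q M) \<subseteq> V \<times> UNIV \<longleftrightarrow> set_mset M \<subseteq> V \<times> UNIV"
  by (auto simp: translate_def)

lemma set_mset_sum_subset:
  "(\<And>x. x \<in> S \<Longrightarrow> set_mset (f x) \<subseteq> A) \<Longrightarrow> set_mset (sum f S) \<subseteq> A"
  by (induction S rule: infinite_finite_induct) auto

lemma talented_eq_sum:
  assumes "\<And>x. x \<in> S \<Longrightarrow> talented_eq G (f x) (g x)"
  shows "talented_eq G (sum f S) (sum g S)"
  using assms by (induction S rule: infinite_finite_induct) (auto intro: talented_eq.intros)

lemma talented_eq_translate: "talented_eq G M N \<Longrightarrow> talented_eq G (translate q M) (translate q N)"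
proof (induction rule: talented_eq.induct)
  case (relation v n i)
  then show ?case
    using talented_eq.relation[of v G "n + q" i] by (simp add: translate_sum ac_simps)
qed (auto intro: talented_eq.intros)

lemma talented_eq_translate_period:
  assumes "talented_eq G M (translate q M)" "talented_eq G M (translate r M)"
  shows "talented_eq G M (translate (q + r) M)"
  using talented_eq.trans[OF assms(2) talented_eq_translate[OF assms(1)]] by (simp add: translate_add)

lemma talented_eq_translate_multiple:
  assumes "talented_eq G M (translate (axis i (int n)) M)"
  shows "talented_eq G M (translate (axis i (int (n * j))) M)"
proof (induction j)
  case 0
  have "axis i (0::int) = 0" by (simp add: cart_eq_iff axis_def)
  then show ?case by (simp only: mult_0_right of_nat_0 translate_0 talented_eq.refl)
next
  case (Suc j)
  then show ?case
    using talented_eq_translate_period[OF assms Suc] by (simp add: axis_add)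
qed

context row_finite_k_graph
begin

text \<open>Unique factorization is a bijection with the composable pairs of degrees p and q. The
  target monoid is left open because the identity serves both for multisets of symbols and for
  numbers of paths.\<close>

lemma sum_paths_from_add:
  fixes f :: "'a \<Rightarrow> 'c::comm_monoid_add"
  shows "(\<Sum>z\<in>paths_from G v (p + q). f z) =
    (\<Sum>x\<in>paths_from G v p. \<Sum>y\<in>paths_from G (src G x) q. f (cmp G x y))"
proof -
  let ?S = "Sigma (paths_from G v p) (\<lambda>x. paths_from G (src G x) q)"
  have "(\<Sum>z\<in>paths_from G v (p + q). f z) = (\<Sum>(x, y)\<in>?S. f (cmp G x y))"
  proof (rule sum.reindex_bij_witness[of _ "\<lambda>(x, y). cmp G x y" "\<lambda>z. (pre z p, suf z p)"])
    fix z assume z: "z \<in> paths_from G v (p + q)"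
    then have "z \<in> paths G" "p \<le> deg G z" by (auto simp: paths_from_def)
    note * = pre_suf[OF this] rng_pre[OF this]
    show "(case (pre z p, suf z p) of (x, y) \<Rightarrow> cmp G x y) = z" using * by simp
    show "(pre z p, suf z p) \<in> ?S" using * z by (simp add: paths_from_def)
    show "(case (pre z p, suf z p) of (x, y) \<Rightarrow> f (cmp G x y)) = f z" using * by simp
  next
    fix w assume "w \<in> ?S"
    then obtain x y where w: "w = (x, y)" "x \<in> paths G" "y \<in> paths G" "src G x = rng G y"
      "deg G x = p" "deg G y = q" "rng G x = v" by (auto simp: paths_from_def)
    show "(pre (case w of (x, y) \<Rightarrow> cmp G x y) p, suf (case w of (x, y) \<Rightarrow> cmp G x y) p) = w"
      using w pre_suf_cmp[of x y] by simp
    show "(case w of (x, y) \<Rightarrow> cmp G x y) \<in> paths_from G v (p + q)"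
      using w by (simp add: paths_from_def cmp_closed rng_cmp deg_cmp)
  qed
  then show ?thesis by (simp add: sum.Sigma finite_paths_from)
qed

lemma paths_from_0:
  assumes "v \<in> vertices G"
  shows "paths_from G v 0 = {v}"
  using vertexD[OF assms] identity_of_deg_0 by (auto simp: paths_from_def)

text \<open>The defining relations expand by one edge; induction over unit vectors, with the paths
  regrouped by \<open>sum_paths_from_add\<close>, reaches every degree.\<close>

lemma talented_eq_expand:
  assumes "v \<in> vertices G"
  shows "talented_eq G {#(v, n)#} (\<Sum>x\<in>paths_from G v p. {#(src G x, n + int_vec p)#})"
  using assms
proof (induction p arbitrary: v n rule: nat_vec_induct)
  case zero
  then show ?case using vertexD by (simp add: paths_from_0 talented_eq.refl)
next
  case (axis_add i q)
  have "talented_eq G (\<Sum>x\<in>paths_from G v (axis i 1). {#(src G x, n + axis i 1)#})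
    (\<Sum>x\<in>paths_from G v (axis i 1). \<Sum>y\<in>paths_from G (src G x) q. {#(src G y, n + axis i 1 + int_vec q)#})"
    using axis_add(1) src_vertex by (intro talented_eq_sum) (auto simp: paths_from_def)
  also have "(\<Sum>x\<in>paths_from G v (axis i 1). \<Sum>y\<in>paths_from G (src G x) q. {#(src G y, n + axis i 1 + int_vec q)#})
     = (\<Sum>x\<in>paths_from G v (axis i 1). \<Sum>y\<in>paths_from G (src G x) q.
         {#(src G (cmp G x y), n + int_vec (axis i 1 + q))#})"
    by (intro sum.cong HOL.refl) (auto simp: paths_from_def src_cmp int_vec_add add.assoc)
  finally show ?case
    unfolding sum_paths_from_add by (rule talented_eq.trans[OF talented_eq.relation[OF axis_add(2)]])
qed

section \<open>Counting continuations\<close>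

text \<open>Counts the ways to continue the symbols of M up to level m: v(n) contributes the paths
  from v of degree m - n. Negative coordinates are truncated to 0 by \<open>nat\<close>, so the
  number is meaningful only for m above all n.\<close>

definition path_count :: "int ^ 'k \<Rightarrow> ('a \<times> (int ^ 'k)) multiset \<Rightarrow> nat" where
  "path_count m M = (\<Sum>(v, n)\<in>#M. card (paths_from G v (\<chi> i. nat (vec_nth (m - n) i))))"

lemma path_count_add: "path_count m (M + N) = path_count m M + path_count m N"
  by (simp add: path_count_def)

lemma path_count_sum: "path_count m (sum f S) = (\<Sum>x\<in>S. path_count m (f x))"
  by (induction S rule: infinite_finite_induct) (auto simp: path_count_add path_count_def[of _ "{#}"])

lemma path_count_pos:
  assumes "set_mset M \<subseteq> vertices G \<times> UNIV" "M \<noteq> {#}"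
  shows "0 < path_count m M"
proof -
  obtain v n where "(v, n) \<in># M" using assms(2) by auto
  then obtain N where "M = add_mset (v, n) N" "v \<in> vertices G"
    using assms(1) by (auto dest: multi_member_split)
  then show ?thesis
    using paths_from_nonempty[of v] finite_paths_from by (auto simp: path_count_def card_gt_0_iff)
qed

text \<open>The number of paths leaving a multiset is an invariant of the talented monoid in high degrees
  only: the relation at \<open>v(n)\<close> needs room for one more edge.\<close>

lemma path_count_eventually_invariant:
  assumes "talented_eq G M N"
  shows "\<exists>b. \<forall>m. (\<forall>i. b \<le> vec_nth m i) \<longrightarrow> path_count m M = path_count m N"
  using assms
proof (induction rule: talented_eq.induct)
  case (relation v n j)
  define b where "b = Max (range (\<lambda>i. vec_nth n i + 1))"
  have "path_count m {#(v, n)#} = path_count m (\<Sum>x\<in>paths_from G v (axis j 1). {#(src G x, n + axis j 1)#})"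
    if "\<forall>i. b \<le> vec_nth m i" for m
  proof -
    have n: "vec_nth n i + 1 \<le> vec_nth m i" for i
      using that Max_ge[of "range (\<lambda>i. vec_nth n i + 1)" "vec_nth n i + 1"] b_def
      by (meson finite_class.finite_UNIV finite_imageI order_trans rangeI)
    define q :: "nat ^ 'k" where "q = (\<chi> i. nat (vec_nth (m - (n + axis j 1)) i))"
    have "nat (vec_nth (m - n) i) = vec_nth (axis j 1 + q) i" for i
    proof (cases "i = j")
      case True
      have "nat (vec_nth m i - vec_nth n i) = 1 + nat (vec_nth m i - (vec_nth n i + 1))"
        using n[of i] by linarith
      then show ?thesis using True by (simp add: axis_def q_def)
    next
      case False
      then show ?thesis by (simp add: axis_def q_def)
    qed
    then have "(\<chi> i. nat (vec_nth (m - n) i)) = axis j 1 + q"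
      by (simp only: cart_eq_iff vec_lambda_beta) simp
    then have "path_count m {#(v, n)#} = card (paths_from G v (axis j 1 + q))"
      by (simp add: path_count_def)
    also have "\<dots> = (\<Sum>x\<in>paths_from G v (axis j 1). card (paths_from G (src G x) q))"
      using sum_paths_from_add[of "\<lambda>_. 1::nat" v "axis j 1" q] by simp
    also have "\<dots> = path_count m (\<Sum>x\<in>paths_from G v (axis j 1). {#(src G x, n + axis j 1)#})"
      unfolding path_count_sum by (simp add: path_count_def q_def)
    finally show ?thesis .
  qed
  then show ?case by blast
next
  case (trans x y z)
  then obtain b c where "\<forall>m. (\<forall>i. b \<le> vec_nth m i) \<longrightarrow> path_count m x = path_count m y"
    "\<forall>m. (\<forall>i. c \<le> vec_nth m i) \<longrightarrow> path_count m y = path_count m z" by blast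
  then have "\<forall>m. (\<forall>i. max b c \<le> vec_nth m i) \<longrightarrow> path_count m x = path_count m z" by simp
  then show ?case by blast
next
  case (add x x' y y')
  then obtain b c where "\<forall>m. (\<forall>i. b \<le> vec_nth m i) \<longrightarrow> path_count m x = path_count m x'"
    "\<forall>m. (\<forall>i. c \<le> vec_nth m i) \<longrightarrow> path_count m y = path_count m y'" by blast
  then have "\<forall>m. (\<forall>i. max b c \<le> vec_nth m i) \<longrightarrow> path_count m (x + y) = path_count m (x' + y')"
    by (simp add: path_count_add)
  then show ?case by blast
next
  case (sym x y)
  then show ?case by metis
qed auto

text \<open>At a high level M and M + N have the same count, so N has count 0; but without sources
  every symbol has a continuation to every level.\<close>

lemma talented_eq_cancel:
  assumes "talented_eq G M (M + N)" "set_mset N \<subseteq> vertices G \<times> UNIV"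
  shows "N = {#}"
proof (rule ccontr)
  assume "N \<noteq> {#}"
  obtain b where "\<forall>m. (\<forall>i. b \<le> vec_nth m i) \<longrightarrow> path_count m M = path_count m (M + N)"
    using path_count_eventually_invariant[OF assms(1)] by blast
  then have "path_count (\<chi> i. b) N = 0" by (simp add: path_count_add)
  then show False using path_count_pos[OF assms(2) \<open>N \<noteq> {#}\<close>, of "\<chi> i. b"] by simp
qed

section \<open>A loop with an entrance contradicts periodicity\<close>

text \<open>Without sources the entrance y can be prolonged to the full degree of the loop; its
  initial segment y still distinguishes it from x.\<close>

lemma entrance_extend:
  assumes "is_loop G x" "is_entrance G x y"
  shows "\<exists>z\<in>paths_from G (rng G x) (deg G x). z \<noteq> x"
proof -
  have y: "y \<in> paths G" "rng G y = rng G x" "deg G y \<le> deg G x" "segment G x 0 (deg G y) \<noteq> y" "x \<in> paths G"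
    using assms by (auto simp: is_loop_def is_entrance_def)
  obtain e where e: "e \<in> paths G" "rng G e = src G y" "deg G e = deg G x - deg G y"
    using paths_from_nonempty[OF src_vertex[OF y(1)], of "deg G x - deg G y"] by (auto simp: paths_from_def)
  have "pre (cmp G y e) (deg G y) = y" using pre_suf_cmp y e by simp
  then have "cmp G y e \<noteq> x" using y segment_0[of x "deg G y"] by auto
  moreover have "cmp G y e \<in> paths_from G (rng G x) (deg G x)"
    using y e by (simp add: paths_from_def cmp_closed rng_cmp deg_cmp nat_vec_add_diff)
  ultimately show ?thesis by blast
qed

lemma talented_rel_equiv: "equiv {M. set_mset M \<subseteq> vertices G \<times> UNIV} (talented_rel G)"
  by (rule equivI) (auto simp: talented_rel_def refl_on_def sym_def trans_def intro: talented_eq.intros)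

text \<open>Among the paths of degree d(x) from the base vertex the loop x contributes the
  translated symbol; the rest is D, which contains the symbol of the prolonged entrance.\<close>

lemma talented_eq_loop_expand:
  assumes "is_loop G x" "is_entrance G x y"
  shows "\<exists>D. D \<noteq> {#} \<and> set_mset D \<subseteq> vertices G \<times> UNIV \<and>
    talented_eq G {#(rng G x, 0)#} (translate (int_vec (deg G x)) {#(rng G x, 0)#} + D)"
proof -
  have x: "x \<in> paths G" "rng G x = src G x" using assms(1) by (auto simp: is_loop_def)
  obtain z where z: "z \<in> paths_from G (rng G x) (deg G x)" "z \<noteq> x" using entrance_extend[OF assms] by blast
  let ?f = "\<lambda>u. {#(src G u, int_vec (deg G x))#}"
  define D where "D = (\<Sum>u\<in>paths_from G (rng G x) (deg G x) - {x}. ?f u)"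
  have "talented_eq G {#(rng G x, 0)#} (\<Sum>u\<in>paths_from G (rng G x) (deg G x). ?f u)"
    using talented_eq_expand[OF rng_vertex[OF x(1)], of 0 "deg G x"] by simp
  also have "(\<Sum>u\<in>paths_from G (rng G x) (deg G x). ?f u) = ?f x + D"
    unfolding D_def using x by (intro sum.remove finite_paths_from) (auto simp: paths_from_def)
  finally have "talented_eq G {#(rng G x, 0)#} (translate (int_vec (deg G x)) {#(rng G x, 0)#} + D)"
    using x by simp
  moreover have "D = ?f z + (\<Sum>u\<in>paths_from G (rng G x) (deg G x) - {x} - {z}. ?f u)"
    unfolding D_def using z finite_paths_from by (intro sum.remove) auto
  then have "D \<noteq> {#}" by simp
  moreover have "set_mset D \<subseteq> vertices G \<times> UNIV"
    unfolding D_def by (rule set_mset_sum_subset) (auto simp: paths_from_def)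
  ultimately show ?thesis by blast
qed

text \<open>Periods are known along the axes only, and d(x) itself need not be composed of them, so
  the loop is run through N times. Each further round adds a translate of the remainder, and a sum
  of multisets with a nonempty summand is nonempty.\<close>

lemma talented_eq_entrance:
  assumes "is_loop G x" "is_entrance G x y" "0 < N"
  shows "\<exists>C. C \<noteq> {#} \<and> set_mset C \<subseteq> vertices G \<times> UNIV \<and>
    talented_eq G {#(rng G x, 0)#} (translate (\<chi> i. int N * int (vec_nth (deg G x) i)) {#(rng G x, 0)#} + C)"
  using assms(3)
proof (induction N rule: nat_induct_non_zero)
  case 1
  show ?case using talented_eq_loop_expand[OF assms(1,2)] by (simp add: int_vec_def)
next
  case (Suc N)
  let ?A = "{#(rng G x, 0)#} :: ('a \<times> (int ^ 'k)) multiset"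
  let ?P = "\<lambda>N. (\<chi> i. int N * int (vec_nth (deg G x) i)) :: int ^ 'k"
  from Suc obtain C where C: "C \<noteq> {#}" "set_mset C \<subseteq> vertices G \<times> UNIV"
    "talented_eq G ?A (translate (?P N) ?A + C)" by blast
  obtain D where D: "set_mset D \<subseteq> vertices G \<times> UNIV"
    "talented_eq G ?A (translate (int_vec (deg G x)) ?A + D)"
    using talented_eq_loop_expand[OF assms(1,2)] by blast
  from talented_eq_translate[OF D(2), of "?P N"]
  have "talented_eq G (translate (?P N) ?A) (translate (int_vec (deg G x) + ?P N) ?A + translate (?P N) D)"
    by (simp only: translate_simps(2) translate_add)
  moreover have "int_vec (deg G x) + ?P N = ?P (Suc N)"
    by (simp add: cart_eq_iff algebra_simps)
  ultimately have "talented_eq G (translate (?P N) ?A + C) (translate (?P (Suc N)) ?A + translate (?P N) D + C)"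
    by (intro talented_eq.add talented_eq.refl) simp
  then have "talented_eq G ?A (translate (?P (Suc N)) ?A + (translate (?P N) D + C))"
    using talented_eq.trans[OF C(3)] by (simp only: add.assoc)
  moreover have "set_mset (translate (?P N) D + C) \<subseteq> vertices G \<times> UNIV"
    using C(2) D(1) by (simp add: set_translate)
  moreover have "translate (?P N) D + C \<noteq> {#}" using C(1) by simp
  ultimately show ?case by blast
qed

lemma talented_periodic_imp_HNE:
  assumes "talented_periodic G"
  shows "condition_HNE G"
  unfolding condition_HNE_def
proof
  assume "\<exists>x y. is_loop G x \<and> is_entrance G x y"
  then obtain x y where xy: "is_loop G x" "is_entrance G x y" by blast
  let ?A = "{#(rng G x, 0)#} :: ('a \<times> (int ^ 'k)) multiset"
  have A: "set_mset ?A \<subseteq> vertices G \<times> UNIV" using xy by (auto simp: is_loop_def rng_vertex)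
  let ?a = "talented_rel G `` {?A}"
  have "?a \<in> carrier (talented_monoid G)"
    using A by (auto simp: talented_monoid_def intro: quotientI)
  moreover have "?a \<noteq> \<one>\<^bsub>talented_monoid G\<^esub>"
  proof
    assume "?a = \<one>\<^bsub>talented_monoid G\<^esub>"
    then have "(?A, {#}) \<in> talented_rel G"
      using eq_equiv_class[OF _ talented_rel_equiv, of ?A "{#}"] by (simp add: talented_monoid_def)
    then have "talented_eq G {#} ({#} + ?A)" by (auto simp: talented_rel_def intro: talented_eq.sym)
    then show False using talented_eq_cancel[OF _ A, of "{#}"] by auto
  qed
  ultimately have "\<forall>i. \<exists>n. n \<noteq> 0 \<and> talented_action (axis i (int n)) ?a = ?a"
    using assms by (auto simp: talented_periodic_def)
  then obtain n where n: "\<And>i. n i \<noteq> (0::nat)" "\<And>i. talented_action (axis i (int (n i))) ?a = ?a" by metis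
  have per: "talented_eq G ?A (translate (axis i (int (n i))) ?A)" for i
  proof -
    have "?A \<in> ?a" using A by (auto simp: talented_rel_def intro: talented_eq.refl)
    then have "translate (axis i (int (n i))) ?A \<in> ?a"
      using n(2)[of i] unfolding talented_action_def translate_def by blast
    then show ?thesis by (auto simp: talented_rel_def)
  qed
  \<comment> \<open>The product of the axis periods makes every coordinate of N d(x) a multiple of
    the period of its axis, so translation by N d(x) fixes the symbol.\<close>
  define N where "N = (\<Prod>i\<in>UNIV. n i)"
  let ?P = "(\<chi> i. int N * int (vec_nth (deg G x) i)) :: int ^ 'k"
  have dvd: "n i dvd N * vec_nth (deg G x) i" for i unfolding N_def by (simp add: dvd_prodI)
  have sums: "talented_eq G ?A (translate (\<Sum>i\<in>S. axis i (vec_nth ?P i)) ?A)" for S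
  proof (induction S rule: infinite_finite_induct)
    case (insert i S)
    obtain j where "N * vec_nth (deg G x) i = n i * j" using dvd[of i] by (auto simp: dvd_def)
    then have "vec_nth ?P i = int (n i * j)" by (simp flip: of_nat_mult)
    then have "talented_eq G ?A (translate (axis i (vec_nth ?P i)) ?A)"
      using talented_eq_translate_multiple[OF per] by metis
    from talented_eq_translate_period[OF this insert(3)] show ?case using insert(1,2) by simp
  qed (auto intro: talented_eq.refl)
  have period: "talented_eq G ?A (translate ?P ?A)" using sums[of UNIV] unfolding sum_axis .
  have "0 < N" using n(1) by (simp add: N_def)
  then obtain C where C: "C \<noteq> {#}" "set_mset C \<subseteq> vertices G \<times> UNIV" "talented_eq G ?A (translate ?P ?A + C)"
    using talented_eq_entrance[OF xy] by blast
  have "talented_eq G (translate ?P ?A) (translate ?P ?A + C)"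
    by (rule talented_eq.trans[OF talented_eq.sym[OF period] C(3)])
  then show False using talented_eq_cancel C by blast
qed

section \<open>Axis periods from rigid vertices\<close>

definition has_period :: "'k \<Rightarrow> ('a \<times> (int ^ 'k)) multiset \<Rightarrow> bool" where
  "has_period i M \<longleftrightarrow> (\<exists>n>0. talented_eq G M (translate (axis i (int n)) M))"

text \<open>The product of two periods is a period of both summands.\<close>

lemma has_period_add:
  assumes "has_period i M" "has_period i N"
  shows "has_period i (M + N)"
proof -
  obtain m n where "m > 0" "n > 0" "talented_eq G M (translate (axis i (int m)) M)"
    "talented_eq G N (translate (axis i (int n)) N)" using assms by (auto simp: has_period_def)
  then have "talented_eq G (M + N) (translate (axis i (int (m * n))) (M + N))"
    using talented_eq_translate_multiple[of G M i m n] talented_eq_translate_multiple[of G N i n m]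
    by (auto simp: mult.commute intro: talented_eq.add)
  then show ?thesis using \<open>m > 0\<close> \<open>n > 0\<close> by (auto simp: has_period_def intro!: exI[of _ "m * n"])
qed

lemma has_period_empty: "has_period i {#}"
  by (auto simp: has_period_def intro: talented_eq.refl)

lemma has_period_sum: "(\<And>x. x \<in> S \<Longrightarrow> has_period i (f x)) \<Longrightarrow> has_period i (sum f S)"
  by (induction S rule: infinite_finite_induct) (auto intro: has_period_add has_period_empty)

lemma has_period_cong:
  assumes "talented_eq G M N" "has_period i N"
  shows "has_period i M"
proof -
  obtain n where n: "n > 0" "talented_eq G N (translate (axis i (int n)) N)"
    using assms(2) unfolding has_period_def by blast
  have "talented_eq G (translate (axis i (int n)) N) (translate (axis i (int n)) M)"
    by (rule talented_eq_translate[OF talented_eq.sym[OF assms(1)]])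
  then have "talented_eq G M (translate (axis i (int n)) M)"
    using talented_eq.trans[OF talented_eq.trans[OF assms(1) n(2)]] by blast
  then show ?thesis using n(1) unfolding has_period_def by blast
qed

lemma talented_eq_rigid:
  assumes "p \<in> paths G" "rigid (rng G p)"
  shows "talented_eq G {#(rng G p, n)#} {#(src G p, n + int_vec (deg G p))#}"
proof -
  have "paths_from G (rng G p) (deg G p) = {p}"
    using assms by (auto simp: rigid_def paths_from_def)
  then show ?thesis
    using talented_eq_expand[OF rng_vertex[OF assms(1)], of n "deg G p"] by simp
qed

text \<open>In direction i the infinite path from u meets finitely many vertices, so it returns:
  \<open>w j = w l\<close>. The segment in between is the only path of its degree from the rigid
  vertex \<open>w j\<close>, so expansion identifies a symbol at \<open>w j\<close> with its
  translate by l - j; and the symbol at u equals one at \<open>w j\<close>.\<close>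

lemma has_period_rigid:
  assumes "rigid u" "finite (vertices G)"
  shows "has_period i {#(u, n)#}"
proof -
  obtain x where x: "x \<in> inf_paths" "x 0 = u"
    using inf_path_exists[of u] assms(1) by (auto simp: rigid_def)
  define w where "w j = src G (x (axis i j))" for j
  have "range w \<subseteq> vertices G" using inf_pathsD[OF x(1)] by (auto simp: w_def)
  then have "\<not> inj w" using assms(2) finite_imageD[of w UNIV] finite_subset by fastforce
  then obtain j l where jl: "j < l" "w j = w l" unfolding inj_def by (metis nat_neq_iff)
  note s = inf_path_split[OF x(1), of "axis i j"] and d = inf_pathsD[OF x(1)]
  have r: "rng G (x (axis i j)) = u" using inf_path_rng(1)[OF x(1)] x(2) by simp
  have l: "axis i l = axis i j + axis i (l - j)" using jl by (simp add: axis_add)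
  let ?p = "shift (axis i j) x (axis i (l - j))"
  have "src G ?p = w l" unfolding w_def l s(4) using s d by (subst src_cmp) auto
  then have p: "?p \<in> paths G" "rng G ?p = w j" "src G ?p = w j" "deg G ?p = axis i (l - j)"
    using s jl by (auto simp: w_def)
  have "rigid (w j)" unfolding w_def using d assms(1) r by (intro rigid_src) auto
  then have "talented_eq G {#(w j, m)#} {#(w j, m + axis i (int (l - j)))#}" for m
    using talented_eq_rigid[OF p(1), of m] p by simp
  then have "has_period i {#(w j, m)#}" for m
    using jl(1) by (auto simp: has_period_def intro!: exI[of _ "l - j"])
  moreover have "talented_eq G {#(u, n)#} {#(w j, n + int_vec (deg G (x (axis i j))))#}"
    using talented_eq_rigid[OF d(1), of "axis i j" n] assms(1) r by (simp add: w_def)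
  ultimately show ?thesis using has_period_cong by blast
qed

lemma HNE_imp_talented_periodic:
  assumes "condition_HNE G" "finite (vertices G)"
  shows "talented_periodic G"
  unfolding talented_periodic_def
proof (intro ballI impI allI)
  fix a i assume "a \<in> carrier (talented_monoid G)"
  then obtain M where M: "set_mset M \<subseteq> vertices G \<times> UNIV" "a = talented_rel G `` {M}"
    by (auto simp: talented_monoid_def elim: quotientE)
  \<comment> \<open>Expanding to the pigeonhole degree writes every symbol as a sum of symbols at
    rigid vertices.\<close>
  have v: "has_period i {#(v, n)#}" if "v \<in> vertices G" for v n
  proof (rule has_period_cong[OF talented_eq_expand[OF that, of n "diag (card (vertices G))"]])
    show "has_period i (\<Sum>x\<in>paths_from G v (diag (card (vertices G))).
        {#(src G x, n + int_vec (diag (card (vertices G))))#})"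
      using HNE_long_path_rigid[OF assms] assms(2)
      by (intro has_period_sum has_period_rigid) (auto simp: paths_from_def)
  qed
  have "has_period i M" using M(1)
  proof (induction M)
    case (add z M)
    then show ?case using has_period_add[of i "{#z#}" M] v by (cases z) auto
  qed (rule has_period_empty)
  then obtain n where n: "n > 0" "talented_eq G M (translate (axis i (int n)) M)"
    by (auto simp: has_period_def)
  let ?q = "axis i (int n)"
  have "translate ?q x \<in> a" if "x \<in> a" for x
  proof -
    have "talented_eq G M x" "set_mset x \<subseteq> vertices G \<times> UNIV" using that M(2) by (auto simp: talented_rel_def)
    then have "talented_eq G M (translate ?q x)" "set_mset (translate ?q x) \<subseteq> vertices G \<times> UNIV"
      using talented_eq.trans[OF n(2) talented_eq_translate] by (simp_all only: set_translate)
    then show ?thesis using M by (auto simp: talented_rel_def)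
  qed
  \<comment> \<open>The action is the image of the class as a set, so surjectivity is needed as
    well; the preimage of x is its translate in the opposite direction.\<close>
  moreover have "x \<in> translate ?q ` a" if "x \<in> a" for x
  proof
    show "x = translate ?q (translate (- ?q) x)" by (simp add: translate_add)
    have "talented_eq G M x" "set_mset x \<subseteq> vertices G \<times> UNIV" using that M(2) by (auto simp: talented_rel_def)
    moreover have "talented_eq G (translate (- ?q) M) M"
      using talented_eq_translate[OF n(2), of "- ?q"] by (simp add: translate_add)
    ultimately have "talented_eq G M (translate (- ?q) x)" "set_mset (translate (- ?q) x) \<subseteq> vertices G \<times> UNIV"
      using talented_eq.trans[OF talented_eq.sym talented_eq_translate] by (simp_all only: set_translate)
    then show "translate (- ?q) x \<in> a" using M by (auto simp: talented_rel_def)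
  qed
  ultimately have "talented_action ?q a = a"
    unfolding talented_action_def translate_def[symmetric] by blast
  then show "\<exists>n. n \<noteq> 0 \<and> talented_action (axis i (int n)) a = a" using n(1) by blast
qed

end

section \<open>Algebras presented by generators and relations\<close>

declare alg_eq.trans [trans]

lemma alg_eq_times_left: "alg_eq R a b \<Longrightarrow> alg_eq R (Times a c) (Times b c)"
  by (rule alg_eq.cong_times[OF _ alg_eq.refl])

lemma alg_eq_times_right: "alg_eq R a b \<Longrightarrow> alg_eq R (Times c a) (Times c b)"
  by (rule alg_eq.cong_times[OF alg_eq.refl])

text \<open>\<open>Zero\<close> is rewritten as \<open>Scale 0 Zero\<close> by
  \<open>scale_zero\<close>, and the scalar 0 is then pulled out. The same device serves for
  products.\<close>

lemma alg_eq_scale_Zero: "alg_eq R (Scale c Zero) Zero"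
proof -
  have "alg_eq R (Scale c Zero) (Scale c (Scale 0 Zero))"
    by (rule alg_eq.cong_scale[OF alg_eq.sym[OF alg_eq.scale_zero]])
  also have "alg_eq R \<dots> (Scale (c * 0) Zero)" by (rule alg_eq.scale_scale)
  also have "alg_eq R (Scale (c * 0) Zero) Zero" by (simp add: alg_eq.scale_zero)
  finally show ?thesis .
qed

lemma alg_eq_Zero_times: "alg_eq R (Times Zero x) Zero"
proof -
  have "alg_eq R (Times Zero x) (Times (Scale 0 Zero) x)"
    by (rule alg_eq_times_left[OF alg_eq.sym[OF alg_eq.scale_zero]])
  also have "alg_eq R \<dots> (Scale 0 (Times Zero x))" by (rule alg_eq.scale_times)
  also have "alg_eq R \<dots> Zero" by (rule alg_eq.scale_zero)
  finally show ?thesis .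
qed

lemma alg_eq_times_Zero: "alg_eq R (Times x Zero) Zero"
proof -
  have "alg_eq R (Times x Zero) (Times x (Scale 0 Zero))"
    by (rule alg_eq_times_right[OF alg_eq.sym[OF alg_eq.scale_zero]])
  also have "alg_eq R \<dots> (Scale 0 (Times x Zero))" by (rule alg_eq.times_scale)
  also have "alg_eq R \<dots> Zero" by (rule alg_eq.scale_zero)
  finally show ?thesis .
qed

lemma alg_eq_plus_Zero: "alg_eq R (Plus x Zero) x"
  by (rule alg_eq.trans[OF alg_eq.plus_comm alg_eq.plus_zero])

lemma alg_eq_plus_swap: "alg_eq R (Plus (Plus a b) (Plus c d)) (Plus (Plus a c) (Plus b d))"
proof -
  have "alg_eq R (Plus (Plus a b) (Plus c d)) (Plus a (Plus b (Plus c d)))" by (rule alg_eq.plus_assoc)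
  also have "alg_eq R \<dots> (Plus a (Plus (Plus b c) d))"
    by (rule alg_eq.cong_plus[OF alg_eq.refl alg_eq.sym[OF alg_eq.plus_assoc]])
  also have "alg_eq R \<dots> (Plus a (Plus (Plus c b) d))"
    by (intro alg_eq.cong_plus alg_eq.refl alg_eq.plus_comm)
  also have "alg_eq R \<dots> (Plus a (Plus c (Plus b d)))"
    by (rule alg_eq.cong_plus[OF alg_eq.refl alg_eq.plus_assoc])
  also have "alg_eq R \<dots> (Plus (Plus a c) (Plus b d))" by (rule alg_eq.sym[OF alg_eq.plus_assoc])
  finally show ?thesis .
qed

section \<open>Finite sums of terms\<close>

text \<open>The same fold as on the right-hand side of \<open>KP4\<close>, so that the relation
  applies to it literally.\<close>

definition alg_sum :: "('f, 'x) alg_term list \<Rightarrow> ('f, 'x) alg_term" where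
  "alg_sum ts = foldr Plus ts Zero"

lemma alg_sum_simps [simp]: "alg_sum [] = Zero" "alg_sum (t # ts) = Plus t (alg_sum ts)"
  by (simp_all add: alg_sum_def)

lemma gens_alg_sum: "gens (alg_sum ts) = (\<Union>t\<in>set ts. gens t)"
  by (induction ts) auto

lemma alg_eq_times_sum: "alg_eq R (Times a (alg_sum ts)) (alg_sum (map (Times a) ts))"
proof (induction ts)
  case (Cons t ts)
  have "alg_eq R (Times a (Plus t (alg_sum ts))) (Plus (Times a t) (Times a (alg_sum ts)))"
    by (rule alg_eq.times_plus)
  also have "alg_eq R \<dots> (Plus (Times a t) (alg_sum (map (Times a) ts)))"
    by (rule alg_eq.cong_plus[OF alg_eq.refl Cons])
  finally show ?case by simp
qed (simp add: alg_eq_times_Zero)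

lemma alg_eq_sum_times: "alg_eq R (Times (alg_sum ts) a) (alg_sum (map (\<lambda>t. Times t a) ts))"
proof (induction ts)
  case (Cons t ts)
  have "alg_eq R (Times (Plus t (alg_sum ts)) a) (Plus (Times t a) (Times (alg_sum ts) a))"
    by (rule alg_eq.plus_times)
  also have "alg_eq R \<dots> (Plus (Times t a) (alg_sum (map (\<lambda>t. Times t a) ts)))"
    by (rule alg_eq.cong_plus[OF alg_eq.refl Cons])
  finally show ?case by simp
qed (simp add: alg_eq_Zero_times)

lemma alg_eq_sum_cong:
  "(\<And>x. x \<in> set xs \<Longrightarrow> alg_eq R (f x) (g x)) \<Longrightarrow> alg_eq R (alg_sum (map f xs)) (alg_sum (map g xs))"
  by (induction xs) (auto intro: alg_eq.refl alg_eq.cong_plus)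

lemma alg_eq_sum_Zero:
  "(\<And>x. x \<in> set xs \<Longrightarrow> alg_eq R (f x) Zero) \<Longrightarrow> alg_eq R (alg_sum (map f xs)) Zero"
proof (induction xs)
  case (Cons x xs)
  then have "alg_eq R (Plus (f x) (alg_sum (map f xs))) (Plus Zero Zero)"
    by (intro alg_eq.cong_plus) auto
  then show ?case using alg_eq.trans[OF _ alg_eq.plus_zero] by simp
qed (simp add: alg_eq.refl)

lemma alg_eq_sum_plus:
  "alg_eq R (Plus (alg_sum (map f xs)) (alg_sum (map g xs))) (alg_sum (map (\<lambda>x. Plus (f x) (g x)) xs))"
proof (induction xs)
  case (Cons x xs)
  show ?case
    using alg_eq.trans[OF alg_eq_plus_swap alg_eq.cong_plus[OF alg_eq.refl Cons]] by simp
qed (simp add: alg_eq.plus_zero)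

lemma alg_eq_sum_scale:
  "alg_eq R (Scale c (alg_sum (map f xs))) (alg_sum (map (\<lambda>x. Scale c (f x)) xs))"
proof (induction xs)
  case (Cons x xs)
  show ?case
    using alg_eq.trans[OF alg_eq.scale_plus alg_eq.cong_plus[OF alg_eq.refl Cons]] by simp
qed (simp add: alg_eq_scale_Zero)

lemma alg_eq_sum_single:
  assumes "x \<in> set xs" "distinct xs" "\<And>y. y \<in> set xs \<Longrightarrow> y \<noteq> x \<Longrightarrow> alg_eq R (f y) Zero"
  shows "alg_eq R (alg_sum (map f xs)) (f x)"
  using assms
proof (induction xs)
  case (Cons y xs)
  show ?case
  proof (cases "x = y")
    case True
    then have "alg_eq R (alg_sum (map f xs)) Zero"
      using Cons.prems by (intro alg_eq_sum_Zero) auto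
    then have "alg_eq R (Plus (f y) (alg_sum (map f xs))) (Plus (f y) Zero)"
      by (rule alg_eq.cong_plus[OF alg_eq.refl])
    then show ?thesis using alg_eq.trans[OF _ alg_eq_plus_Zero] True by simp
  next
    case False
    then have "alg_eq R (alg_sum (map f xs)) (f x)" "alg_eq R (f y) Zero"
      using Cons by auto
    then have "alg_eq R (Plus (f y) (alg_sum (map f xs))) (Plus Zero (f x))"
      by (rule alg_eq.cong_plus[rotated])
    then show ?thesis using alg_eq.trans[OF _ alg_eq.plus_zero] by simp
  qed
qed simp

subsection \<open>Linear spans and normal forms\<close>

text \<open>The linear span in the quotient algebra, kept on terms: rule \<open>eq\<close> makes it
  a union of congruence classes, so spanning arguments avoid the carrier of the quotient.\<close>

inductive alg_span ::
    "(('f::field, 'x) alg_term \<times> ('f, 'x) alg_term) set \<Rightarrow> ('f, 'x) alg_term set \<Rightarrow> ('f, 'x) alg_term \<Rightarrow> bool"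
  for R S where
  base: "t \<in> S \<Longrightarrow> alg_span R S t"
| zero: "alg_span R S Zero"
| plus: "alg_span R S s \<Longrightarrow> alg_span R S t \<Longrightarrow> alg_span R S (Plus s t)"
| scale: "alg_span R S t \<Longrightarrow> alg_span R S (Scale c t)"
| eq: "alg_eq R s t \<Longrightarrow> alg_span R S t \<Longrightarrow> alg_span R S s"

lemma alg_span_sum: "(\<And>t. t \<in> set ts \<Longrightarrow> alg_span R S t) \<Longrightarrow> alg_span R S (alg_sum ts)"
  by (induction ts) (auto intro: alg_span.intros)

lemma alg_span_times:
  assumes "\<And>t. t \<in> S \<Longrightarrow> alg_span R S (Times a t)" "alg_span R S t"
  shows "alg_span R S (Times a t)"
  using assms(2)
proof induction
  case (zero)
  show ?case by (rule alg_span.eq[OF alg_eq_times_Zero alg_span.zero])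
next
  case (plus s t)
  show ?case by (rule alg_span.eq[OF alg_eq.times_plus alg_span.plus[OF plus(3,4)]])
next
  case (scale t c)
  show ?case by (rule alg_span.eq[OF alg_eq.times_scale alg_span.scale[OF scale(2)]])
next
  case (eq s t)
  show ?case by (rule alg_span.eq[OF alg_eq_times_right[OF eq(1)] eq(3)])
qed (use assms(1) in blast)

text \<open>Left multiplication by a term is built up from multiplications by generators, so testing
  generators on S is enough.\<close>

lemma alg_span_ideal:
  assumes "\<And>g t. g \<in> X \<Longrightarrow> t \<in> S \<Longrightarrow> alg_span R S (Times (Gen g) t)" "gens a \<subseteq> X" "alg_span R S t"
  shows "alg_span R S (Times a t)"
  using assms(2,3)
proof (induction a arbitrary: t)
  case (Gen g)
  then show ?case using alg_span_times[of S R "Gen g"] assms(1) by simp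
next
  case Zero
  show ?case by (rule alg_span.eq[OF alg_eq_Zero_times alg_span.zero])
next
  case (Plus a b)
  then have "alg_span R S (Plus (Times a t) (Times b t))" by (intro alg_span.plus) auto
  then show ?case by (rule alg_span.eq[OF alg_eq.plus_times])
next
  case (Scale c a)
  then have "alg_span R S (Scale c (Times a t))" by (intro alg_span.scale) auto
  then show ?case by (rule alg_span.eq[OF alg_eq.scale_times])
next
  case (Times a b)
  then have "alg_span R S (Times a (Times b t))" by auto
  then show ?case by (rule alg_span.eq[OF alg_eq.times_assoc])
qed

text \<open>The expansion is asserted along every enumeration that contains the support D, surplus
  terms having coefficient 0. Two expansions can thus be put on a common list, to be added or
  compared, without permuting sums.\<close>

lemma alg_span_normal_form:
  assumes "alg_span R S t" "\<And>s. s \<in> S \<Longrightarrow> \<exists>g\<in>I. alg_eq R s (b g)"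
  shows "\<exists>D c. finite D \<and> D \<subseteq> I \<and> (\<forall>g. g \<notin> D \<longrightarrow> c g = 0) \<and>
    (\<forall>gs. distinct gs \<and> D \<subseteq> set gs \<longrightarrow> alg_eq R t (alg_sum (map (\<lambda>g. Scale (c g) (b g)) gs)))"
  using assms(1)
proof induction
  case (base t)
  then obtain g where g: "g \<in> I" "alg_eq R t (b g)" using assms(2) by blast
  define c where "c h = (if h = g then 1 else 0 :: 'a)" for h
  have "alg_eq R t (alg_sum (map (\<lambda>h. Scale (c h) (b h)) gs))" if "distinct gs" "{g} \<subseteq> set gs" for gs
  proof -
    have "alg_eq R (alg_sum (map (\<lambda>h. Scale (c h) (b h)) gs)) (Scale (c g) (b g))"
      using that by (intro alg_eq_sum_single) (auto simp: c_def intro: alg_eq.scale_zero)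
    then have "alg_eq R (alg_sum (map (\<lambda>h. Scale (c h) (b h)) gs)) (b g)"
      using alg_eq.trans[OF _ alg_eq.scale_one] by (simp add: c_def)
    then show ?thesis using alg_eq.trans[OF g(2) alg_eq.sym] by blast
  qed
  then show ?case using g by (intro exI[of _ "{g}"] exI[of _ c]) (auto simp: c_def)
next
  case zero
  have "alg_eq R Zero (alg_sum (map (\<lambda>h. Scale 0 (b h)) gs))" for gs
    by (intro alg_eq.sym[OF alg_eq_sum_Zero] alg_eq.scale_zero)
  then show ?case by (intro exI[of _ "{}"] exI[of _ "\<lambda>_. 0"]) auto
next
  case (plus s t)
  obtain D c where D: "finite D" "D \<subseteq> I" "\<And>g. g \<notin> D \<Longrightarrow> c g = 0"
    "\<And>gs. distinct gs \<Longrightarrow> D \<subseteq> set gs \<Longrightarrow> alg_eq R s (alg_sum (map (\<lambda>g. Scale (c g) (b g)) gs))"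
    using plus(3) by blast
  obtain E d where E: "finite E" "E \<subseteq> I" "\<And>g. g \<notin> E \<Longrightarrow> d g = 0"
    "\<And>gs. distinct gs \<Longrightarrow> E \<subseteq> set gs \<Longrightarrow> alg_eq R t (alg_sum (map (\<lambda>g. Scale (d g) (b g)) gs))"
    using plus(4) by blast
  have "alg_eq R (Plus s t) (alg_sum (map (\<lambda>g. Scale (c g + d g) (b g)) gs))"
    if "distinct gs" "D \<union> E \<subseteq> set gs" for gs
  proof -
    have "alg_eq R (Plus s t)
      (Plus (alg_sum (map (\<lambda>g. Scale (c g) (b g)) gs)) (alg_sum (map (\<lambda>g. Scale (d g) (b g)) gs)))"
      using that by (intro alg_eq.cong_plus D(4) E(4)) auto
    also have "alg_eq R \<dots> (alg_sum (map (\<lambda>g. Plus (Scale (c g) (b g)) (Scale (d g) (b g))) gs))"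
      by (rule alg_eq_sum_plus)
    also have "alg_eq R \<dots> (alg_sum (map (\<lambda>g. Scale (c g + d g) (b g)) gs))"
      by (intro alg_eq_sum_cong alg_eq.sym[OF alg_eq.plus_scale])
    finally show ?thesis .
  qed
  then show ?case using D E by (intro exI[of _ "D \<union> E"] exI[of _ "\<lambda>g. c g + d g"]) auto
next
  case (scale t e)
  obtain D c where D: "finite D" "D \<subseteq> I" "\<And>g. g \<notin> D \<Longrightarrow> c g = 0"
    "\<And>gs. distinct gs \<Longrightarrow> D \<subseteq> set gs \<Longrightarrow> alg_eq R t (alg_sum (map (\<lambda>g. Scale (c g) (b g)) gs))"
    using scale(2) by blast
  have "alg_eq R (Scale e t) (alg_sum (map (\<lambda>g. Scale (e * c g) (b g)) gs))"
    if "distinct gs" "D \<subseteq> set gs" for gs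
  proof -
    have "alg_eq R (Scale e t) (Scale e (alg_sum (map (\<lambda>g. Scale (c g) (b g)) gs)))"
      using that by (intro alg_eq.cong_scale D(4)) auto
    also have "alg_eq R \<dots> (alg_sum (map (\<lambda>g. Scale e (Scale (c g) (b g))) gs))"
      by (rule alg_eq_sum_scale)
    also have "alg_eq R \<dots> (alg_sum (map (\<lambda>g. Scale (e * c g) (b g)) gs))"
      by (intro alg_eq_sum_cong alg_eq.scale_scale)
    finally show ?thesis .
  qed
  then show ?case using D by (intro exI[of _ D] exI[of _ "\<lambda>g. e * c g"]) auto
next
  case (eq s t)
  then show ?case by (meson alg_eq.trans)
qed

subsection \<open>Evaluation in operators\<close>

text \<open>A term is interpreted as an operator on the functions \<open>'p \<Rightarrow> 'c\<close>, where the commutative ring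
  \<open>'c\<close> receives the scalars through \<open>\<sigma>\<close>.\<close>

primrec alg_eval :: "('f \<Rightarrow> 'c::comm_ring_1) \<Rightarrow> ('x \<Rightarrow> ('p \<Rightarrow> 'c) \<Rightarrow> 'p \<Rightarrow> 'c) \<Rightarrow> ('f, 'x) alg_term \<Rightarrow>
    ('p \<Rightarrow> 'c) \<Rightarrow> 'p \<Rightarrow> 'c" where
  "alg_eval \<sigma> J (Gen g) = J g"
| "alg_eval \<sigma> J Zero = (\<lambda>f x. 0)"
| "alg_eval \<sigma> J (Plus s t) = (\<lambda>f x. alg_eval \<sigma> J s f x + alg_eval \<sigma> J t f x)"
| "alg_eval \<sigma> J (Scale c t) = (\<lambda>f x. \<sigma> c * alg_eval \<sigma> J t f x)"
| "alg_eval \<sigma> J (Times s t) = (\<lambda>f. alg_eval \<sigma> J s (alg_eval \<sigma> J t f))"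

text \<open>The conditions on \<sigma> make it a unital ring homomorphism. Linearity of the
  generators over \<open>'c\<close> is what soundness of \<open>times_plus\<close> and
  \<open>times_scale\<close> rests on.\<close>

locale alg_operators =
  fixes \<sigma> :: "'f::field \<Rightarrow> 'c::comm_ring_1" and J :: "'x \<Rightarrow> ('p \<Rightarrow> 'c) \<Rightarrow> 'p \<Rightarrow> 'c"
  assumes \<sigma>_add: "\<sigma> (a + b) = \<sigma> a + \<sigma> b"
    and \<sigma>_mult: "\<sigma> (a * b) = \<sigma> a * \<sigma> b"
    and \<sigma>_0: "\<sigma> 0 = 0"
    and \<sigma>_1: "\<sigma> 1 = 1"
    and J_add: "J g (\<lambda>x. f x + f' x) = (\<lambda>x. J g f x + J g f' x)"
    and J_scale: "J g (\<lambda>x. k * f x) = (\<lambda>x. k * J g f x)"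
begin

lemma alg_eval_add: "alg_eval \<sigma> J t (\<lambda>x. f x + f' x) = (\<lambda>x. alg_eval \<sigma> J t f x + alg_eval \<sigma> J t f' x)"
  by (induction t arbitrary: f f') (auto simp: J_add algebra_simps)

lemma alg_eval_scale: "alg_eval \<sigma> J t (\<lambda>x. k * f x) = (\<lambda>x. k * alg_eval \<sigma> J t f x)"
  by (induction t arbitrary: f) (auto simp: J_scale algebra_simps)

lemma alg_eval_0: "alg_eval \<sigma> J t (\<lambda>x. 0) = (\<lambda>x. 0)"
  using alg_eval_scale[of t 0 "\<lambda>x. 0"] by simp

lemma alg_eval_sum: "alg_eval \<sigma> J t (\<lambda>x. \<Sum>z\<in>A. f z x) = (\<lambda>x. \<Sum>z\<in>A. alg_eval \<sigma> J t (f z) x)"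
  by (induction A rule: infinite_finite_induct) (auto simp: alg_eval_0 alg_eval_add)

lemma alg_eval_sound:
  assumes "alg_eq R s t" "\<And>a b. (a, b) \<in> R \<Longrightarrow> alg_eval \<sigma> J a = alg_eval \<sigma> J b"
  shows "alg_eval \<sigma> J s = alg_eval \<sigma> J t"
  using assms(1)
  by induction
    (rule ext, rule ext, simp add: assms(2) algebra_simps \<sigma>_add \<sigma>_mult \<sigma>_0 \<sigma>_1 alg_eval_add alg_eval_scale)+

end

subsection \<open>The module structure\<close>

definition alg_class ::
    "'x set \<Rightarrow> (('f::field, 'x) alg_term \<times> ('f, 'x) alg_term) set \<Rightarrow> ('f, 'x) alg_term \<Rightarrow> ('f, 'x) alg_term set" where
  "alg_class X R t = alg_rel X R `` {t}"

lemma alg_rel_equiv: "equiv {t. gens t \<subseteq> X} (alg_rel X R)"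
  by (rule equivI) (auto simp: alg_rel_def refl_on_def sym_def trans_def intro: alg_eq.intros)

lemma alg_class_eq_iff:
  "gens s \<subseteq> X \<Longrightarrow> gens t \<subseteq> X \<Longrightarrow> alg_class X R s = alg_class X R t \<longleftrightarrow> alg_eq R s t"
  unfolding alg_class_def by (subst eq_equiv_class_iff[OF alg_rel_equiv]) (auto simp: alg_rel_def)

lemma mem_alg_class: "gens t \<subseteq> X \<Longrightarrow> s \<in> alg_class X R t \<longleftrightarrow> gens s \<subseteq> X \<and> alg_eq R t s"
  by (auto simp: alg_class_def alg_rel_def)

lemma presented_carrier: "A \<in> carrier (presented_algebra X R) \<longleftrightarrow> (\<exists>t. gens t \<subseteq> X \<and> A = alg_class X R t)"
  by (auto simp: presented_algebra_def Let_def alg_class_def quotient_def)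

lemma presented_carrierE:
  assumes "A \<in> carrier (presented_algebra X R)"
  obtains t where "gens t \<subseteq> X" "A = alg_class X R t"
  using assms by (auto simp: presented_carrier)

lemma alg_class_closed: "gens t \<subseteq> X \<Longrightarrow> alg_class X R t \<in> carrier (presented_algebra X R)"
  by (auto simp: presented_carrier)

text \<open>The operations of the quotient are unions over representatives; when an operation
  respects the congruence, all the sets united are equal.\<close>

lemma UN_alg_class:
  assumes "gens s \<subseteq> X" "\<And>s'. gens s' \<subseteq> X \<Longrightarrow> alg_eq R s s' \<Longrightarrow> F s' = C"
  shows "(\<Union>x\<in>alg_class X R s. F x) = C"
proof -
  have "F x = C" if "x \<in> alg_class X R s" for x using that assms by (simp add: mem_alg_class)
  moreover have "s \<in> alg_class X R s" using assms(1) by (simp add: mem_alg_class alg_eq.refl)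
  ultimately show ?thesis by blast
qed

lemma presented_smult:
  assumes "gens s \<subseteq> X"
  shows "c \<odot>\<^bsub>presented_algebra X R\<^esub> alg_class X R s = alg_class X R (Scale c s)"
proof -
  have "c \<odot>\<^bsub>presented_algebra X R\<^esub> alg_class X R s = (\<Union>x\<in>alg_class X R s. alg_class X R (Scale c x))"
    by (simp add: presented_algebra_def Let_def alg_class_def)
  also have "\<dots> = alg_class X R (Scale c s)"
    using assms by (intro UN_alg_class)
      (auto simp: alg_class_eq_iff intro: alg_eq.cong_scale alg_eq.sym)
  finally show ?thesis .
qed

lemma presented_binary:
  assumes "gens s \<subseteq> X" "gens t \<subseteq> X" "\<And>a b. gens (F a b) = gens a \<union> gens b"
    "\<And>a b a' b'. alg_eq R a a' \<Longrightarrow> alg_eq R b b' \<Longrightarrow> alg_eq R (F a b) (F a' b')"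
  shows "(\<Union>x\<in>alg_class X R s. \<Union>y\<in>alg_class X R t. alg_class X R (F x y)) = alg_class X R (F s t)"
proof (intro UN_alg_class assms(1,2))
  fix s' t' assume "gens s' \<subseteq> X" "alg_eq R s s'" "gens t' \<subseteq> X" "alg_eq R t t'"
  then show "alg_class X R (F s' t') = alg_class X R (F s t)"
    using assms(1,2,3) by (subst alg_class_eq_iff) (auto intro: assms(4) alg_eq.sym)
qed

lemma presented_add:
  assumes "gens s \<subseteq> X" "gens t \<subseteq> X"
  shows "alg_class X R s \<oplus>\<^bsub>presented_algebra X R\<^esub> alg_class X R t = alg_class X R (Plus s t)"
  using presented_binary[of s X t Plus R] assms
  by (simp add: presented_algebra_def Let_def alg_class_def alg_eq.cong_plus)

lemma presented_mult:
  assumes "gens s \<subseteq> X" "gens t \<subseteq> X"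
  shows "alg_class X R s \<otimes>\<^bsub>presented_algebra X R\<^esub> alg_class X R t = alg_class X R (Times s t)"
  using presented_binary[of s X t Times R] assms
  by (simp add: presented_algebra_def Let_def alg_class_def alg_eq.cong_times)

lemma presented_zero: "\<zero>\<^bsub>presented_algebra X R\<^esub> = alg_class X R Zero"
  by (simp add: presented_algebra_def Let_def alg_class_def)

text \<open>The class of e satisfies the description that defines \<open>one\<close>, and a
  two-sided unit is unique.\<close>

lemma presented_one:
  assumes "gens e \<subseteq> X" "\<And>t. gens t \<subseteq> X \<Longrightarrow> alg_eq R (Times e t) t"
    "\<And>t. gens t \<subseteq> X \<Longrightarrow> alg_eq R (Times t e) t"
  shows "\<one>\<^bsub>presented_algebra X R\<^esub> = alg_class X R e"
proof -
  let ?A = "presented_algebra X R"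
  have "\<one>\<^bsub>?A\<^esub> = (THE u. u \<in> carrier ?A \<and> (\<forall>x\<in>carrier ?A. u \<otimes>\<^bsub>?A\<^esub> x = x \<and> x \<otimes>\<^bsub>?A\<^esub> u = x))"
    by (simp add: presented_algebra_def Let_def)
  also have "\<dots> = alg_class X R e"
  proof (rule the_equality)
    show unit: "alg_class X R e \<in> carrier ?A \<and>
      (\<forall>x\<in>carrier ?A. alg_class X R e \<otimes>\<^bsub>?A\<^esub> x = x \<and> x \<otimes>\<^bsub>?A\<^esub> alg_class X R e = x)"
    proof (intro conjI ballI)
      fix x assume "x \<in> carrier ?A"
      then obtain t where t: "gens t \<subseteq> X" "x = alg_class X R t" by (rule presented_carrierE)
      then show "alg_class X R e \<otimes>\<^bsub>?A\<^esub> x = x" "x \<otimes>\<^bsub>?A\<^esub> alg_class X R e = x"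
        using assms by (simp_all add: presented_mult alg_class_eq_iff)
    qed (rule alg_class_closed[OF assms(1)])
    fix u assume "u \<in> carrier ?A \<and> (\<forall>x\<in>carrier ?A. u \<otimes>\<^bsub>?A\<^esub> x = x \<and> x \<otimes>\<^bsub>?A\<^esub> u = x)"
    then show "u = alg_class X R e" using unit by metis
  qed
  finally show ?thesis .
qed

lemma presented_module: "module class_ring (presented_algebra X R)"
proof -
  let ?A = "presented_algebra X R"
  have ag: "abelian_group ?A"
  proof (rule abelian_groupI)
    fix x y z assume "x \<in> carrier ?A" "y \<in> carrier ?A" "z \<in> carrier ?A"
    then show "x \<oplus>\<^bsub>?A\<^esub> y \<oplus>\<^bsub>?A\<^esub> z = x \<oplus>\<^bsub>?A\<^esub> (y \<oplus>\<^bsub>?A\<^esub> z)"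
      by (elim presented_carrierE) (simp add: presented_add alg_class_eq_iff alg_eq.plus_assoc)
  next
    fix x y assume "x \<in> carrier ?A" "y \<in> carrier ?A"
    then show "x \<oplus>\<^bsub>?A\<^esub> y = y \<oplus>\<^bsub>?A\<^esub> x" "x \<oplus>\<^bsub>?A\<^esub> y \<in> carrier ?A"
      by (elim presented_carrierE, simp add: presented_add alg_class_eq_iff alg_eq.plus_comm alg_class_closed)+
  next
    fix x assume x: "x \<in> carrier ?A"
    then show "\<zero>\<^bsub>?A\<^esub> \<oplus>\<^bsub>?A\<^esub> x = x"
      by (elim presented_carrierE) (simp add: presented_add presented_zero alg_class_eq_iff alg_eq.plus_zero)
    from x obtain t where t: "gens t \<subseteq> X" "x = alg_class X R t" by (rule presented_carrierE)
    have "alg_eq R (Plus (Scale (- 1) t) t) (Plus (Scale (- 1) t) (Scale 1 t))"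
      by (rule alg_eq.cong_plus[OF alg_eq.refl alg_eq.sym[OF alg_eq.scale_one]])
    also have "alg_eq R \<dots> (Scale (- 1 + 1) t)" by (rule alg_eq.sym[OF alg_eq.plus_scale])
    also have "alg_eq R (Scale (- 1 + 1) t) Zero" by (simp add: alg_eq.scale_zero)
    finally have "alg_class X R (Scale (- 1) t) \<oplus>\<^bsub>?A\<^esub> x = \<zero>\<^bsub>?A\<^esub>"
      using t by (simp add: presented_add presented_zero alg_class_eq_iff)
    then show "\<exists>y\<in>carrier ?A. y \<oplus>\<^bsub>?A\<^esub> x = \<zero>\<^bsub>?A\<^esub>"
      using t by (intro bexI[of _ "alg_class X R (Scale (- 1) t)"]) (auto intro!: alg_class_closed)
  qed (auto simp: presented_zero intro!: alg_class_closed)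
  have ax: "module_axioms class_ring ?A"
  proof (rule module_axioms.intro)
    fix a :: 'a and x assume "x \<in> carrier ?A"
    then show "a \<odot>\<^bsub>?A\<^esub> x \<in> carrier ?A"
      by (elim presented_carrierE) (simp add: presented_smult alg_class_closed)
  next
    fix a b :: 'a and x assume "x \<in> carrier ?A"
    then show "(a \<oplus>\<^bsub>class_ring\<^esub> b) \<odot>\<^bsub>?A\<^esub> x = a \<odot>\<^bsub>?A\<^esub> x \<oplus>\<^bsub>?A\<^esub> b \<odot>\<^bsub>?A\<^esub> x"
      "(a \<otimes>\<^bsub>class_ring\<^esub> b) \<odot>\<^bsub>?A\<^esub> x = a \<odot>\<^bsub>?A\<^esub> (b \<odot>\<^bsub>?A\<^esub> x)"
      by (elim presented_carrierE, simp add: presented_smult presented_add alg_class_eq_iff alg_eq.plus_scale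
          alg_eq.sym[OF alg_eq.scale_scale])+
  next
    fix a :: 'a and x y assume "x \<in> carrier ?A" "y \<in> carrier ?A"
    then show "a \<odot>\<^bsub>?A\<^esub> (x \<oplus>\<^bsub>?A\<^esub> y) = a \<odot>\<^bsub>?A\<^esub> x \<oplus>\<^bsub>?A\<^esub> a \<odot>\<^bsub>?A\<^esub> y"
      by (elim presented_carrierE) (simp add: presented_smult presented_add alg_class_eq_iff alg_eq.scale_plus)
  next
    fix x assume "x \<in> carrier ?A"
    then show "\<one>\<^bsub>class_ring\<^esub> \<odot>\<^bsub>?A\<^esub> x = x"
      by (elim presented_carrierE) (simp add: presented_smult alg_class_eq_iff alg_eq.scale_one)
  qed
  show ?thesis
    by (intro module.intro ag ax) (rule class_cring.cring_axioms)
qed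

section \<open>Computations in the Kumjian-Pask algebra\<close>

context row_finite_k_graph
begin

abbreviation kp_eq :: "('f::field, 'a kp_gen) alg_term \<Rightarrow> ('f, 'a kp_gen) alg_term \<Rightarrow> bool" where
  "kp_eq \<equiv> alg_eq (kp_relations G)"

section \<open>The relations, extended to vertices and to degree zero\<close>

lemma kp_s_vertex [simp]: "v \<in> vertices G \<Longrightarrow> kp_s G v = kp_p v" "v \<in> vertices G \<Longrightarrow> kp_s_star G v = kp_p v"
  by (simp_all add: kp_s_def kp_s_star_def)

lemma gens_kp_s: "x \<in> paths G \<Longrightarrow> gens (kp_s G x) \<subseteq> kp_gens G" "x \<in> paths G \<Longrightarrow> gens (kp_s_star G x) \<subseteq> kp_gens G"
  by (auto simp: kp_s_def kp_s_star_def kp_gens_def)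

lemma kp_vertex_mult:
  assumes "u \<in> vertices G" "v \<in> vertices G"
  shows "kp_eq (Times (kp_p u) (kp_p v)) (if u = v then kp_p u else Zero)"
  by (rule alg_eq.relation[OF kp_relations.KP1[OF assms]])

lemma kp_vertex_idem: "v \<in> vertices G \<Longrightarrow> kp_eq (Times (kp_p v) (kp_p v)) (kp_p v)"
  using kp_vertex_mult[of v v] by simp

lemma kp_vertex_orth:
  "u \<in> vertices G \<Longrightarrow> v \<in> vertices G \<Longrightarrow> u \<noteq> v \<Longrightarrow> kp_eq (Times (kp_p u) (kp_p v)) Zero"
  using kp_vertex_mult[of u v] by simp

lemma kp_rng_s: "x \<in> paths G \<Longrightarrow> kp_eq (Times (kp_p (rng G x)) (kp_s G x)) (kp_s G x)"
  by (cases "x \<in> vertices G")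
    (use vertexD[of x] kp_vertex_idem[of x] in auto, intro alg_eq.relation kp_relations.KP2_rng_path, simp)

lemma kp_s_src: "x \<in> paths G \<Longrightarrow> kp_eq (Times (kp_s G x) (kp_p (src G x))) (kp_s G x)"
  by (cases "x \<in> vertices G")
    (use vertexD[of x] kp_vertex_idem[of x] in auto, intro alg_eq.relation kp_relations.KP2_path_src, simp)

lemma kp_src_star: "x \<in> paths G \<Longrightarrow> kp_eq (Times (kp_p (src G x)) (kp_s_star G x)) (kp_s_star G x)"
  by (cases "x \<in> vertices G")
    (use vertexD[of x] kp_vertex_idem[of x] in auto, intro alg_eq.relation kp_relations.KP2_src_ghost, simp)

lemma kp_star_rng: "x \<in> paths G \<Longrightarrow> kp_eq (Times (kp_s_star G x) (kp_p (rng G x))) (kp_s_star G x)"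
  by (cases "x \<in> vertices G")
    (use vertexD[of x] kp_vertex_idem[of x] in auto, intro alg_eq.relation kp_relations.KP2_ghost_rng, simp)

lemma kp_s_cmp:
  assumes "x \<in> paths G" "y \<in> paths G" "src G x = rng G y"
  shows "kp_eq (Times (kp_s G x) (kp_s G y)) (kp_s G (cmp G x y))"
proof -
  consider "x \<in> vertices G" | "y \<in> vertices G" | "x \<notin> vertices G" "y \<notin> vertices G" by blast
  then show ?thesis
  proof cases
    case 1
    then have "x = rng G y" using vertexD assms by auto
    then show ?thesis using 1 kp_rng_s[OF assms(2)] cmp_rng[OF assms(2)] by simp
  next
    case 2
    then have "y = src G x" using vertexD assms by auto
    then show ?thesis using 2 kp_s_src[OF assms(1)] cmp_src[OF assms(1)] by simp
  next
    case 3
    then show ?thesis using assms by (intro alg_eq.relation kp_relations.KP2_path) auto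
  qed
qed

lemma kp_star_cmp:
  assumes "x \<in> paths G" "y \<in> paths G" "src G x = rng G y"
  shows "kp_eq (Times (kp_s_star G y) (kp_s_star G x)) (kp_s_star G (cmp G x y))"
proof -
  consider "x \<in> vertices G" | "y \<in> vertices G" | "x \<notin> vertices G" "y \<notin> vertices G" by blast
  then show ?thesis
  proof cases
    case 1
    then have "x = rng G y" using vertexD assms by auto
    then show ?thesis using 1 kp_star_rng[OF assms(2)] cmp_rng[OF assms(2)] by simp
  next
    case 2
    then have "y = src G x" using vertexD assms by auto
    then show ?thesis using 2 kp_src_star[OF assms(1)] cmp_src[OF assms(1)] by simp
  next
    case 3
    then show ?thesis using assms by (intro alg_eq.relation kp_relations.KP2_ghost) auto
  qed
qed

lemma kp_star_s:
  assumes "x \<in> paths G" "y \<in> paths G" "deg G x = deg G y"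
  shows "kp_eq (Times (kp_s_star G x) (kp_s G y)) (if x = y then kp_p (src G x) else Zero)"
proof (cases "x \<in> vertices G")
  case True
  then have "y \<in> vertices G" using assms by (auto simp: vertices_def)
  then show ?thesis using True kp_vertex_mult[of x y] vertexD[of x] by (simp split: if_splits)
next
  case False
  then have "y \<notin> vertices G" using assms by (auto simp: vertices_def)
  then show ?thesis using False assms by (intro alg_eq.relation kp_relations.KP3) auto
qed

text \<open>a absorbs \<open>kp_p u\<close> on the right and b absorbs \<open>kp_p v\<close> on the
  left; inserted between them, these idempotents annihilate each other.\<close>

lemma kp_mismatch:
  assumes "u \<in> vertices G" "v \<in> vertices G" "u \<noteq> v"
    "kp_eq (Times a (kp_p u)) a" "kp_eq (Times (kp_p v) b) b"
  shows "kp_eq (Times a b) Zero"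
proof -
  have "kp_eq (Times a b) (Times (Times a (kp_p u)) (Times (kp_p v) b))"
    by (rule alg_eq.cong_times[OF alg_eq.sym[OF assms(4)] alg_eq.sym[OF assms(5)]])
  also have "kp_eq \<dots> (Times a (Times (kp_p u) (Times (kp_p v) b)))" by (rule alg_eq.times_assoc)
  also have "kp_eq \<dots> (Times a (Times (Times (kp_p u) (kp_p v)) b))"
    by (rule alg_eq_times_right[OF alg_eq.sym[OF alg_eq.times_assoc]])
  also have "kp_eq \<dots> (Times a (Times Zero b))"
    by (intro alg_eq_times_right alg_eq_times_left kp_vertex_orth assms)
  also have "kp_eq \<dots> (Times a Zero)" by (rule alg_eq_times_right[OF alg_eq_Zero_times])
  also have "kp_eq \<dots> Zero" by (rule alg_eq_times_Zero)
  finally show ?thesis .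
qed

text \<open>(KP4) is stated for nonzero degree. In degree 0 the sum has one term, the square of
  \<open>kp_p v\<close>.\<close>

lemma kp_vertex_expand:
  assumes "v \<in> vertices G" "distinct xs" "set xs = paths_from G v n"
  shows "kp_eq (kp_p v) (alg_sum (map (\<lambda>x. Times (kp_s G x) (kp_s_star G x)) xs))"
proof (cases "n = 0")
  case True
  then have "set xs = {v}" using assms paths_from_0 by simp
  then have "xs = [v]" using assms(2) by (cases xs) (auto simp: subset_singleton_iff)
  then show ?thesis
    using alg_eq.sym[OF alg_eq.trans[OF alg_eq_plus_Zero kp_vertex_idem[OF assms(1)]]] assms(1) by simp
next
  case False
  then show ?thesis
    unfolding alg_sum_def using assms by (intro alg_eq.relation kp_relations.KP4) auto
qed

text \<open>The vertex projection at the common source is inserted in the middle and expanded by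
  (KP4); the two halves of each summand are then absorbed to the left and to the right.\<close>

lemma kp_elem_expand:
  assumes "p \<in> paths G" "q \<in> paths G" "src G p = src G q"
    "distinct xs" "set xs = paths_from G (src G p) n"
  shows "kp_eq (Times (kp_s G p) (kp_s_star G q))
    (alg_sum (map (\<lambda>a. Times (kp_s G (cmp G p a)) (kp_s_star G (cmp G q a))) xs))"
proof -
  let ?e = "\<lambda>a. Times (kp_s G a) (kp_s_star G a)"
  have "kp_eq (Times (kp_s G p) (kp_s_star G q)) (Times (kp_s G p) (Times (kp_p (src G q)) (kp_s_star G q)))"
    by (rule alg_eq_times_right[OF alg_eq.sym[OF kp_src_star[OF assms(2)]]])
  also have "kp_eq \<dots> (Times (kp_s G p) (Times (alg_sum (map ?e xs)) (kp_s_star G q)))"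
    using assms by (intro alg_eq_times_right alg_eq_times_left kp_vertex_expand[of _ _ n]) auto
  also have "kp_eq \<dots> (Times (kp_s G p) (alg_sum (map (\<lambda>t. Times t (kp_s_star G q)) (map ?e xs))))"
    by (intro alg_eq_times_right alg_eq_sum_times)
  also have "kp_eq \<dots> (alg_sum (map (Times (kp_s G p)) (map (\<lambda>t. Times t (kp_s_star G q)) (map ?e xs))))"
    by (rule alg_eq_times_sum)
  also have "\<dots> = alg_sum (map (\<lambda>a. Times (kp_s G p) (Times (?e a) (kp_s_star G q))) xs)"
    by (simp add: comp_def)
  also have "kp_eq \<dots> (alg_sum (map (\<lambda>a. Times (kp_s G (cmp G p a)) (kp_s_star G (cmp G q a))) xs))"
  proof (rule alg_eq_sum_cong)
    fix a assume "a \<in> set xs"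
    then have a: "a \<in> paths G" "src G p = rng G a" "src G q = rng G a"
      using assms by (auto simp: paths_from_def)
    have "kp_eq (Times (kp_s G p) (Times (?e a) (kp_s_star G q)))
      (Times (kp_s G p) (Times (kp_s G a) (Times (kp_s_star G a) (kp_s_star G q))))"
      by (rule alg_eq_times_right[OF alg_eq.times_assoc])
    also have "kp_eq \<dots> (Times (Times (kp_s G p) (kp_s G a)) (Times (kp_s_star G a) (kp_s_star G q)))"
      by (rule alg_eq.sym[OF alg_eq.times_assoc])
    also have "kp_eq \<dots> (Times (kp_s G (cmp G p a)) (kp_s_star G (cmp G q a)))"
      using a assms by (intro alg_eq.cong_times kp_s_cmp kp_star_cmp)
    finally show "kp_eq (Times (kp_s G p) (Times (?e a) (kp_s_star G q)))
      (Times (kp_s G (cmp G p a)) (kp_s_star G (cmp G q a)))" .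
  qed
  finally show ?thesis .
qed

section \<open>Spanning elements indexed by infinite paths\<close>

text \<open>A presentation of the arrow (x, p - q, y) of the path groupoid: x after p and y after q
  have the same tail. Since it starts at a rigid vertex, the finite paths \<open>x p\<close> and
  \<open>y q\<close> determine x and y.\<close>

definition rigid_pair :: "(nat ^ 'k \<Rightarrow> 'a) \<Rightarrow> (nat ^ 'k \<Rightarrow> 'a) \<Rightarrow> nat ^ 'k \<Rightarrow> nat ^ 'k \<Rightarrow> bool" where
  "rigid_pair x y p q \<longleftrightarrow> x \<in> inf_paths \<and> y \<in> inf_paths \<and> shift p x = shift q y \<and> rigid (src G (x p))"

definition kp_elem :: "(nat ^ 'k \<Rightarrow> 'a) \<Rightarrow> (nat ^ 'k \<Rightarrow> 'a) \<Rightarrow> nat ^ 'k \<Rightarrow> nat ^ 'k \<Rightarrow> ('f::field, 'a kp_gen) alg_term" where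
  "kp_elem x y p q = Times (kp_s G (x p)) (kp_s_star G (y q))"

lemma rigid_pairD:
  assumes "rigid_pair x y p q"
  shows "x \<in> inf_paths" "y \<in> inf_paths" "shift p x = shift q y" "rigid (src G (x p))"
    "src G (x p) = src G (y q)"
  using assms shift_start[of x p] shift_start[of y q] by (auto simp: rigid_pair_def)

lemma gens_kp_elem: "rigid_pair x y p q \<Longrightarrow> gens (kp_elem x y p q) \<subseteq> kp_gens G"
  using gens_kp_s(1)[of "x p"] gens_kp_s(2)[of "y q"] inf_pathsD(1)[of x p] inf_pathsD(1)[of y q] rigid_pairD(1,2)[of x y p q]
  by (simp add: kp_elem_def)

lemma src_shift:
  assumes "x \<in> inf_paths"
  shows "src G (shift p x m) = src G (x (p + m))"
  using inf_path_split[OF assms, of p m] inf_pathsD[OF assms, of p] src_cmp[of "x p" "shift p x m"] by simp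

text \<open>At a rigid vertex the sum in (KP4) has a single term, so both paths can be prolonged
  together along the common tail.\<close>

lemma rigid_pair_extend:
  assumes "rigid_pair x y p q"
  shows "rigid_pair x y (p + m) (q + m)"
    "kp_eq (kp_elem x y p q) (kp_elem x y (p + m) (q + m))"
proof -
  note P = rigid_pairD[OF assms]
  note sx = inf_path_split[OF P(1), of p m] and sy = inf_path_split[OF P(2), of q m]
  have "rigid (src G (shift p x m))" using rigid_src[of "shift p x m"] sx P(4) by simp
  then have "rigid (src G (x (p + m)))" using src_shift[OF P(1)] by simp
  moreover have "shift (p + m) x = shift (q + m) y"
    using shift_shift[OF P(1), of m p] shift_shift[OF P(2), of m q] P(3) by simp
  ultimately show "rigid_pair x y (p + m) (q + m)" using P by (simp add: rigid_pair_def)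
  have "set [shift p x m] = paths_from G (src G (x p)) m"
    using sx P(4) by (auto simp: paths_from_def rigid_def)
  from kp_elem_expand[OF _ _ P(5) _ this]
  have "kp_eq (Times (kp_s G (x p)) (kp_s_star G (y q)))
    (Plus (Times (kp_s G (x (p + m))) (kp_s_star G (y (q + m)))) Zero)"
    using inf_pathsD[OF P(1), of p] inf_pathsD[OF P(2), of q] sx(4) sy(4) P(3) by simp
  then show "kp_eq (kp_elem x y p q) (kp_elem x y (p + m) (q + m))"
    unfolding kp_elem_def by (rule alg_eq.trans[OF _ alg_eq_plus_Zero])
qed

text \<open>Equal lags mean q + p' = q' + p. Prolonging the first pair by p' and the second by p
  therefore leads to the same element.\<close>

lemma kp_elem_eq:
  assumes "rigid_pair x y p q" "rigid_pair x y p' q'" "int_vec p - int_vec q = int_vec p' - int_vec q'"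
  shows "kp_eq (kp_elem x y p q) (kp_elem x y p' q')"
proof -
  have "q + p' = q' + p"
  proof -
    have "int (vec_nth (q + p') i) = int (vec_nth (q' + p) i)" for i
      using arg_cong[OF assms(3), of "\<lambda>v. vec_nth v i"] by simp
    then show ?thesis by (simp only: cart_eq_iff of_nat_eq_iff) simp
  qed
  then have "kp_elem x y (p + p') (q + p') = kp_elem x y (p' + p) (q' + p)"
    by (simp add: add.commute)
  then show ?thesis
    using alg_eq.trans[OF rigid_pair_extend(2)[OF assms(1), of p']] alg_eq.sym[OF rigid_pair_extend(2)[OF assms(2), of p]]
    by metis
qed

definition kp_basis_set :: "('f::field, 'a kp_gen) alg_term set" where
  "kp_basis_set = {kp_elem x y p q | x y p q. rigid_pair x y p q}"

lemma rigid_pair_prepend: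
  assumes "rigid_pair x y p q" "l \<in> paths G" "src G l = x 0"
  shows "rigid_pair (prepend l x) y (deg G l + p) q"
    "kp_eq (Times (kp_s G l) (kp_elem x y p q)) (kp_elem (prepend l x) y (deg G l + p) q)"
proof -
  note P = rigid_pairD[OF assms(1)]
  note a = assms(2) P(1) assms(3)
  have add: "prepend l x (deg G l + p) = cmp G l (x p)" by (rule prepend_add[OF a])
  have c: "src G l = rng G (x p)" using inf_path_rng(1)[OF P(1)] assms(3) by simp
  have "shift (deg G l + p) (prepend l x) = shift q y"
    using shift_shift[OF prepend_closed[OF a], of p "deg G l"] shift_prepend(1)[OF a] P(3) by simp
  moreover have "src G (cmp G l (x p)) = src G (x p)"
    using src_cmp[OF a(1) inf_pathsD(1)[OF P(1)] c] .
  ultimately show "rigid_pair (prepend l x) y (deg G l + p) q"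
    using P prepend_closed[OF a] add by (simp add: rigid_pair_def)
  show "kp_eq (Times (kp_s G l) (kp_elem x y p q)) (kp_elem (prepend l x) y (deg G l + p) q)"
    unfolding kp_elem_def add
    by (rule alg_eq.trans[OF alg_eq.sym[OF alg_eq.times_assoc] alg_eq_times_left[OF kp_s_cmp[OF a(1) inf_pathsD(1)[OF P(1)] c]]])
qed

lemma kp_basis_path:
  assumes "t \<in> kp_basis_set" "l \<in> paths G"
  shows "alg_span (kp_relations G) kp_basis_set (Times (kp_s G l) t)"
proof -
  obtain x y p q where t: "t = kp_elem x y p q" "rigid_pair x y p q"
    using assms(1) by (auto simp: kp_basis_set_def)
  note P = rigid_pairD[OF t(2)]
  show ?thesis
  proof (cases "src G l = x 0")
    case True
    note E = rigid_pair_prepend[OF t(2) assms(2) True]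
    have "kp_elem (prepend l x) y (deg G l + p) q \<in> kp_basis_set"
      using E(1) unfolding kp_basis_set_def by blast
    then show ?thesis unfolding t(1) by (rule alg_span.eq[OF E(2) alg_span.base])
  next
    case False
    have "kp_eq (Times (kp_s G l) (kp_s G (x p))) Zero"
      using kp_mismatch[OF _ _ False kp_s_src[OF assms(2)]] kp_rng_s[OF inf_pathsD(1)[OF P(1)], of p]
        inf_path_rng[OF P(1)] src_vertex[OF assms(2)] by simp
    then have "kp_eq (Times (kp_s G l) (kp_elem x y p q)) Zero"
      unfolding kp_elem_def
      using alg_eq.trans[OF alg_eq.sym[OF alg_eq.times_assoc] alg_eq.trans[OF alg_eq_times_left alg_eq_Zero_times]]
      by blast
    then show ?thesis unfolding t(1) by (rule alg_span.eq[OF _ alg_span.zero])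
  qed
qed

text \<open>(KP3) compares paths of equal degree, so the segment of x is first prolonged by d(l). It
  then begins with x(0,d(l)), which either equals l and cancels, leaving a shift of x, or makes the
  product vanish.\<close>

lemma kp_basis_ghost:
  assumes "t \<in> kp_basis_set" "l \<in> paths G"
  shows "alg_span (kp_relations G) kp_basis_set (Times (kp_s_star G l) t)"
proof -
  obtain x y p q where t: "t = kp_elem x y p q" "rigid_pair x y p q"
    using assms(1) by (auto simp: kp_basis_set_def)
  let ?d = "deg G l"
  note P = rigid_pairD[OF t(2)]
  note E = rigid_pair_extend[OF t(2), of ?d]
  note s = inf_path_split[OF P(1), of ?d p]
  let ?r = "kp_s_star G (y (q + ?d))"
  let ?v = "if l = x ?d then kp_p (src G l) else Zero"
  have x: "x ?d \<in> paths G" "deg G (x ?d) = ?d" using inf_pathsD[OF P(1)] by auto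
  have "kp_eq (Times (kp_s_star G l) t) (Times (kp_s_star G l) (Times (kp_s G (x (?d + p))) ?r))"
    using alg_eq_times_right[OF E(2)] by (simp add: t(1) kp_elem_def add.commute)
  also have "kp_eq \<dots> (Times (kp_s_star G l) (Times (Times (kp_s G (x ?d)) (kp_s G (shift ?d x p))) ?r))"
    unfolding s(4) by (intro alg_eq_times_right alg_eq_times_left alg_eq.sym[OF kp_s_cmp] x s)
  also have "kp_eq \<dots> (Times (kp_s_star G l) (Times (kp_s G (x ?d)) (Times (kp_s G (shift ?d x p)) ?r)))"
    by (rule alg_eq_times_right[OF alg_eq.times_assoc])
  also have "kp_eq \<dots> (Times (Times (kp_s_star G l) (kp_s G (x ?d))) (Times (kp_s G (shift ?d x p)) ?r))"
    by (rule alg_eq.sym[OF alg_eq.times_assoc])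
  also have "kp_eq \<dots> (Times ?v (Times (kp_s G (shift ?d x p)) ?r))"
    using kp_star_s[OF assms(2) x(1)] x(2) by (intro alg_eq_times_left) simp
  finally have main: "kp_eq (Times (kp_s_star G l) t) (Times ?v (Times (kp_s G (shift ?d x p)) ?r))" .
  show ?thesis
  proof (cases "l = x ?d")
    case True
    have "kp_eq (Times (kp_p (src G l)) (Times (kp_s G (shift ?d x p)) ?r))
      (Times (Times (kp_p (src G l)) (kp_s G (shift ?d x p))) ?r)"
      by (rule alg_eq.sym[OF alg_eq.times_assoc])
    also have "kp_eq \<dots> (Times (kp_s G (shift ?d x p)) ?r)"
      using kp_rng_s[OF s(1)] s(3) True by (intro alg_eq_times_left) simp
    finally have "kp_eq (Times (kp_s_star G l) t) (kp_elem (shift ?d x) y p (q + ?d))"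
      using alg_eq.trans[OF main] True by (simp add: kp_elem_def)
    moreover have "rigid_pair (shift ?d x) y p (q + ?d)"
      using rigid_pairD[OF E(1)] shift_closed[OF P(1), of ?d] shift_shift[OF P(1), of p ?d] src_shift[OF P(1), of ?d p]
      by (simp add: rigid_pair_def add.commute)
    then have "kp_elem (shift ?d x) y p (q + ?d) \<in> kp_basis_set"
      unfolding kp_basis_set_def by blast
    ultimately show ?thesis by (blast intro: alg_span.eq alg_span.base)
  next
    case False
    then have "kp_eq (Times (kp_s_star G l) t) (Times Zero (Times (kp_s G (shift ?d x p)) ?r))"
      using main by simp
    then have "kp_eq (Times (kp_s_star G l) t) Zero"
      by (rule alg_eq.trans[OF _ alg_eq_Zero_times])
    then show ?thesis by (rule alg_span.eq[OF _ alg_span.zero])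
  qed
qed

text \<open>Prolonging both factors by the pigeonhole degree makes their sources rigid, and an
  infinite path z from there supplies x and y. Both degrees grow by the same vector, so the
  expansion stays in one homogeneous component.\<close>

lemma kp_elem_expand_rigid:
  assumes "condition_HNE G" "finite (vertices G)" "p \<in> paths G" "q \<in> paths G" "src G p = src G q"
  shows "\<exists>ts. kp_eq (Times (kp_s G p) (kp_s_star G q)) (alg_sum ts) \<and>
    (\<forall>t\<in>set ts. \<exists>x y p' q'. t = kp_elem x y p' q' \<and> rigid_pair x y p' q' \<and>
       int_vec p' - int_vec q' = int_vec (deg G p) - int_vec (deg G q))"
proof -
  let ?N = "diag (card (vertices G)) :: nat ^ 'k"
  obtain xs where xs: "distinct xs" "set xs = paths_from G (src G p) ?N"
    using finite_distinct_list[OF finite_paths_from] by metis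
  have "\<exists>x y p' q'. Times (kp_s G (cmp G p a)) (kp_s_star G (cmp G q a)) = kp_elem x y p' q' \<and> rigid_pair x y p' q' \<and>
     int_vec p' - int_vec q' = int_vec (deg G p) - int_vec (deg G q)" if "a \<in> set xs" for a
  proof -
    have a: "a \<in> paths G" "rng G a = src G p" "deg G a = ?N" using that xs(2) by (auto simp: paths_from_def)
    obtain z where z: "z \<in> inf_paths" "z 0 = src G a"
      using inf_path_exists[OF src_vertex[OF a(1)]] by blast
    have r: "rigid (src G a)" using HNE_long_path_rigid[OF assms(1,2) a(1)] a(3) by simp
    have cp: "cmp G p a \<in> paths G" "src G (cmp G p a) = z 0" "deg G (cmp G p a) = deg G p + ?N"
      and cq: "cmp G q a \<in> paths G" "src G (cmp G q a) = z 0" "deg G (cmp G q a) = deg G q + ?N"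
      using assms a z by (auto simp: cmp_closed src_cmp deg_cmp)
    let ?x = "prepend (cmp G p a) z" and ?y = "prepend (cmp G q a) z"
    note sp = shift_prepend[OF cp(1) z(1) cp(2)] and sq = shift_prepend[OF cq(1) z(1) cq(2)]
    have "rigid_pair ?x ?y (deg G p + ?N) (deg G q + ?N)"
      using sp sq cp cq z r prepend_closed by (simp add: rigid_pair_def)
    moreover have "Times (kp_s G (cmp G p a)) (kp_s_star G (cmp G q a)) = kp_elem ?x ?y (deg G p + ?N) (deg G q + ?N)"
      using sp sq cp cq by (simp add: kp_elem_def)
    moreover have "int_vec (deg G p + ?N) - int_vec (deg G q + ?N) = int_vec (deg G p) - int_vec (deg G q)"
      by (simp add: int_vec_add)
    ultimately show ?thesis by blast
  qed
  then show ?thesis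
    using kp_elem_expand[OF assms(3-5) xs]
    by (intro exI[of _ "map (\<lambda>a. Times (kp_s G (cmp G p a)) (kp_s_star G (cmp G q a))) xs"]) auto
qed

text \<open>Next to a generator only one projection survives on each side: for a path, its range on
  the left and its source on the right; for a ghost path the other way round. Induction over the
  term does the rest.\<close>

lemma kp_unit:
  assumes "distinct vs" "set vs = vertices G" "gens t \<subseteq> kp_gens G"
  shows "kp_eq (Times (alg_sum (map kp_p vs)) t) t \<and>
    kp_eq (Times t (alg_sum (map kp_p vs))) t"
  using assms(3)
proof (induction t)
  case (Gen g)
  have left: "kp_eq (Times (alg_sum (map kp_p vs)) a) a"
    if "u \<in> vertices G" "kp_eq (Times (kp_p u) a) a" for u a
  proof -
    have "kp_eq (Times (kp_p v) a) Zero" if "v \<in> set vs" "v \<noteq> u" for v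
      using kp_mismatch[OF _ \<open>u \<in> vertices G\<close> that(2) kp_vertex_idem \<open>kp_eq (Times (kp_p u) a) a\<close>] that(1) assms(2)
      by simp
    then have "kp_eq (alg_sum (map (\<lambda>v. Times (kp_p v) a) vs)) (Times (kp_p u) a)"
      using assms that by (intro alg_eq_sum_single) auto
    then have "kp_eq (alg_sum (map (\<lambda>v. Times (kp_p v) a) vs)) a"
      using that(2) by (rule alg_eq.trans)
    then show ?thesis using alg_eq.trans[OF alg_eq_sum_times[of "kp_relations G" "map kp_p vs" a]] by (simp add: comp_def)
  qed
  have right: "kp_eq (Times a (alg_sum (map kp_p vs))) a"
    if "u \<in> vertices G" "kp_eq (Times a (kp_p u)) a" for u a
  proof -
    have "kp_eq (Times a (kp_p v)) Zero" if "v \<in> set vs" "v \<noteq> u" for v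
      using kp_mismatch[OF \<open>u \<in> vertices G\<close> _ that(2)[symmetric] \<open>kp_eq (Times a (kp_p u)) a\<close> kp_vertex_idem] that(1) assms(2)
      by simp
    then have "kp_eq (alg_sum (map (\<lambda>v. Times a (kp_p v)) vs)) (Times a (kp_p u))"
      using assms that by (intro alg_eq_sum_single) auto
    then have "kp_eq (alg_sum (map (\<lambda>v. Times a (kp_p v)) vs)) a"
      using that(2) by (rule alg_eq.trans)
    then show ?thesis using alg_eq.trans[OF alg_eq_times_sum[of "kp_relations G" a "map kp_p vs"]] by (simp add: comp_def)
  qed
  consider v where "g = Vert v" "v \<in> vertices G" | x where "g = Path x" "x \<in> paths G" "x \<notin> vertices G"
    | x where "g = Ghost x" "x \<in> paths G" "x \<notin> vertices G"
    using Gen by (auto simp: kp_gens_def)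
  then show ?case
  proof cases
    case 1
    then show ?thesis using left right kp_vertex_idem by blast
  next
    case 2
    then have "Gen g = kp_s G x" by (simp add: kp_s_def)
    then show ?thesis using left[OF rng_vertex kp_rng_s, of x] right[OF src_vertex kp_s_src, of x] 2 by metis
  next
    case 3
    then have "Gen g = kp_s_star G x" by (simp add: kp_s_star_def)
    then show ?thesis using left[OF src_vertex kp_src_star, of x] right[OF rng_vertex kp_star_rng, of x] 3 by metis
  qed
next
  case Zero
  show ?case using alg_eq_Zero_times alg_eq_times_Zero by blast
next
  case (Plus a b)
  then show ?case
    by (intro conjI alg_eq.trans[OF alg_eq.times_plus alg_eq.cong_plus]
        alg_eq.trans[OF alg_eq.plus_times alg_eq.cong_plus]) auto
next
  case (Scale c a)
  then show ?case
    by (intro conjI alg_eq.trans[OF alg_eq.times_scale alg_eq.cong_scale]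
        alg_eq.trans[OF alg_eq.scale_times alg_eq.cong_scale]) auto
next
  case (Times a b)
  then show ?case
    by (intro conjI alg_eq.trans[OF alg_eq.sym[OF alg_eq.times_assoc] alg_eq_times_left]
        alg_eq.trans[OF alg_eq.times_assoc alg_eq_times_right]) auto
qed

text \<open>The span is closed under left multiplication and contains all vertex projections, hence
  the unit; and t is t times the unit.\<close>

lemma kp_span:
  fixes t :: "('f::field, 'a kp_gen) alg_term"
  assumes "condition_HNE G" "finite (vertices G)" "gens t \<subseteq> kp_gens G"
  shows "alg_span (kp_relations G) kp_basis_set t"
proof -
  let ?R = "kp_relations G :: (('f, _) alg_term \<times> _) set"
  obtain vs where vs: "distinct vs" "set vs = vertices G"
    using finite_distinct_list[OF assms(2)] by metis
  have "alg_span ?R kp_basis_set (kp_p v)" if v: "v \<in> vertices G" for v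
  proof -
    have "v \<in> paths G" using vertexD[OF v] by simp
    from kp_elem_expand_rigid[OF assms(1,2) this this HOL.refl] obtain ts :: "('f, 'a kp_gen) alg_term list" where
      ts: "kp_eq (Times (kp_p v) (kp_p v)) (alg_sum ts)" "\<forall>t\<in>set ts. t \<in> kp_basis_set"
      using v unfolding kp_basis_set_def by fastforce
    have "alg_span ?R kp_basis_set (alg_sum ts)"
      using ts(2) by (intro alg_span_sum alg_span.base) auto
    then show ?thesis
      using alg_span.eq[OF alg_eq.trans[OF alg_eq.sym[OF kp_vertex_idem[OF v]] ts(1)]] by blast
  qed
  then have e: "alg_span ?R kp_basis_set (alg_sum (map kp_p vs))"
    using vs by (intro alg_span_sum) auto
  have "alg_span ?R kp_basis_set (Times (Gen g) s)" if "g \<in> kp_gens G" "s \<in> kp_basis_set" for g s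
  proof -
    from that(1) consider l where "l \<in> paths G" "(Gen g :: ('f, _) alg_term) = kp_s G l" | l where "l \<in> paths G" "(Gen g :: ('f, _) alg_term) = kp_s_star G l"
      unfolding kp_gens_def kp_s_def kp_s_star_def using vertexD by fastforce
    then show ?thesis
      by cases (simp_all add: kp_basis_path[OF that(2)] kp_basis_ghost[OF that(2)])
  qed
  from alg_span_ideal[OF this assms(3) e]
  have "alg_span ?R kp_basis_set (Times t (alg_sum (map kp_p vs)))" .
  then show ?thesis using alg_span.eq[OF alg_eq.sym] kp_unit[OF vs assms(3)] by blast
qed

end

section \<open>The representation on infinite paths\<close>

lemma (in module) linear_functional_lincomb:
  assumes add: "\<And>x y. x \<in> carrier M \<Longrightarrow> y \<in> carrier M \<Longrightarrow> \<phi> (x \<oplus>\<^bsub>M\<^esub> y) = \<phi> x + (\<phi> y :: 'e::ab_group_add)"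
    and scale: "\<And>c x. c \<in> carrier R \<Longrightarrow> x \<in> carrier M \<Longrightarrow> \<phi> (c \<odot>\<^bsub>M\<^esub> x) = s c (\<phi> x)"
    and "finite A" "A \<subseteq> carrier M" "a \<in> A \<rightarrow> carrier R"
  shows "\<phi> (lincomb a A) = (\<Sum>v\<in>A. s (a v) (\<phi> v))"
  using assms(3-5)
proof (induction A)
  case empty
  have "\<phi> \<zero>\<^bsub>M\<^esub> + 0 = \<phi> \<zero>\<^bsub>M\<^esub> + \<phi> \<zero>\<^bsub>M\<^esub>" using add[of "\<zero>\<^bsub>M\<^esub>" "\<zero>\<^bsub>M\<^esub>"] by simp
  then have "\<phi> \<zero>\<^bsub>M\<^esub> = 0" by (metis add_left_cancel)
  then show ?case by (simp add: lincomb_def)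
next
  case (insert v A)
  then have c: "lincomb a A \<in> carrier M" "a v \<in> carrier R" "v \<in> carrier M" "a v \<odot>\<^bsub>M\<^esub> v \<in> carrier M"
    by (auto intro!: lincomb_closed)
  have "lincomb a (A \<union> {v}) = a v \<odot>\<^bsub>M\<^esub> v \<oplus>\<^bsub>M\<^esub> lincomb a A"
    using insert by (intro lincomb_insert) auto
  then have "\<phi> (lincomb a (insert v A)) = s (a v) (\<phi> v) + \<phi> (lincomb a A)"
    using c by (simp add: add scale)
  then show ?case using insert by auto
qed

lemma (in vectorspace) span_vectorspace:
  assumes "S \<subseteq> carrier V"
  shows "vectorspace K (V\<lparr>carrier := span S\<rparr>)" "submodule K (span S) V"
proof -
  show "submodule K (span S) V" by (rule span_is_submodule[OF assms])
  then show "vectorspace K (V\<lparr>carrier := span S\<rparr>)"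
    by (intro vectorspace.intro submodule_is_module field_axioms)
qed

lemma (in vectorspace) fin_dim_spanI:
  assumes "S \<subseteq> carrier V" "finite A" "A \<subseteq> span S" "S \<subseteq> span A"
  shows "vectorspace.fin_dim K (V\<lparr>carrier := span S\<rparr>)"
proof -
  note W = span_vectorspace[OF assms(1)]
  have A: "A \<subseteq> carrier V" using assms(3) span_is_subset2[OF assms(1)] by blast
  have "span A = span S"
    using span_is_subset[OF assms(3) W(2)] span_is_subset[OF assms(4) span_is_submodule[OF A]] by blast
  then show ?thesis
    unfolding vectorspace.fin_dim_def[OF W(1)]
    using span_li_not_depend(1)[OF assms(3) W(2)] assms(2,3) by auto
qed

text \<open>The functionals are dual to the family u, so applying them to a linear relation isolates
  each coefficient. An independent set cannot exceed a finite dimension.\<close>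

lemma infinite_independent_family:
  fixes V :: "('f::field, 'c) module" and u :: "nat \<Rightarrow> 'c" and \<phi> :: "nat \<Rightarrow> 'c \<Rightarrow> 'f"
  assumes "vectorspace class_ring V" "S \<subseteq> carrier V"
    and u: "\<And>j. u j \<in> module.span class_ring V S"
    and add: "\<And>i x y. x \<in> carrier V \<Longrightarrow> y \<in> carrier V \<Longrightarrow> \<phi> i (x \<oplus>\<^bsub>V\<^esub> y) = \<phi> i x + \<phi> i y"
    and scale: "\<And>i c x. x \<in> carrier V \<Longrightarrow> \<phi> i (c \<odot>\<^bsub>V\<^esub> x) = c * \<phi> i x"
    and dual: "\<And>i j. \<phi> i (u j) = (if i = j then 1 else 0)"
  shows "\<not> vectorspace.fin_dim class_ring (V\<lparr>carrier := module.span class_ring V S\<rparr>)"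
proof
  interpret V: vectorspace class_ring V by fact
  let ?W = "V\<lparr>carrier := V.span S\<rparr>"
  assume fd: "vectorspace.fin_dim class_ring ?W"
  note W = V.span_vectorspace[OF assms(2)]
  have uc: "range u \<subseteq> carrier V" using u V.span_is_subset2[OF assms(2)] by blast
  have ur: "range u \<subseteq> V.span S" using u by blast
  have inj: "inj u"
  proof (rule injI)
    fix i j assume "u i = u j"
    then have "\<phi> i (u i) = \<phi> i (u j)" by simp
    then show "i = j" using dual[of i i] dual[of i j] by (auto split: if_splits)
  qed
  have "V.lin_indpt (range u)"
  proof
    assume "V.lin_dep (range u)"
    then obtain A a v where A: "finite A" "A \<subseteq> range u" "V.lincomb a A = \<zero>\<^bsub>V\<^esub>" "v \<in> A" "a v \<noteq> 0"
      unfolding V.lin_dep_def by auto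
    obtain i where i: "v = u i" using A by auto
    have lin: "\<phi> i (V.lincomb b B) = (\<Sum>w\<in>B. b w * \<phi> i w)" if "finite B" "B \<subseteq> carrier V" for b B
      using V.linear_functional_lincomb[of "\<phi> i" "\<lambda>c x. c * x" B b] add scale that by simp
    have "\<phi> i (V.lincomb a A) = (\<Sum>w\<in>A. a w * \<phi> i w)" using A uc by (intro lin) auto
    also have "\<dots> = (\<Sum>w\<in>A. if w = v then a w else 0)"
    proof (rule sum.cong)
      fix w assume "w \<in> A"
      then obtain j where "w = u j" using A by auto
      then show "a w * \<phi> i w = (if w = v then a w else 0)"
        using dual[of i j] inj i by (auto simp: inj_eq)
    qed simp
    also have "\<dots> = a v" using A by simp
    finally have "\<phi> i \<zero>\<^bsub>V\<^esub> \<noteq> 0" using A by simp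
    moreover have "\<phi> i \<zero>\<^bsub>V\<^esub> = 0" using lin[of "{}"] by (simp add: V.lincomb_def)
    ultimately show False by simp
  qed
  then have "\<not> module.lin_dep class_ring ?W (range u)"
    using V.span_li_not_depend(2)[OF ur W(2)] by simp
  then have "finite (range u)"
    using vectorspace.li_le_dim(1)[OF W(1) fd, of "range u"] ur by simp
  then show False using inj finite_imageD by blast
qed

abbreviation group_monom :: "'g::zero \<Rightarrow> ('g \<Rightarrow>\<^sub>0 'f::zero_neq_one)" where
  "group_monom n \<equiv> Poly_Mapping.single n 1"

lemma single_times: "Poly_Mapping.single a c * (Poly_Mapping.single b d * x) = Poly_Mapping.single (a + b) (c * d) * x"
  for x :: "('g::comm_monoid_add) \<Rightarrow>\<^sub>0 ('f::comm_ring_1)"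
  by (simp add: mult_single flip: mult.assoc)

lemma alg_eval_alg_sum:
  "alg_eval \<sigma> J (alg_sum (map F xs)) f x = (\<Sum>t\<leftarrow>xs. alg_eval \<sigma> J (F t) f x)"
  by (induction xs) auto

context row_finite_k_graph
begin

text \<open>The group element in the values of the functions records the degree.\<close>

fun kp_operator :: "'a kp_gen \<Rightarrow> ((nat ^ 'k \<Rightarrow> 'a) \<Rightarrow> ((int ^ 'k) \<Rightarrow>\<^sub>0 'f::field)) \<Rightarrow>
    (nat ^ 'k \<Rightarrow> 'a) \<Rightarrow> ((int ^ 'k) \<Rightarrow>\<^sub>0 'f)" where
  "kp_operator (Vert v) f x = (if x \<in> inf_paths \<and> x 0 = v then f x else 0)"
| "kp_operator (Path p) f x = (if x \<in> inf_paths \<and> x (deg G p) = p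
     then group_monom (int_vec (deg G p)) * f (shift (deg G p) x) else 0)"
| "kp_operator (Ghost p) f x = (if x \<in> inf_paths \<and> x 0 = src G p
     then group_monom (- int_vec (deg G p)) * f (prepend p x) else 0)"

abbreviation kp_eval :: "('f::field, 'a kp_gen) alg_term \<Rightarrow> ((nat ^ 'k \<Rightarrow> 'a) \<Rightarrow> ((int ^ 'k) \<Rightarrow>\<^sub>0 'f)) \<Rightarrow>
    (nat ^ 'k \<Rightarrow> 'a) \<Rightarrow> ((int ^ 'k) \<Rightarrow>\<^sub>0 'f)" where
  "kp_eval \<equiv> alg_eval (Poly_Mapping.single 0) kp_operator"

lemma kp_operators:
  "alg_operators (Poly_Mapping.single 0 :: 'f::field \<Rightarrow> ((int ^ 'k) \<Rightarrow>\<^sub>0 'f)) kp_operator"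
proof
  fix g :: "'a kp_gen" and f f' :: "(nat ^ 'k \<Rightarrow> 'a) \<Rightarrow> ((int ^ 'k) \<Rightarrow>\<^sub>0 'f)" and k
  show "kp_operator g (\<lambda>x. f x + f' x) = (\<lambda>x. kp_operator g f x + kp_operator g f' x)"
    by (cases g) (auto simp: fun_eq_iff algebra_simps)
  show "kp_operator g (\<lambda>x. k * f x) = (\<lambda>x. k * kp_operator g f x)"
    by (cases g) (auto simp: fun_eq_iff algebra_simps)
qed (auto simp: single_add mult_single)

lemma kp_eval_s:
  assumes "p \<in> paths G"
  shows "kp_eval (kp_s G p) f x = (if x \<in> inf_paths \<and> x (deg G p) = p
     then group_monom (int_vec (deg G p)) * f (shift (deg G p) x) else 0)"
  using vertexD[of p] shift_0[of x] by (cases "p \<in> vertices G") (auto simp: kp_s_def)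

lemma kp_eval_star:
  assumes "p \<in> paths G"
  shows "kp_eval (kp_s_star G p) f x = (if x \<in> inf_paths \<and> x 0 = src G p
     then group_monom (- int_vec (deg G p)) * f (prepend p x) else 0)"
proof (cases "p \<in> vertices G")
  case True
  then show ?thesis using vertexD[OF True] shift_0[of x] prepend_shift[of x 0] by auto
qed (simp add: kp_s_star_def)

text \<open>The operator reads f at the path in which the initial segment p of x is replaced by q,
  and records the lag d(p) - d(q) in the group algebra.\<close>

lemma kp_eval_elem:
  assumes "p \<in> paths G" "q \<in> paths G"
  shows "kp_eval (Times (kp_s G p) (kp_s_star G q)) f x =
    (if x \<in> inf_paths \<and> x (deg G p) = p \<and> src G p = src G q
     then group_monom (int_vec (deg G p) - int_vec (deg G q)) * f (prepend q (shift (deg G p) x)) else 0)"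
  using shift_closed[of x "deg G p"] shift_start[of x "deg G p"]
  by (auto simp: kp_eval_s[OF assms(1)] kp_eval_star[OF assms(2)] single_times)

lemma inf_path_cmp_iff:
  assumes "x \<in> inf_paths" "p \<in> paths G" "q \<in> paths G" "src G p = rng G q"
  shows "x (deg G p + deg G q) = cmp G p q \<longleftrightarrow> x (deg G p) = p \<and> shift (deg G p) x (deg G q) = q"
proof -
  note s = inf_path_split[OF assms(1), of "deg G p" "deg G q"] and d = inf_pathsD[OF assms(1), of "deg G p"]
  show ?thesis
    using factor_unique[OF d(1) s(1,3) assms(2-4)] d(2) s(4) by metis
qed

lemma kp_eval_relations:
  assumes "(a, b) \<in> kp_relations G"
  shows "kp_eval a = (kp_eval b :: _ \<Rightarrow> _ \<Rightarrow> ((int ^ 'k) \<Rightarrow>\<^sub>0 'f::field))"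
proof (intro ext)
  fix f :: "(nat ^ 'k \<Rightarrow> 'a) \<Rightarrow> ((int ^ 'k) \<Rightarrow>\<^sub>0 'f)" and z
  show "kp_eval a f z = kp_eval b f z"
  \<comment> \<open>The functions live on a whole type; every generator produces 0 outside the
    infinite paths, so both sides vanish there.\<close>
  proof (cases "z \<in> inf_paths")
    case False
    from assms show ?thesis
    proof cases
      case (KP4 v n xs)
      have "kp_eval (alg_sum (map (\<lambda>x. Times (kp_s G x) (kp_s_star G x)) xs)) f z = 0"
      proof -
        have "kp_eval (Times (kp_s G x) (kp_s_star G x)) f z = 0" if "x \<in> set xs" for x
        proof -
          have "x \<in> paths G" using that KP4 by (auto simp: paths_from_def)
          then show ?thesis unfolding kp_eval_elem[OF \<open>x \<in> paths G\<close> \<open>x \<in> paths G\<close>] using False by simp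
        qed
        then have "map (\<lambda>x. kp_eval (Times (kp_s G x) (kp_s_star G x)) f z) xs = map (\<lambda>_. 0) xs"
          by (rule map_cong[OF HOL.refl])
        then show ?thesis unfolding alg_eval_alg_sum by (simp only: sum_list_0)
      qed
      then show ?thesis using False KP4 by (simp add: alg_sum_def)
    qed (use False in \<open>auto simp: kp_eval_s kp_eval_star cmp_closed\<close>)
  next
    case z: True
    note sc = shift_closed[OF z] and st = shift_start[OF z] and r = inf_path_rng(1)[OF z]
    from assms show ?thesis
    proof cases
      case (KP1 u v)
      then show ?thesis by auto
    next
      case (KP2_path x y)
      then show ?thesis
        using inf_path_cmp_iff[OF z, of x y] z sc shift_shift[OF z, of "deg G y" "deg G x"]
        by (auto simp: kp_eval_s cmp_closed deg_cmp single_times int_vec_add)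
    next
      case (KP2_ghost x y)
      have c: "cmp G x y \<in> paths G" "src G (cmp G x y) = src G y" "deg G (cmp G x y) = deg G x + deg G y"
        using KP2_ghost by (auto simp: cmp_closed src_cmp deg_cmp)
      show ?thesis
      proof (cases "z 0 = src G y")
        case True
        have "prepend y z \<in> inf_paths" "prepend y z 0 = src G x" "prepend x (prepend y z) = prepend (cmp G x y) z"
          using KP2_ghost True z prepend_closed[of y z] shift_prepend[of y z] prepend_prepend[of x y z] by auto
        then show ?thesis
          using KP2_ghost True z c by (simp add: kp_eval_star single_times int_vec_add minus_diff_commute)
      next
        case False
        then show ?thesis using KP2_ghost c by (simp add: kp_eval_star)
      qed
    next
      case (KP2_rng_path x)
      then show ?thesis using z r[of "deg G x"] by (auto simp: kp_eval_s)
    next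
      case (KP2_path_src x)
      then show ?thesis using z sc[of "deg G x"] st[of "deg G x"] by (auto simp: kp_eval_s)
    next
      case (KP2_src_ghost x)
      then show ?thesis using z by (auto simp: kp_eval_star)
    next
      case (KP2_ghost_rng x)
      then show ?thesis
        using z prepend_closed[of x z] shift_prepend[of x z] by (auto simp: kp_eval_star)
    next
      case (KP3 x y)
      show ?thesis
      proof (cases "z 0 = src G x")
        case True
        then have "prepend x z \<in> inf_paths" "prepend x z (deg G y) = x" "shift (deg G y) (prepend x z) = z"
          using KP3 z prepend_closed[of x z] shift_prepend[of x z] by auto
        then show ?thesis
          using KP3 True z by (cases "x = y") (simp_all add: kp_eval_s kp_eval_star single_times single_one)
      next
        case False
        then show ?thesis using KP3 by (auto simp: kp_eval_s kp_eval_star)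
      qed
    next
      case (KP4 v n xs)
      have "kp_eval (alg_sum (map (\<lambda>x. Times (kp_s G x) (kp_s_star G x)) xs)) f z =
        (\<Sum>x\<in>set xs. kp_eval (Times (kp_s G x) (kp_s_star G x)) f z)"
        unfolding alg_eval_alg_sum by (rule sum_list_distinct_conv_sum_set[OF KP4(5)])
      \<comment> \<open>Of the paths of degree n only the initial segment of z contributes, and it
        is in the list exactly when z starts at v.\<close>
      also have "\<dots> = (\<Sum>x\<in>set xs. if x = z n then f z else 0)"
      proof (rule sum.cong)
        fix x assume "x \<in> set xs"
        then have x: "x \<in> paths G" "deg G x = n" using KP4 by (auto simp: paths_from_def)
        show "kp_eval (Times (kp_s G x) (kp_s_star G x)) f z = (if x = z n then f z else 0)"
          unfolding kp_eval_elem[OF x(1) x(1)] x(2) using z prepend_shift[OF z, of n] by auto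
      qed simp
      also have "\<dots> = (if z n \<in> set xs then f z else 0)" by simp
      also have "z n \<in> set xs \<longleftrightarrow> z 0 = v"
        using KP4 r[of n] inf_pathsD[OF z, of n] by (auto simp: paths_from_def)
      finally show ?thesis using KP4 z by (simp add: alg_sum_def)
    qed
  qed
qed

lemma kp_eval_cong: "kp_eq s t \<Longrightarrow> kp_eval s = kp_eval t"
  by (rule alg_operators.alg_eval_sound[OF kp_operators]) (auto intro: kp_eval_relations)

text \<open>x is the only infinite path that begins with \<open>x p\<close>, because that segment
  ends at a rigid vertex.\<close>

lemma kp_eval_kp_elem:
  assumes "rigid_pair x y p q"
  shows "kp_eval (kp_elem x y p q) f z = (if z = x then group_monom (int_vec p - int_vec q) * f y else 0)"
proof -
  note P = rigid_pairD[OF assms]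
  note dx = inf_pathsD[OF P(1), of p] and dy = inf_pathsD[OF P(2), of q]
  have "z = x" if "z \<in> inf_paths" "z p = x p"
  proof -
    have "shift p z = shift p x"
      by (rule rigid_inf_path_unique[OF P(4) shift_closed[OF that(1)] shift_closed[OF P(1)]])
        (simp_all add: shift_start that P(1))
    then show ?thesis using prepend_shift[OF that(1), of p] prepend_shift[OF P(1), of p] that(2) by metis
  qed
  moreover have "prepend (y q) (shift p x) = y" using prepend_shift[OF P(2), of q] P(3) by simp
  ultimately show ?thesis
    unfolding kp_elem_def kp_eval_elem[OF dx(1) dy(1)] using P dx dy by auto
qed

section \<open>Local finiteness\<close>

lemma KP_presented: "KP TYPE('f::field) G = presented_algebra (kp_gens G) (kp_relations G)"
  by (simp add: KP_def)

lemma kp_class_alg_class: "kp_class G t = alg_class (kp_gens G) (kp_relations G) t"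
  by (simp add: kp_class_def alg_class_def)

lemma KP_vectorspace: "vectorspace class_ring (KP TYPE('f::field) G)"
  unfolding KP_presented by (intro vectorspace.intro presented_module class_field)

lemma KP_component_generators:
  "{kp_class G (Times (kp_s G x) (kp_s_star G y)) | x y.
     x \<in> paths G \<and> y \<in> paths G \<and> int_deg G x - int_deg G y = n} \<subseteq> carrier (KP TYPE('f::field) G)"
  unfolding KP_presented kp_class_alg_class by (auto intro!: alg_class_closed dest: gens_kp_s[THEN subsetD])

lemma int_deg_int_vec: "int_deg G x = int_vec (deg G x)"
  by (simp add: int_deg_def int_vec_def)

lemma HNE_imp_locally_finite:
  assumes "condition_HNE G" "finite (vertices G)"
  shows "locally_finite (KP TYPE('f::field) G) (KP_component TYPE('f) G)"
  unfolding locally_finite_def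
proof
  fix n :: "int ^ 'k"
  interpret V: vectorspace class_ring "KP TYPE('f) G" by (rule KP_vectorspace)
  let ?c = "kp_class G :: ('f, 'a kp_gen) alg_term \<Rightarrow> _"
  let ?S = "{?c (Times (kp_s G x) (kp_s_star G y)) | x y.
     x \<in> paths G \<and> y \<in> paths G \<and> int_deg G x - int_deg G y = n}"
  define A where "A = {?c (kp_elem x y p q) | x y p q. rigid_pair x y p q \<and> int_vec p - int_vec q = n}"
  \<comment> \<open>At the fixed lag n the class depends on the pair (x, y) alone, by
    \<open>kp_elem_eq\<close>, so one chosen representative per pair covers A.\<close>
  have "A \<subseteq> (\<lambda>(x, y). ?c (SOME t. \<exists>p q. t = kp_elem x y p q \<and> rigid_pair x y p q \<and> int_vec p - int_vec q = n))
      ` (inf_paths \<times> inf_paths)"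
  proof
    fix a assume "a \<in> A"
    then obtain x y p q where a: "a = ?c (kp_elem x y p q)" "rigid_pair x y p q" "int_vec p - int_vec q = n"
      by (auto simp: A_def)
    define t where "t = (SOME t :: ('f, 'a kp_gen) alg_term. \<exists>p q. t = kp_elem x y p q \<and> rigid_pair x y p q \<and> int_vec p - int_vec q = n)"
    have "\<exists>p q. t = kp_elem x y p q \<and> rigid_pair x y p q \<and> int_vec p - int_vec q = n"
      unfolding t_def by (rule someI_ex) (use a in blast)
    then obtain p' q' where t: "t = kp_elem x y p' q'" "rigid_pair x y p' q'" "int_vec p' - int_vec q' = n" by blast
    have "?c t = a"
      unfolding t(1) a(1) kp_class_alg_class
      by (rule alg_class_eq_iff[THEN iffD2, OF gens_kp_elem[OF t(2)] gens_kp_elem[OF a(2)] kp_elem_eq[OF t(2) a(2)]])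
        (simp add: t(3) a(3))
    then show "a \<in> (\<lambda>(x, y). ?c (SOME t. \<exists>p q. t = kp_elem x y p q \<and> rigid_pair x y p q \<and> int_vec p - int_vec q = n))
      ` (inf_paths \<times> inf_paths)"
      using rigid_pairD(1,2)[OF a(2)] t_def by force
  qed
  then have fin: "finite A"
    using HNE_finite_inf_paths[OF assms] by (auto intro: finite_subset)
  have "A \<subseteq> ?S"
  proof
    fix a assume "a \<in> A"
    then obtain x y p q where a: "a = ?c (kp_elem x y p q)" "rigid_pair x y p q" "int_vec p - int_vec q = n"
      by (auto simp: A_def)
    note d = inf_pathsD(1,2)[OF rigid_pairD(1)[OF a(2)], of p] inf_pathsD(1,2)[OF rigid_pairD(2)[OF a(2)], of q]
    have "a = ?c (Times (kp_s G (x p)) (kp_s_star G (y q)))" by (simp only: a(1) kp_elem_def)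
    moreover have "int_deg G (x p) - int_deg G (y q) = n" by (simp only: int_deg_int_vec d a(3))
    ultimately show "a \<in> ?S" using d(1,3) by blast
  qed
  then have sub: "A \<subseteq> V.span ?S" "A \<subseteq> carrier (KP TYPE('f) G)"
    by (rule subset_trans[OF _ V.in_own_span[OF KP_component_generators]],
        rule subset_trans[OF _ KP_component_generators])
  have sum_mem: "?c (alg_sum ts) \<in> V.span A" if "\<And>t. t \<in> set ts \<Longrightarrow> gens t \<subseteq> kp_gens G \<and> ?c t \<in> V.span A" for ts
    using that
  proof (induction ts)
    case Nil
    have "\<zero>\<^bsub>KP TYPE('f) G\<^esub> \<in> V.span A"
      using V.span_is_submodule[OF sub(2)] by (simp add: submodule_def)
    then show ?case by (simp add: KP_presented presented_zero kp_class_alg_class)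
  next
    case (Cons t ts)
    have "?c t \<oplus>\<^bsub>KP TYPE('f) G\<^esub> ?c (alg_sum ts) \<in> V.span A"
      using V.span_is_submodule[OF sub(2)] Cons by (auto simp: submodule_def)
    moreover have "gens (alg_sum ts) \<subseteq> kp_gens G" using Cons.prems by (auto simp: gens_alg_sum)
    ultimately show ?case
      using Cons.prems by (simp add: KP_presented presented_add kp_class_alg_class)
  qed
  have "?S \<subseteq> V.span A"
  proof
    fix s assume "s \<in> ?S"
    then obtain x y where s: "s = ?c (Times (kp_s G x) (kp_s_star G y))" "x \<in> paths G" "y \<in> paths G"
      "int_deg G x - int_deg G y = n" by auto
    have gx: "gens (Times (kp_s G x) (kp_s_star G y) :: ('f, _) alg_term) \<subseteq> kp_gens G"
      by (simp add: gens_kp_s(1)[OF s(2)] gens_kp_s(2)[OF s(3)])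
    show "s \<in> V.span A"
    proof (cases "src G x = src G y")
      case True
      obtain ts :: "('f, 'a kp_gen) alg_term list" where
        ts: "kp_eq (Times (kp_s G x) (kp_s_star G y)) (alg_sum ts)"
        "\<forall>t\<in>set ts. \<exists>x' y' p' q'. t = kp_elem x' y' p' q' \<and> rigid_pair x' y' p' q' \<and>
           int_vec p' - int_vec q' = int_vec (deg G x) - int_vec (deg G y)"
        using kp_elem_expand_rigid[OF assms s(2,3) True] by blast
      have t: "gens t \<subseteq> kp_gens G \<and> ?c t \<in> A" if tt: "t \<in> set ts" for t
      proof -
        obtain x' y' p' q' where t: "t = kp_elem x' y' p' q'" "rigid_pair x' y' p' q'"
           "int_vec p' - int_vec q' = int_vec (deg G x) - int_vec (deg G y)" using ts(2) tt by blast
        then show ?thesis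
          unfolding A_def t(1) using gens_kp_elem[OF t(2)] s(4)[unfolded int_deg_int_vec] by blast
      qed
      then have "?c (alg_sum ts) \<in> V.span A"
        using V.in_own_span[OF sub(2)] by (intro sum_mem) blast
      moreover have "gens (alg_sum ts) \<subseteq> kp_gens G" using t by (auto simp: gens_alg_sum)
      then have "s = ?c (alg_sum ts)"
        unfolding s(1) kp_class_alg_class using gx ts(1) by (subst alg_class_eq_iff) auto
      ultimately show ?thesis by simp
    next
      case False
      have "kp_eq (Times (kp_s G x) (kp_s_star G y) :: ('f, _) alg_term) Zero"
        using kp_mismatch[OF _ _ False kp_s_src[OF s(2)] kp_src_star[OF s(3)]] s by simp
      then have "s = ?c (alg_sum [])"
        unfolding s(1) kp_class_alg_class using gx by (subst alg_class_eq_iff) auto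
      then show ?thesis using sum_mem[of "[]"] by simp
    qed
  qed
  then show "vectorspace.fin_dim class_ring (KP TYPE('f) G\<lparr>carrier := KP_component TYPE('f) G n\<rparr>)"
    unfolding KP_component_def
    by (intro V.fin_dim_spanI[OF KP_component_generators fin sub(1)])
qed


section \<open>Independent projections from a loop with an entrance\<close>

lemma lookup_single_0_times:
  "Poly_Mapping.lookup (Poly_Mapping.single 0 c * x) n = c * Poly_Mapping.lookup x n"
  for x :: "('g::comm_monoid_add) \<Rightarrow>\<^sub>0 ('f::comm_ring_1)"
  unfolding mult_map_scale_conv_mult[symmetric] by (simp add: Poly_Mapping.map.rep_eq when_def)

lemma loop_power_add:
  assumes "is_loop G x"
  shows "loop_power x (i + j) = cmp G (loop_power x i) (loop_power x j)"
proof (induction i)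
  case 0
  then show ?case using loop_power[OF assms, of j] cmp_rng[of "loop_power x j"] by simp
next
  case (Suc i)
  have "x \<in> paths G" "src G x = rng G x" using assms by (auto simp: is_loop_def)
  then show ?case
    using Suc loop_power[OF assms, of i] loop_power[OF assms, of j]
      cmp_assoc[of x "loop_power x i" "loop_power x j"] by simp
qed

lemma locally_finite_imp_HNE:
  assumes "locally_finite (KP TYPE('f::field) G) (KP_component TYPE('f) G)"
  shows "condition_HNE G"
  unfolding condition_HNE_def
proof
  assume "\<exists>x y. is_loop G x \<and> is_entrance G x y"
  then obtain x y where xy: "is_loop G x" "is_entrance G x y" by blast
  have x: "x \<in> paths G" "src G x = rng G x" using xy(1) by (auto simp: is_loop_def)
  obtain z where z: "z \<in> paths G" "rng G z = rng G x" "deg G z = deg G x" "z \<noteq> x"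
    using entrance_extend[OF xy] by (auto simp: paths_from_def)
  note l = loop_power[OF xy(1)]
  have l': "loop_power x j \<in> paths G" "rng G (loop_power x j) = rng G x" "src G (loop_power x j) = rng G x" for j
    using l by auto
  \<comment> \<open>Since d(z) = d(x), the path \<open>p i\<close> has the degree of the loop power
    i + 1 but differs from it. For j > i the path \<open>p j\<close> begins with that power, hence
    not with \<open>p i\<close>; so no infinite path begins with two of them.\<close>
  define p where "p j = cmp G (loop_power x j) z" for j
  have p: "p j \<in> paths G" "src G (p j) = src G z" for j
    using l'[of j] z by (auto simp: p_def cmp_closed src_cmp)
  have dp: "deg G (p j) = deg G (loop_power x (Suc j))" for j
    using l'[of j] z x by (simp add: p_def deg_cmp add.commute)
  have lS: "loop_power x (Suc j) = cmp G (loop_power x j) x" for j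
    using loop_power_add[OF xy(1), of j 1] cmp_src[OF x(1)] x(2) by simp
  have ne: "loop_power x (Suc j) \<noteq> p j" for j
    using factor_unique[of "loop_power x j" z "loop_power x j" x] l'[of j] z x
    unfolding lS p_def by metis
  have pre_p: "pre (p (i + Suc d)) (deg G (p i)) = loop_power x (Suc i)" for i d
  proof -
    have "p (i + Suc d) = cmp G (loop_power x (Suc i + d)) z" by (simp add: p_def)
    also have "\<dots> = cmp G (loop_power x (Suc i)) (cmp G (loop_power x d) z)"
      unfolding loop_power_add[OF xy(1)] by (rule cmp_assoc[OF l'(1) l'(1) z(1)]) (simp_all only: l' z(2))
    finally show ?thesis
      using pre_suf_cmp(1)[of "loop_power x (Suc i)" "cmp G (loop_power x d) z"] l' z(1,2) dp[of i]
      by (simp add: cmp_closed rng_cmp del: loop_power.simps)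
  qed
  have le: "deg G (p i) \<le> deg G (p (i + d))" for i d
    unfolding cart_le_iff dp using l[of "Suc i"] l[of "Suc (i + d)"]
    by (simp del: loop_power.simps)
  obtain u where u: "u \<in> inf_paths" "u 0 = src G z"
    using inf_path_exists[OF src_vertex[OF z(1)]] by blast
  define w where "w j = prepend (p j) u" for j
  have w: "w j \<in> inf_paths" "w j (deg G (p j)) = p j" for j
    using p[of j] u prepend_closed[of "p j" u] shift_prepend[of "p j" u] by (auto simp: w_def)
  have w_pre: "w j (deg G (p i)) = pre (w j (deg G (p (i + d)))) (deg G (p i))" for i j d
    using inf_pathsD(3)[OF w(1)[of j], of "deg G (p i)" "deg G (p (i + d)) - deg G (p i)"]
    by (simp add: nat_vec_add_diff[OF le])
  have w_iff: "w j (deg G (p i)) = p i \<longleftrightarrow> i = j" for i j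
  proof (rule iffI, rule ccontr)
    assume *: "w j (deg G (p i)) = p i" "i \<noteq> j"
    then consider d where "j = i + Suc d" | d where "i = j + Suc d"
      by (metis less_imp_Suc_add nat_neq_iff add_Suc_right)
    then show False
    proof cases
      case 1
      then show False using w_pre[of j i "Suc d"] w(2)[of j] pre_p[of i d] *(1) ne[of i] by simp
    next
      case 2
      then show False using w_pre[of j j "Suc d"] w(2)[of j] pre_p[of j d] *(1) ne[of j] by simp
    qed
  qed (use w(2) in blast)
  interpret V: vectorspace class_ring "KP TYPE('f) G" by (rule KP_vectorspace)
  let ?c = "kp_class G :: ('f, 'a kp_gen) alg_term \<Rightarrow> _"
  let ?S = "{?c (Times (kp_s G x) (kp_s_star G y)) | x y.
     x \<in> paths G \<and> y \<in> paths G \<and> int_deg G x - int_deg G y = 0}"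
  define e :: "nat \<Rightarrow> ('f, 'a kp_gen) alg_term" where "e j = Times (kp_s G (p j)) (kp_s_star G (p j))" for j
  have e: "gens (e j) \<subseteq> kp_gens G" for j
    using gens_kp_s(1)[OF p(1), of j] gens_kp_s(2)[OF p(1), of j] by (simp add: e_def)
  \<comment> \<open>The operator is applied to the constant function 1, evaluated at
    \<open>w i\<close>, and its coefficient at degree 0 is taken. \<open>SOME\<close> selects a term
    of the class; all of them have the same operator.\<close>
  define \<phi> where "\<phi> i A = Poly_Mapping.lookup (kp_eval (SOME t :: ('f, 'a kp_gen) alg_term. t \<in> A) (\<lambda>_. 1) (w i)) 0" for i A
  have \<phi>: "\<phi> i (?c t) = Poly_Mapping.lookup (kp_eval t (\<lambda>_. 1) (w i)) 0" if "gens t \<subseteq> kp_gens G" for i t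
  proof -
    have "t \<in> ?c t" using that by (simp add: kp_class_alg_class mem_alg_class alg_eq.refl)
    then have "(SOME t'. t' \<in> ?c t) \<in> ?c t" by (rule someI)
    then have "kp_eval (SOME t'. t' \<in> ?c t) = kp_eval t"
      using that kp_eval_cong unfolding kp_class_alg_class by (metis mem_alg_class)
    then show ?thesis by (simp add: \<phi>_def)
  qed
  have "\<not> vectorspace.fin_dim class_ring (KP TYPE('f) G\<lparr>carrier := V.span ?S\<rparr>)"
  proof (rule infinite_independent_family[where u = "\<lambda>j. ?c (e j)" and \<phi> = \<phi>])
    show "?S \<subseteq> carrier (KP TYPE('f) G)" by (rule KP_component_generators)
    show "?c (e j) \<in> V.span ?S" for j
    proof -
      have "?c (e j) \<in> ?S" using p(1)[of j] unfolding e_def by auto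
      then show ?thesis by (rule subsetD[OF V.in_own_span[OF KP_component_generators]])
    qed
    show "\<phi> i (a \<oplus>\<^bsub>KP TYPE('f) G\<^esub> b) = \<phi> i a + \<phi> i b"
      if "a \<in> carrier (KP TYPE('f) G)" "b \<in> carrier (KP TYPE('f) G)" for i a b
      using that unfolding KP_presented
      by (elim presented_carrierE)
        (simp add: presented_add \<phi>[unfolded kp_class_alg_class] lookup_add)
    show "\<phi> i (c \<odot>\<^bsub>KP TYPE('f) G\<^esub> a) = c * \<phi> i a" if "a \<in> carrier (KP TYPE('f) G)" for i c a
      using that unfolding KP_presented
      by (elim presented_carrierE)
        (simp add: presented_smult \<phi>[unfolded kp_class_alg_class] lookup_single_0_times)
    show "\<phi> i (?c (e j)) = (if i = j then 1 else 0)" for i j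
      unfolding \<phi>[OF e] unfolding e_def kp_eval_elem[OF p(1) p(1)] using w(1)[of i] w_iff[of i j]
      by (auto simp: lookup_single)
  qed (rule KP_vectorspace)
  then show False using assms unfolding locally_finite_def KP_component_def by blast
qed

end

section \<open>Subgroups of finite index in the lattice\<close>

text \<open>A triangular basis is built one coordinate at a time: the next basis vector has the least
  positive value in the new coordinate.\<close>

lemma lattice_subgroup_basis_aux:
  fixes H :: "(int ^ 'n::finite) set" and S :: "'n set"
  assumes diff: "\<And>a b. a \<in> H \<Longrightarrow> b \<in> H \<Longrightarrow> a - b \<in> H" and "0 \<in> H"
    and axis: "\<And>i. \<exists>N>0. axis i N \<in> H"
  shows "\<exists>\<phi> :: int ^ 'n \<Rightarrow> int ^ 'n. (\<forall>a b. \<phi> (a + b) = \<phi> a + \<phi> b) \<and>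
    (\<forall>n. (\<forall>j. j \<notin> S \<longrightarrow> vec_nth n j = 0) \<longrightarrow> \<phi> n = 0 \<longrightarrow> n = 0) \<and>
    \<phi> ` {n. \<forall>j. j \<notin> S \<longrightarrow> vec_nth n j = 0} = H \<inter> {n. \<forall>j. j \<notin> S \<longrightarrow> vec_nth n j = 0}"
proof -
  have "finite S" by simp
  then show ?thesis
  proof (induction S)
    case empty
    have "{n :: int ^ 'n. \<forall>j. vec_nth n j = 0} = {0}"
      by (auto simp: cart_eq_iff)
    then show ?case using \<open>0 \<in> H\<close>
      by (intro exI[of _ "\<lambda>_. 0"]) (auto simp: cart_eq_iff)
  next
    case (insert i S)
    define Z where "Z T = {n :: int ^ 'n. \<forall>j. j \<notin> T \<longrightarrow> vec_nth n j = 0}" for T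
    from insert(3) obtain \<phi> :: "int ^ 'n \<Rightarrow> int ^ 'n" where \<phi>: "\<And>a b. \<phi> (a + b) = \<phi> a + \<phi> b"
      "\<And>n. n \<in> Z S \<Longrightarrow> \<phi> n = 0 \<Longrightarrow> n = 0" "\<phi> ` Z S = H \<inter> Z S"
      unfolding Z_def by blast
    \<comment> \<open>The positive values of coordinate i on the elements of H supported in
      \<open>insert i S\<close>; the hypothesis on the axes provides one.\<close>
    define P where "P a \<longleftrightarrow> 0 < a \<and> (\<exists>h\<in>H \<inter> Z (insert i S). vec_nth h i = int a)" for a
    obtain N :: int where "N > 0" "axis i N \<in> H" using axis by blast
    moreover have "axis i N \<in> Z (insert i S)" by (auto simp: Z_def axis_def)
    ultimately have "P (nat N)" unfolding P_def by (intro conjI bexI[of _ "axis i N"]) (auto simp: axis_def)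
    define a where "a = (LEAST a. P a)"
    have Pa: "P a" unfolding a_def by (rule LeastI) fact
    then obtain b where b: "b \<in> H" "b \<in> Z (insert i S)" "vec_nth b i = int a" "0 < a"
      by (auto simp: P_def)
    define mul where "mul q = (\<chi> j. q * vec_nth b j)" for q
    have mul_Z: "mul q \<in> Z (insert i S)" for q using b(2) by (auto simp: Z_def mul_def)
    have mul_nat: "mul (int q) \<in> H" for q
    proof (induction q)
      case 0
      have "mul (int 0) = 0" by (simp add: mul_def cart_eq_iff)
      then show ?case using \<open>0 \<in> H\<close> by simp
    next
      case (Suc q)
      have "mul (int (Suc q)) = mul (int q) - (0 - b)"
        by (simp add: mul_def cart_eq_iff algebra_simps)
      then show ?case using diff[OF Suc diff[OF \<open>0 \<in> H\<close> b(1)]] by simp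
    qed
    have mul_H: "mul q \<in> H" for q
    proof (cases "q \<ge> 0")
      case True
      then show ?thesis using mul_nat[of "nat q"] by simp
    next
      case False
      have "mul q = 0 - mul (- q)" by (simp add: mul_def cart_eq_iff)
      then show ?thesis using diff[OF \<open>0 \<in> H\<close> mul_nat[of "nat (- q)"]] False by simp
    qed
    define drop where "drop n = (\<chi> j. if j = i then 0 else vec_nth n j)" for n :: "int ^ 'n"
    \<comment> \<open>The new vector b takes over coordinate i, while the remaining coordinates are
      treated by the map for S.\<close>
    define \<psi> where "\<psi> n = \<phi> (drop n) + mul (vec_nth n i)" for n
    have drop_add: "drop (n + m) = drop n + drop m" for n m
      by (auto simp: drop_def cart_eq_iff)
    have mul_add: "mul (p + q) = mul p + mul q" for p q
      by (auto simp: mul_def cart_eq_iff algebra_simps)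
    have drop_Z: "drop n \<in> Z S" if "n \<in> Z (insert i S)" for n
      using that by (auto simp: Z_def drop_def)
    have \<phi>Z: "vec_nth (\<phi> m) i = 0 \<and> \<phi> m \<in> H \<and> \<phi> m \<in> Z (insert i S)" if "m \<in> Z S" for m
    proof -
      have "\<phi> m \<in> H \<inter> Z S" using \<phi>(3) that by blast
      then show ?thesis using insert(2) by (auto simp: Z_def)
    qed
    have add_H: "p + q \<in> H" if "p \<in> H" "q \<in> H" for p q
      using diff[OF that(1) diff[OF \<open>0 \<in> H\<close> that(2)]] by simp
    have add_Z: "p + q \<in> Z T" if "p \<in> Z T" "q \<in> Z T" for p q T
      using that by (auto simp: Z_def)
    have 1: "\<psi> (n + m) = \<psi> n + \<psi> m" for n m
      by (simp add: \<psi>_def drop_add \<phi>(1) mul_add algebra_simps)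
    have 2: "n = 0" if n: "n \<in> Z (insert i S)" "\<psi> n = 0" for n
    proof -
      have "vec_nth (\<psi> n) i = vec_nth n i * int a"
        using \<phi>Z[OF drop_Z[OF n(1)]] b(3) by (simp add: \<psi>_def mul_def)
      then have ni: "vec_nth n i = 0" using n(2) b(4) by simp
      have "mul 0 = 0" by (simp add: mul_def cart_eq_iff)
      then have "\<phi> (drop n) = 0" using n(2) ni by (simp add: \<psi>_def)
      then have "drop n = 0" using \<phi>(2) drop_Z[OF n(1)] by blast
      then have dj: "vec_nth (drop n) j = 0" for j by simp
      have "vec_nth n j = 0" for j
        using ni dj[of j] by (cases "j = i") (simp_all add: drop_def)
      then show ?thesis by (simp add: cart_eq_iff)
    qed
    have 3: "\<psi> ` Z (insert i S) = H \<inter> Z (insert i S)"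
    proof (intro equalityI subsetI)
      fix h assume "h \<in> \<psi> ` Z (insert i S)"
      then show "h \<in> H \<inter> Z (insert i S)"
        using \<phi>Z drop_Z mul_H mul_Z add_H add_Z unfolding \<psi>_def by blast
    next
      fix h assume h: "h \<in> H \<inter> Z (insert i S)"
      \<comment> \<open>Division with remainder: subtracting q times b leaves a value between 0 and
        a - 1 in coordinate i, and minimality of a forces it to be 0.\<close>
      define q where "q = vec_nth h i div int a"
      let ?r = "h - mul q"
      have r: "?r \<in> H" "?r \<in> Z (insert i S)"
        using h diff[OF _ mul_H[of q]] mul_Z[of q] by (auto simp: Z_def)
      have ri: "vec_nth ?r i = vec_nth h i mod int a"
        by (simp only: vector_minus_component mul_def vec_lambda_beta b(3) q_def minus_div_mult_eq_mod)
      have "vec_nth ?r i = 0"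
      proof (rule ccontr)
        assume "vec_nth ?r i \<noteq> 0"
        then have "0 < vec_nth ?r i" "vec_nth ?r i < int a"
          using b(4) pos_mod_sign[of "int a" "vec_nth h i"] pos_mod_bound[of "int a" "vec_nth h i"]
          unfolding ri by linarith+
        then have "P (nat (vec_nth ?r i))" "nat (vec_nth ?r i) < a"
          unfolding P_def using r by (auto intro!: bexI[of _ ?r])
        then show False using not_less_Least unfolding a_def by blast
      qed
      then have "?r \<in> H \<inter> Z S" using r by (auto simp: Z_def)
      then obtain n where n: "n \<in> Z S" "\<phi> n = ?r" using \<phi>(3) by (metis imageE)
      have ni: "vec_nth n i = 0" using n(1) insert(2) by (auto simp: Z_def)
      have "drop (n + axis i q) = n" "vec_nth (n + axis i q) i = q"
        using ni by (auto simp: drop_def cart_eq_iff axis_def)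
      then have "\<psi> (n + axis i q) = h" using n(2) by (simp add: \<psi>_def)
      moreover have "n + axis i q \<in> Z (insert i S)"
        using n(1) by (auto simp: Z_def axis_def)
      ultimately show "h \<in> \<psi> ` Z (insert i S)" by blast
    qed
    show ?case using 1 2 3 unfolding Z_def by blast
  qed
qed

text \<open>A positive multiple of each unit vector in H expresses that H has finite index.
  Injectivity comes from the trivial kernel.\<close>

lemma lattice_subgroup_iso:
  fixes H :: "(int ^ 'n::finite) set"
  assumes "\<And>a b. a \<in> H \<Longrightarrow> b \<in> H \<Longrightarrow> a - b \<in> H" "0 \<in> H" "\<And>i. \<exists>N>0. axis i N \<in> H"
  shows "\<exists>\<phi> :: int ^ 'n \<Rightarrow> int ^ 'n. (\<forall>a b. \<phi> (a + b) = \<phi> a + \<phi> b) \<and> inj \<phi> \<and> range \<phi> = H"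
proof -
  obtain \<phi> :: "int ^ 'n \<Rightarrow> int ^ 'n" where \<phi>: "\<And>a b. \<phi> (a + b) = \<phi> a + \<phi> b" "\<And>n. \<phi> n = 0 \<Longrightarrow> n = 0" "range \<phi> = H"
    using lattice_subgroup_basis_aux[of H UNIV] assms by auto
  have "inj \<phi>"
  proof (rule injI)
    fix a b assume "\<phi> a = \<phi> b"
    then have "\<phi> (a - b) + \<phi> b = \<phi> b" using \<phi>(1)[of "a - b" b] by simp
    then show "a = b" using \<phi>(2)[of "a - b"] by simp
  qed
  then show ?thesis using \<phi> by blast
qed

section \<open>Pushing forward elements of a group algebra\<close>

text \<open>The map of group algebras induced by a map of groups; supports are finite, so it makes
  sense even where \<phi> identifies elements.\<close>

definition pm_push :: "('a \<Rightarrow> 'b) \<Rightarrow> ('a \<Rightarrow>\<^sub>0 'c::comm_monoid_add) \<Rightarrow> ('b \<Rightarrow>\<^sub>0 'c)" where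
  "pm_push \<phi> p = (\<Sum>n\<in>Poly_Mapping.keys p. Poly_Mapping.single (\<phi> n) (Poly_Mapping.lookup p n))"

lemma pm_push_superset:
  assumes "finite A" "Poly_Mapping.keys p \<subseteq> A"
  shows "pm_push \<phi> p = (\<Sum>n\<in>A. Poly_Mapping.single (\<phi> n) (Poly_Mapping.lookup p n))"
  unfolding pm_push_def using assms by (intro sum.mono_neutral_left) (auto simp: in_keys_iff)

lemma pm_push_0 [simp]: "pm_push \<phi> 0 = 0"
  by (simp add: pm_push_def)

lemma pm_push_add: "pm_push \<phi> (p + q) = pm_push \<phi> p + pm_push \<phi> q"
proof -
  let ?A = "Poly_Mapping.keys p \<union> Poly_Mapping.keys q"
  have "pm_push \<phi> (p + q) = (\<Sum>n\<in>?A. Poly_Mapping.single (\<phi> n) (Poly_Mapping.lookup (p + q) n))"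
    by (rule pm_push_superset) (auto simp: keys_add)
  also have "\<dots> = (\<Sum>n\<in>?A. Poly_Mapping.single (\<phi> n) (Poly_Mapping.lookup p n)) +
      (\<Sum>n\<in>?A. Poly_Mapping.single (\<phi> n) (Poly_Mapping.lookup q n))"
    by (simp add: lookup_add single_add sum.distrib)
  also have "\<dots> = pm_push \<phi> p + pm_push \<phi> q"
    by (subst (1 2) pm_push_superset[where A = ?A]) auto
  finally show ?thesis .
qed

lemma pm_push_sum: "pm_push \<phi> (sum f S) = (\<Sum>x\<in>S. pm_push \<phi> (f x))"
  by (induction S rule: infinite_finite_induct) (auto simp: pm_push_add)

lemma pm_push_single [simp]: "pm_push \<phi> (Poly_Mapping.single n c) = Poly_Mapping.single (\<phi> n) c"
  by (cases "c = 0") (simp_all add: pm_push_def)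

lemma sum_singles: "(\<Sum>n\<in>Poly_Mapping.keys p. Poly_Mapping.single n (Poly_Mapping.lookup p n)) = p"
  by (rule poly_mapping_eqI) (auto simp: lookup_sum lookup_single when_def in_keys_iff)

lemma pm_push_mult:
  fixes p q :: "'a::comm_monoid_add \<Rightarrow>\<^sub>0 'c::comm_semiring_0"
  assumes "\<And>a b. \<phi> (a + b) = \<phi> a + \<phi> b"
  shows "pm_push \<phi> (p * q) = pm_push \<phi> p * pm_push \<phi> q"
proof -
  let ?s = "\<lambda>p n. Poly_Mapping.single n (Poly_Mapping.lookup p n)"
  have "p * q = (\<Sum>n\<in>Poly_Mapping.keys p. ?s p n) * (\<Sum>m\<in>Poly_Mapping.keys q. ?s q m)"
    by (simp only: sum_singles)
  also have "\<dots> = (\<Sum>n\<in>Poly_Mapping.keys p. \<Sum>m\<in>Poly_Mapping.keys q.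
      Poly_Mapping.single (n + m) (Poly_Mapping.lookup p n * Poly_Mapping.lookup q m))"
    by (simp add: sum_product mult_single)
  finally have "pm_push \<phi> (p * q) = (\<Sum>n\<in>Poly_Mapping.keys p. \<Sum>m\<in>Poly_Mapping.keys q.
      Poly_Mapping.single (\<phi> n + \<phi> m) (Poly_Mapping.lookup p n * Poly_Mapping.lookup q m))"
    by (simp add: pm_push_sum assms)
  also have "\<dots> = pm_push \<phi> p * pm_push \<phi> q"
    by (simp add: pm_push_def sum_product mult_single)
  finally show ?thesis .
qed

lemma lookup_pm_push:
  assumes "inj \<phi>"
  shows "Poly_Mapping.lookup (pm_push \<phi> p) (\<phi> n) = Poly_Mapping.lookup p n"
  unfolding pm_push_def lookup_sum using assms
  by (auto simp: lookup_single when_def inj_eq in_keys_iff)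

lemma pm_push_inj: "inj \<phi> \<Longrightarrow> pm_push \<phi> p = pm_push \<phi> q \<Longrightarrow> p = q"
  by (rule poly_mapping_eqI) (metis lookup_pm_push)

lemma keys_pm_push: "Poly_Mapping.keys (pm_push \<phi> p) \<subseteq> range \<phi>"
proof
  fix m assume "m \<in> Poly_Mapping.keys (pm_push \<phi> p)"
  then have "(\<Sum>n\<in>Poly_Mapping.keys p. Poly_Mapping.lookup (Poly_Mapping.single (\<phi> n) (Poly_Mapping.lookup p n)) m) \<noteq> 0"
    by (simp add: in_keys_iff pm_push_def lookup_sum)
  then obtain n where "Poly_Mapping.lookup (Poly_Mapping.single (\<phi> n) (Poly_Mapping.lookup p n)) m \<noteq> 0"
    by (meson sum.neutral)
  then show "m \<in> range \<phi>" by (auto simp: lookup_single when_def split: if_splits)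
qed

text \<open>Serves to rewrite entries supported in an isotropy group as elements of the full group
  algebra. Outside the range neither side has support; inside, \<open>map_key\<close> reads the
  coefficient at the image.\<close>

lemma pm_push_map_key:
  assumes "inj \<phi>" "Poly_Mapping.keys p \<subseteq> range \<phi>"
  shows "pm_push \<phi> (Poly_Mapping.map_key \<phi> p) = p"
proof (rule poly_mapping_eqI)
  fix m
  show "Poly_Mapping.lookup (pm_push \<phi> (Poly_Mapping.map_key \<phi> p)) m = Poly_Mapping.lookup p m"
  proof (cases "m \<in> range \<phi>")
    case True
    then obtain x where "m = \<phi> x" by blast
    then show ?thesis by (simp only: lookup_pm_push[OF assms(1)] map_key.rep_eq[OF assms(1)] o_apply)
  next
    case False
    then have "m \<notin> Poly_Mapping.keys (pm_push \<phi> (Poly_Mapping.map_key \<phi> p))"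
      by (rule contra_subsetD[OF keys_pm_push])
    moreover have "m \<notin> Poly_Mapping.keys p" by (rule contra_subsetD[OF assms(2) False])
    ultimately show ?thesis by (simp only: in_keys_iff not_not)
  qed
qed

lemma keys_monom_times:
  fixes p :: "'g::ab_group_add \<Rightarrow>\<^sub>0 'f::comm_ring_1"
  shows "m \<in> Poly_Mapping.keys (group_monom n * p) \<Longrightarrow> m - n \<in> Poly_Mapping.keys p"
  using keys_mult[of "group_monom n" p] by (auto split: if_splits)

section \<open>Tail equivalence of infinite paths\<close>

context row_finite_k_graph
begin

text \<open>The arrows of the path groupoid; here the common tail may start at any vertex. Units,
  inverses and composition are the next three lemmas.\<close>

definition tail_lag :: "(nat ^ 'k \<Rightarrow> 'a) \<Rightarrow> int ^ 'k \<Rightarrow> (nat ^ 'k \<Rightarrow> 'a) \<Rightarrow> bool" where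
  "tail_lag x n y \<longleftrightarrow> x \<in> inf_paths \<and> y \<in> inf_paths \<and>
     (\<exists>p q. shift p x = shift q y \<and> int_vec p - int_vec q = n)"

lemma tail_lag_refl: "x \<in> inf_paths \<Longrightarrow> tail_lag x 0 x"
  unfolding tail_lag_def by (auto intro!: exI[of _ 0])

lemma tail_lag_sym:
  assumes "tail_lag x n y"
  shows "tail_lag y (- n) x"
proof -
  obtain p q where pq: "x \<in> inf_paths" "y \<in> inf_paths" "shift p x = shift q y" "int_vec p - int_vec q = n"
    using assms by (auto simp: tail_lag_def)
  then have "shift q y = shift p x" "int_vec q - int_vec p = - n" by auto
  then show ?thesis using pq(1,2) unfolding tail_lag_def by blast
qed

lemma tail_lag_trans:
  assumes "tail_lag x n y" "tail_lag y m z"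
  shows "tail_lag x (n + m) z"
proof -
  obtain p q where pq: "x \<in> inf_paths" "y \<in> inf_paths" "shift p x = shift q y" "int_vec p - int_vec q = n"
    using assms(1) by (auto simp: tail_lag_def)
  obtain p' q' where pq': "z \<in> inf_paths" "shift p' y = shift q' z" "int_vec p' - int_vec q' = m"
    using assms(2) by (auto simp: tail_lag_def)
  have "shift (p + p') x = shift (q + p') y"
    using shift_shift[OF pq(1), of p' p] shift_shift[OF pq(2), of p' q] pq(3) by simp
  also have "\<dots> = shift (q' + q) z"
    using shift_shift[OF pq(2), of q p'] shift_shift[OF pq'(1), of q q'] pq'(2) by (simp add: add.commute)
  finally have "shift (p + p') x = shift (q' + q) z" .
  moreover have "int_vec (p + p') - int_vec (q' + q) = n + m"
    unfolding int_vec_add pq(4)[symmetric] pq'(3)[symmetric] by (simp add: algebra_simps)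
  ultimately show ?thesis using pq(1) pq'(1) unfolding tail_lag_def by blast
qed

lemma tail_lag_axis:
  assumes "finite inf_paths" "x \<in> inf_paths"
  shows "\<exists>N>0. tail_lag x (axis i N) x"
proof -
  define f where "f j = shift (axis i j) x" for j
  have "range f \<subseteq> inf_paths" using shift_closed[OF assms(2)] by (auto simp: f_def)
  then have "\<not> inj f" using assms(1) finite_imageD[of f UNIV] finite_subset by fastforce
  then obtain j l where jl: "j < l" "f l = f j" unfolding inj_def by (metis nat_neq_iff)
  have "int_vec (axis i l) - int_vec (axis i j) = (axis i (int l - int j) :: int ^ 'k)"
    by (auto simp: cart_eq_iff axis_def)
  then have "tail_lag x (axis i (int l - int j)) x"
    using jl(2) assms(2) unfolding tail_lag_def f_def by blast
  then show ?thesis using jl(1) by (intro exI[of _ "int l - int j"]) simp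
qed

text \<open>Moving both cut points on by the pigeonhole degree makes the tail start at a rigid
  vertex and keeps the lag.\<close>

lemma tail_lag_rigid_pair:
  assumes "condition_HNE G" "finite (vertices G)" "tail_lag x n y"
  shows "\<exists>p q. rigid_pair x y p q \<and> int_vec p - int_vec q = n"
proof -
  obtain p q where pq: "x \<in> inf_paths" "y \<in> inf_paths" "shift p x = shift q y" "int_vec p - int_vec q = n"
    using assms(3) by (auto simp: tail_lag_def)
  let ?N = "diag (card (vertices G)) :: nat ^ 'k"
  have "rigid (src G (x (p + ?N)))"
    using inf_pathsD[OF pq(1), of "p + ?N"] by (intro HNE_long_path_rigid[OF assms(1,2)]) auto
  moreover have "shift (p + ?N) x = shift (q + ?N) y"
    using shift_shift[OF pq(1), of ?N p] shift_shift[OF pq(2), of ?N q] pq(3) by simp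
  moreover have "int_vec (p + ?N) - int_vec (q + ?N) = n" using pq(4) by (simp add: int_vec_add)
  ultimately show ?thesis using pq(1,2) unfolding rigid_pair_def by blast
qed

text \<open>Coordinates on the groupoid. The t tail classes are numbered from 1, the
  \<open>m i\<close> members of class i from 0. With \<open>e i 0\<close> as base point,
  \<open>l i a\<close> is a lag from \<open>e i a\<close> to it, and \<open>\<phi> i\<close> maps
  the lattice isomorphically onto its isotropy group. Then \<open>n - l i a + l i b\<close> is the
  lag of the closed walk from the base point to \<open>e i a\<close>, on to \<open>e i b\<close> and
  back.\<close>

lemma tail_lag_coordinates:
  assumes "finite inf_paths" "inf_paths \<noteq> {}"
  shows "\<exists>(t :: nat) (m :: nat \<Rightarrow> nat) (e :: nat \<Rightarrow> nat \<Rightarrow> nat ^ 'k \<Rightarrow> 'a)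
      (\<phi> :: nat \<Rightarrow> int ^ 'k \<Rightarrow> int ^ 'k) (l :: nat \<Rightarrow> nat \<Rightarrow> int ^ 'k).
    0 < t \<and> (\<forall>i\<in>{1..t}. 0 < m i) \<and>
    bij_betw (\<lambda>(i, a). e i a) (Sigma {1..t} (\<lambda>i. {0..<m i})) inf_paths \<and>
    (\<forall>i\<in>{1..t}. \<forall>a b. \<phi> i (a + b) = \<phi> i a + \<phi> i b) \<and> (\<forall>i\<in>{1..t}. inj (\<phi> i)) \<and>
    (\<forall>i\<in>{1..t}. \<forall>j\<in>{1..t}. \<forall>a<m i. \<forall>b<m j. \<forall>n.
       tail_lag (e i a) n (e j b) \<longleftrightarrow> i = j \<and> n - l i a + l i b \<in> range (\<phi> i))"
proof -
  define r where "r = {(x, y). \<exists>n. tail_lag x n y}"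
  have eq: "equiv inf_paths r"
  proof (rule equivI)
    show "r \<subseteq> inf_paths \<times> inf_paths" by (auto simp: r_def tail_lag_def)
    show "refl_on inf_paths r" using tail_lag_refl by (auto simp: r_def refl_on_def)
    show "sym r" using tail_lag_sym unfolding sym_def r_def by blast
    show "Relation.trans r" using tail_lag_trans unfolding trans_def r_def by blast
  qed
  let ?Q = "inf_paths // r"
  define t where "t = card ?Q"
  have finQ: "finite ?Q" using finite_quotient[OF assms(1)] eq by (auto simp: equiv_def)
  have "?Q \<noteq> {}" using assms(2) by (auto simp: quotient_def)
  then have t: "0 < t" using finQ by (auto simp: t_def card_gt_0_iff)
  obtain C where C: "bij_betw C {1..t} ?Q"
    using ex_bij_betw_nat_finite_1[OF finQ] by (auto simp: t_def)
  have CQ: "C i \<in> ?Q" if "i \<in> {1..t}" for i using C that by (auto simp: bij_betw_def)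
  have Csub: "C i \<subseteq> inf_paths" "C i \<noteq> {}" "finite (C i)" if "i \<in> {1..t}" for i
    using in_quotient_imp_subset[OF eq CQ[OF that]] in_quotient_imp_non_empty[OF eq CQ[OF that]]
      assms(1) finite_subset by auto
  define m where "m i = card (C i)" for i
  have m: "0 < m i" if "i \<in> {1..t}" for i using Csub[OF that] by (simp add: m_def card_gt_0_iff)
  have "\<forall>i\<in>{1..t}. \<exists>e. bij_betw e {0..<m i} (C i)"
    using ex_bij_betw_nat_finite[OF Csub(3)] by (auto simp: m_def)
  then obtain e where e: "\<And>i. i \<in> {1..t} \<Longrightarrow> bij_betw (e i) {0..<m i} (C i)" by metis
  have eC: "e i a \<in> C i" if "i \<in> {1..t}" "a < m i" for i a
    using e[OF that(1)] that(2) by (auto simp: bij_betw_def)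
  have bij: "bij_betw (\<lambda>(i, a). e i a) (Sigma {1..t} (\<lambda>i. {0..<m i})) inf_paths"
  proof (rule bij_betw_imageI)
    have ij_ab: "i = j \<and> a = b" if "i \<in> {1..t}" "j \<in> {1..t}" "a < m i" "b < m j" "e i a = e j b" for i j a b
    proof -
      have "C i \<inter> C j \<noteq> {}" using eC[OF that(1,3)] eC[OF that(2,4)] that(5) by auto
      then have "C i = C j" using quotient_disj[OF eq CQ[OF that(1)] CQ[OF that(2)]] by blast
      then have ij: "i = j" by (rule inj_onD[OF bij_betw_imp_inj_on[OF C] _ that(1,2)])
      then have "e i a = e i b" using that(5) by simp
      then have "a = b"
        by (rule inj_onD[OF bij_betw_imp_inj_on[OF e[OF that(1)]]]) (simp_all add: that(3) that(4)[folded ij])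
      then show ?thesis using ij by blast
    qed
    show "inj_on (\<lambda>(i, a). e i a) (Sigma {1..t} (\<lambda>i. {0..<m i}))"
    proof (rule inj_onI)
      fix u v assume uv: "u \<in> Sigma {1..t} (\<lambda>i. {0..<m i})" "v \<in> Sigma {1..t} (\<lambda>i. {0..<m i})"
        "(case u of (i, a) \<Rightarrow> e i a) = (case v of (i, a) \<Rightarrow> e i a)"
      obtain i a j b where ij: "u = (i, a)" "v = (j, b)" by (meson surj_pair)
      show "u = v" using ij_ab[of i j a b] uv unfolding ij by simp
    qed
    have surj: "x \<in> (\<lambda>(i, a). e i a) ` (Sigma {1..t} (\<lambda>i. {0..<m i}))" if x: "x \<in> inf_paths" for x
    proof -
      have "r `` {x} \<in> ?Q" "x \<in> r `` {x}" using x quotientI equiv_class_self[OF eq] by auto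
      then obtain i where i: "i \<in> {1..t}" "x \<in> C i" using bij_betw_imp_surj_on[OF C] by (metis imageE)
      then obtain a where a: "a \<in> {0..<m i}" "x = e i a" using bij_betw_imp_surj_on[OF e[OF i(1)]] by (metis imageE)
      have "(i, a) \<in> Sigma {1..t} (\<lambda>i. {0..<m i})" using i(1) a(1) by blast
      then show ?thesis using a(2) by (metis (no_types, lifting) case_prod_conv image_eqI)
    qed
    then show "(\<lambda>(i, a). e i a) ` (Sigma {1..t} (\<lambda>i. {0..<m i})) = inf_paths"
    proof (intro equalityI subsetI)
      fix x assume "x \<in> (\<lambda>(i, a). e i a) ` (Sigma {1..t} (\<lambda>i. {0..<m i}))"
      then obtain i a where ia: "i \<in> {1..t}" "a < m i" "x = e i a" by auto
      show "x \<in> inf_paths" unfolding ia(3) by (rule subsetD[OF Csub(1)[OF ia(1)] eC[OF ia(1,2)]])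
    qed (rule surj)
  qed
  have rel: "(\<exists>n. tail_lag (e i a) n (e j b)) \<longleftrightarrow> i = j"
    if "i \<in> {1..t}" "j \<in> {1..t}" "a < m i" "b < m j" for i j a b
  proof -
    have "(\<exists>n. tail_lag (e i a) n (e j b)) \<longleftrightarrow> (e i a, e j b) \<in> r" by (simp add: r_def)
    also have "\<dots> \<longleftrightarrow> C i = C j"
      using quotient_eq_iff[OF eq CQ[OF that(1)] CQ[OF that(2)] eC[OF that(1,3)] eC[OF that(2,4)]] by simp
    also have "\<dots> \<longleftrightarrow> i = j" using inj_on_eq_iff[OF bij_betw_imp_inj_on[OF C] that(1,2)] .
    finally show ?thesis .
  qed
  have "\<forall>i\<in>{1..t}. \<forall>a\<in>{0..<m i}. \<exists>n. tail_lag (e i a) n (e i 0)" using rel m by auto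
  then obtain l where l: "\<And>i a. i \<in> {1..t} \<Longrightarrow> a < m i \<Longrightarrow> tail_lag (e i a) (l i a) (e i 0)"
    by (metis atLeast0LessThan lessThan_iff)
  have "\<exists>\<phi> :: int ^ 'k \<Rightarrow> int ^ 'k. (\<forall>a b. \<phi> (a + b) = \<phi> a + \<phi> b) \<and> inj \<phi> \<and> range \<phi> = {n. tail_lag (e i 0) n (e i 0)}"
    if i: "i \<in> {1..t}" for i
  proof (rule lattice_subgroup_iso)
    have x: "e i 0 \<in> inf_paths" using eC[OF i m[OF i]] Csub(1)[OF i] by blast
    show "0 \<in> {n. tail_lag (e i 0) n (e i 0)}" using tail_lag_refl[OF x] by simp
    show "\<exists>N>0. axis j N \<in> {n. tail_lag (e i 0) n (e i 0)}" for j
      using tail_lag_axis[OF assms(1) x] by simp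
    fix a b assume "a \<in> {n. tail_lag (e i 0) n (e i 0)}" "b \<in> {n. tail_lag (e i 0) n (e i 0)}"
    then have "tail_lag (e i 0) a (e i 0)" "tail_lag (e i 0) b (e i 0)" by simp_all
    from tail_lag_trans[OF this(1) tail_lag_sym[OF this(2)]]
    show "a - b \<in> {n. tail_lag (e i 0) n (e i 0)}" by simp
  qed
  then obtain \<phi> :: "nat \<Rightarrow> int ^ 'k \<Rightarrow> int ^ 'k" where \<phi>: "\<And>i a b. i \<in> {1..t} \<Longrightarrow> \<phi> i (a + b) = \<phi> i a + \<phi> i b"
    "\<And>i. i \<in> {1..t} \<Longrightarrow> inj (\<phi> i)"
    "\<And>i. i \<in> {1..t} \<Longrightarrow> range (\<phi> i) = {n. tail_lag (e i 0) n (e i 0)}" by metis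
  have lag: "tail_lag (e i a) n (e j b) \<longleftrightarrow> i = j \<and> n - l i a + l i b \<in> range (\<phi> i)"
    if ij: "i \<in> {1..t}" "j \<in> {1..t}" "a < m i" "b < m j" for i j a b n
  proof (cases "i = j")
    case True
    note la = l[OF ij(1,3)] and lb = l[OF ij(1) ij(4)[folded True]]
    have "tail_lag (e i a) n (e i b) \<longleftrightarrow> tail_lag (e i 0) (n - l i a + l i b) (e i 0)"
    proof
      assume "tail_lag (e i a) n (e i b)"
      from tail_lag_trans[OF tail_lag_trans[OF tail_lag_sym[OF la] this] lb]
      show "tail_lag (e i 0) (n - l i a + l i b) (e i 0)" by (simp add: algebra_simps)
    next
      assume "tail_lag (e i 0) (n - l i a + l i b) (e i 0)"
      from tail_lag_trans[OF tail_lag_trans[OF la this] tail_lag_sym[OF lb]]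
      show "tail_lag (e i a) n (e i b)" by (simp add: algebra_simps)
    qed
    then show ?thesis using True \<phi>(3)[OF ij(1)] by simp
  next
    case False
    then show ?thesis using rel[OF ij] by blast
  qed
  show ?thesis
    by (rule exI[of _ t], rule exI[of _ m], rule exI[of _ e], rule exI[of _ \<phi>], rule exI[of _ l],
        intro conjI ballI allI impI t bij m \<phi>(1,2) lag)
qed

end

section \<open>Matrices over the group algebra\<close>

lemma mult_interchange: "k = g * h \<Longrightarrow> (g * x) * (h * y) = k * (x * y)"
  for g h k x y :: "'b::comm_monoid_mult"
  by (simp add: ac_simps)

context row_finite_k_graph
begin

lemma kp_eval_outside: "x \<notin> inf_paths \<Longrightarrow> kp_eval t f x = 0"
proof (induction t arbitrary: f x)
  case (Gen g)
  then show ?case by (cases g) auto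
qed auto

section \<open>The matrix of a term and its normal form\<close>

text \<open>Column y is the image of the indicator function of y.\<close>

definition kp_mat :: "('f::field, 'a kp_gen) alg_term \<Rightarrow> (nat ^ 'k \<Rightarrow> 'a) \<Rightarrow> (nat ^ 'k \<Rightarrow> 'a) \<Rightarrow> ((int ^ 'k) \<Rightarrow>\<^sub>0 'f)" where
  "kp_mat t x y = kp_eval t (\<lambda>z. if z = y then 1 else 0) x"

lemma kp_mat_simps [simp]:
  "kp_mat Zero x y = 0" "kp_mat (Plus s t) x y = kp_mat s x y + kp_mat t x y"
  "kp_mat (Scale c t) x y = Poly_Mapping.single 0 c * kp_mat t x y"
  by (simp_all add: kp_mat_def)

lemma kp_mat_cong: "kp_eq s t \<Longrightarrow> kp_mat s = kp_mat t"
  by (simp add: kp_mat_def fun_eq_iff kp_eval_cong)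

text \<open>An image vanishes outside the finitely many infinite paths, so it is a finite
  combination of indicators, and operators are linear over the group algebra.\<close>

lemma kp_mat_times:
  assumes "finite inf_paths"
  shows "kp_mat (Times s t) x y = (\<Sum>z\<in>inf_paths. kp_mat s x z * kp_mat t z y)"
proof -
  define g where "g = kp_eval t (\<lambda>z. if z = y then 1 else 0)"
  have "g = (\<lambda>w. \<Sum>z\<in>inf_paths. g z * (if w = z then 1 else 0))"
  proof
    fix w
    show "g w = (\<Sum>z\<in>inf_paths. g z * (if w = z then 1 else 0))"
    proof (cases "w \<in> inf_paths")
      case True
      have "(\<Sum>z\<in>inf_paths. g z * (if w = z then 1 else 0)) = (\<Sum>z\<in>inf_paths. if w = z then g z else 0)"
        by (intro sum.cong) auto
      then show ?thesis using True assms by simp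
    next
      case False
      then have "(\<Sum>z\<in>inf_paths. g z * (if w = z then 1 else 0)) = 0" by (intro sum.neutral) auto
      moreover have "g w = 0" unfolding g_def by (rule kp_eval_outside[OF False])
      ultimately show ?thesis by simp
    qed
  qed
  then have "kp_eval s g x = kp_eval s (\<lambda>w. \<Sum>z\<in>inf_paths. g z * (if w = z then 1 else 0)) x" by simp
  also have "\<dots> = (\<Sum>z\<in>inf_paths. kp_eval s (\<lambda>w. g z * (if w = z then 1 else 0)) x)"
    by (rule fun_cong[OF alg_operators.alg_eval_sum[OF kp_operators]])
  also have "\<dots> = (\<Sum>z\<in>inf_paths. g z * kp_eval s (\<lambda>w. if w = z then 1 else 0) x)"
    by (intro sum.cong HOL.refl fun_cong[OF alg_operators.alg_eval_scale[OF kp_operators]])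
  finally show ?thesis by (simp add: kp_mat_def g_def mult.commute)
qed

lemma kp_mat_unit:
  assumes "distinct vs" "set vs = vertices G"
  shows "kp_mat (alg_sum (map kp_p vs)) x y = (if x \<in> inf_paths \<and> x = y then 1 else 0)"
proof -
  have "kp_mat (alg_sum (map kp_p vs)) x y =
      (\<Sum>v\<in>vertices G. if x \<in> inf_paths \<and> x 0 = v then if x = y then 1 else 0 else 0)"
    unfolding kp_mat_def alg_eval_alg_sum
    by (simp add: sum_list_distinct_conv_sum_set[OF assms(1)] assms(2))
  moreover have "finite (vertices G)" using assms(2) by (metis List.finite_set)
  ultimately show ?thesis using inf_path_rng(2)[of x] by (cases "x \<in> inf_paths") auto
qed

definition lag_index :: "((nat ^ 'k \<Rightarrow> 'a) \<times> (int ^ 'k) \<times> (nat ^ 'k \<Rightarrow> 'a)) set" where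
  "lag_index = {(x, n, y). tail_lag x n y}"

text \<open>One term is chosen for each arrow; its class does not depend on the choice. For other
  triples the value is unspecified.\<close>

definition kp_basis :: "(nat ^ 'k \<Rightarrow> 'a) \<times> (int ^ 'k) \<times> (nat ^ 'k \<Rightarrow> 'a) \<Rightarrow> ('f::field, 'a kp_gen) alg_term" where
  "kp_basis = (\<lambda>(x, n, y). SOME t. \<exists>p q. t = kp_elem x y p q \<and> rigid_pair x y p q \<and> int_vec p - int_vec q = n)"

context
  assumes HNE: "condition_HNE G" and fin: "finite (vertices G)"
begin

lemma kp_basis:
  assumes "tail_lag x n y"
  obtains p q where "(kp_basis (x, n, y) :: ('f::field, 'a kp_gen) alg_term) = kp_elem x y p q"
    "rigid_pair x y p q" "int_vec p - int_vec q = n"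
proof -
  have "\<exists>t :: ('f, 'a kp_gen) alg_term. \<exists>p q. t = kp_elem x y p q \<and> rigid_pair x y p q \<and> int_vec p - int_vec q = n"
    using tail_lag_rigid_pair[OF HNE fin assms] by blast
  from someI_ex[OF this] show ?thesis using that unfolding kp_basis_def by auto
qed

lemma gens_kp_basis: "g \<in> lag_index \<Longrightarrow> gens (kp_basis g :: ('f::field, 'a kp_gen) alg_term) \<subseteq> kp_gens G"
proof -
  assume "g \<in> lag_index"
  then obtain x n y where g: "g = (x, n, y)" "tail_lag x n y" by (auto simp: lag_index_def)
  obtain p q where "(kp_basis (x, n, y) :: ('f, 'a kp_gen) alg_term) = kp_elem x y p q" "rigid_pair x y p q"
    using kp_basis[OF g(2)] by metis
  then show ?thesis unfolding g(1) using gens_kp_elem by metis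
qed

lemma kp_mat_basis:
  assumes "tail_lag x n y"
  shows "kp_mat (kp_basis (x, n, y) :: ('f::field, 'a kp_gen) alg_term) z w = (if z = x \<and> w = y then group_monom n else 0)"
proof -
  obtain p q where pq: "(kp_basis (x, n, y) :: ('f, 'a kp_gen) alg_term) = kp_elem x y p q" "rigid_pair x y p q"
    "int_vec p - int_vec q = n"
    using kp_basis[OF assms] by metis
  show ?thesis unfolding kp_mat_def pq(1) kp_eval_kp_elem[OF pq(2)] pq(3) by auto
qed

lemma lookup_kp_mat_sum:
  fixes c :: "_ \<Rightarrow> 'f::field"
  assumes "distinct gs" "set gs \<subseteq> lag_index"
  shows "Poly_Mapping.lookup (kp_mat (alg_sum (map (\<lambda>g. Scale (c g) (kp_basis g)) gs)) z w) k =
    (if (z, k, w) \<in> set gs then c (z, k, w) else 0)"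
  using assms
proof (induction gs)
  case (Cons g gs)
  obtain x n y where g: "g = (x, n, y)" "tail_lag x n y" using Cons.prems by (auto simp: lag_index_def)
  have "Poly_Mapping.lookup (kp_mat (Scale (c g) (kp_basis g)) z w) k = (if g = (z, k, w) then c (z, k, w) else 0)"
    unfolding g(1) kp_mat_simps kp_mat_basis[OF g(2)] by (auto simp: lookup_single_0_times lookup_single when_def)
  then show ?case using Cons by (auto simp: lookup_add)
qed simp

text \<open>Spanning supplies the coefficients, and \<open>lookup_kp_mat_sum\<close> recovers them
  from the matrix: the one at the arrow (z, k, w) is the coefficient of degree k in the entry (z,
  w). Hence they are unique.\<close>

lemma kp_normal_form:
  fixes t :: "('f::field, 'a kp_gen) alg_term"
  assumes "gens t \<subseteq> kp_gens G"
  shows "\<exists>D c. finite D \<and> D \<subseteq> lag_index \<and> (\<forall>g. g \<notin> D \<longrightarrow> c g = 0) \<and>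
    (\<forall>gs. distinct gs \<and> D \<subseteq> set gs \<longrightarrow>
       kp_eq t (alg_sum (map (\<lambda>g. Scale (c g) (kp_basis g)) gs))) \<and>
    (\<forall>z k w. Poly_Mapping.lookup (kp_mat t z w) k = c (z, k, w))"
proof -
  have "\<exists>g\<in>lag_index. kp_eq s (kp_basis g)"
    if "s \<in> kp_basis_set" for s :: "('f, 'a kp_gen) alg_term"
  proof -
    obtain x y p q where s: "s = kp_elem x y p q" "rigid_pair x y p q"
      using \<open>s \<in> kp_basis_set\<close> unfolding kp_basis_set_def by blast
    define n where "n = int_vec p - int_vec q"
    have lag: "tail_lag x n y" using s(2) unfolding tail_lag_def rigid_pair_def n_def by blast
    obtain p' q' where pq: "(kp_basis (x, n, y) :: ('f, 'a kp_gen) alg_term) = kp_elem x y p' q'"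
      "rigid_pair x y p' q'" "int_vec p' - int_vec q' = n"
      using kp_basis[OF lag] by metis
    have "kp_eq s (kp_basis (x, n, y))"
      unfolding s(1) pq(1) by (rule kp_elem_eq[OF s(2) pq(2)]) (simp add: n_def pq(3))
    then show ?thesis using lag unfolding lag_index_def by blast
  qed
  from alg_span_normal_form[OF kp_span[OF HNE fin assms] this] obtain D c where
    D: "finite D" "D \<subseteq> lag_index" "\<And>g. g \<notin> D \<Longrightarrow> c g = 0"
    "\<And>gs. distinct gs \<Longrightarrow> D \<subseteq> set gs \<Longrightarrow>
       kp_eq t (alg_sum (map (\<lambda>g. Scale (c g) (kp_basis g)) gs))" by blast
  obtain gs where gs: "distinct gs" "set gs = D" using finite_distinct_list[OF D(1)] by metis
  have "set gs \<subseteq> lag_index" using gs(2) D(2) by simp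
  note sum = lookup_kp_mat_sum[OF gs(1) this, of c]
  have mat: "kp_mat t = kp_mat (alg_sum (map (\<lambda>g. Scale (c g) (kp_basis g)) gs))"
    by (rule kp_mat_cong[OF D(4)[OF gs(1)]]) (simp add: gs(2))
  have "Poly_Mapping.lookup (kp_mat t z w) k = c (z, k, w)" for z k w
    unfolding mat sum gs(2) using D(3)[of "(z, k, w)"] by simp
  then show ?thesis using D by (intro exI[of _ D] exI[of _ c]) blast
qed

text \<open>Equal matrices force equal coefficients, and both normal forms can be written along one
  list containing D and E.\<close>

lemma kp_mat_inj:
  fixes s t :: "('f::field, 'a kp_gen) alg_term"
  assumes "gens s \<subseteq> kp_gens G" "gens t \<subseteq> kp_gens G" "kp_mat s = kp_mat t"
  shows "kp_eq s t"
proof -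
  obtain D c where D: "finite D \<and> D \<subseteq> lag_index \<and> (\<forall>g. g \<notin> D \<longrightarrow> c g = 0) \<and>
    (\<forall>gs. distinct gs \<and> D \<subseteq> set gs \<longrightarrow>
       kp_eq s (alg_sum (map (\<lambda>g. Scale (c g) (kp_basis g)) gs))) \<and>
    (\<forall>z k w. Poly_Mapping.lookup (kp_mat s z w) k = c (z, k, w))"
    using kp_normal_form[OF assms(1)] by blast
  obtain E d where E: "finite E \<and> E \<subseteq> lag_index \<and> (\<forall>g. g \<notin> E \<longrightarrow> d g = 0) \<and>
    (\<forall>gs. distinct gs \<and> E \<subseteq> set gs \<longrightarrow>
       kp_eq t (alg_sum (map (\<lambda>g. Scale (d g) (kp_basis g)) gs))) \<and>
    (\<forall>z k w. Poly_Mapping.lookup (kp_mat t z w) k = d (z, k, w))"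
    using kp_normal_form[OF assms(2)] by blast
  have "c g = d g" for g using D E assms(3) by (cases g) metis
  then have "c = d" by blast
  obtain gs where gs: "distinct gs" "set gs = D \<union> E"
    using finite_distinct_list[of "D \<union> E"] D E by blast
  have "kp_eq s (alg_sum (map (\<lambda>g. Scale (c g) (kp_basis g)) gs))"
    using gs D by blast
  moreover have "kp_eq t (alg_sum (map (\<lambda>g. Scale (c g) (kp_basis g)) gs))"
    unfolding \<open>c = d\<close> using gs E by blast
  ultimately show ?thesis using alg_eq.trans[OF _ alg_eq.sym] by blast
qed

lemma kp_mat_support:
  fixes t :: "('f::field, 'a kp_gen) alg_term"
  assumes "gens t \<subseteq> kp_gens G" "n \<in> Poly_Mapping.keys (kp_mat t x y)"
  shows "tail_lag x n y"
proof -
  obtain D c where D: "finite D \<and> D \<subseteq> lag_index \<and> (\<forall>g. g \<notin> D \<longrightarrow> c g = 0) \<and>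
    (\<forall>gs. distinct gs \<and> D \<subseteq> set gs \<longrightarrow>
       kp_eq t (alg_sum (map (\<lambda>g. Scale (c g) (kp_basis g)) gs))) \<and>
    (\<forall>z k w. Poly_Mapping.lookup (kp_mat t z w) k = c (z, k, w))"
    using kp_normal_form[OF assms(1)] by blast
  have "c (x, n, y) \<noteq> 0" using assms(2) D by (simp add: in_keys_iff)
  then have "(x, n, y) \<in> lag_index" using D by blast
  then show ?thesis by (simp add: lag_index_def)
qed

lemma kp_mat_surj:
  fixes M :: "(nat ^ 'k \<Rightarrow> 'a) \<Rightarrow> (nat ^ 'k \<Rightarrow> 'a) \<Rightarrow> ((int ^ 'k) \<Rightarrow>\<^sub>0 'f::field)"
  assumes "\<And>x n y. n \<in> Poly_Mapping.keys (M x y) \<Longrightarrow> tail_lag x n y"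
  shows "\<exists>t. gens t \<subseteq> kp_gens G \<and> kp_mat t = M"
proof -
  define D where "D = {(x, n, y). n \<in> Poly_Mapping.keys (M x y)}"
  have D: "D \<subseteq> lag_index" using assms by (auto simp: D_def lag_index_def)
  have "D \<subseteq> (\<Union>x\<in>inf_paths. \<Union>y\<in>inf_paths. (\<lambda>n. (x, n, y)) ` Poly_Mapping.keys (M x y))"
    using assms unfolding D_def tail_lag_def by blast
  then have "finite D" using HNE_finite_inf_paths[OF HNE fin] by (auto intro: finite_subset)
  then obtain gs where gs: "distinct gs" "set gs = D" using finite_distinct_list by metis
  define t where "t = alg_sum (map (\<lambda>g. Scale (case g of (x, n, y) \<Rightarrow> Poly_Mapping.lookup (M x y) n) (kp_basis g :: ('f, _) alg_term)) gs)"
  have "gens t \<subseteq> kp_gens G"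
    unfolding t_def gens_alg_sum using gs(2) D gens_kp_basis by fastforce
  moreover have "kp_mat t x y = M x y" for x y
  proof (rule poly_mapping_eqI)
    fix n
    show "Poly_Mapping.lookup (kp_mat t x y) n = Poly_Mapping.lookup (M x y) n"
      unfolding t_def using gs D by (subst lookup_kp_mat_sum) (auto simp: D_def in_keys_iff)
  qed
  ultimately show ?thesis by blast
qed

end

section \<open>The isomorphism with a sum of matrix algebras\<close>

text \<open>A vertex provides an infinite path and thereby a block. On block i the matrix is
  conjugated by the diagonal matrix of the monomials of degree \<open>l i a\<close>; this moves
  every entry into the group algebra of the isotropy group, whose degrees are then pulled back along
  \<open>\<phi> i\<close>.\<close>

lemma kp_algebra_iso:
  assumes HNE: "condition_HNE G" and fin: "finite (vertices G)" and ne: "vertices G \<noteq> {}"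
  shows "\<exists>(t :: nat) (m :: nat \<Rightarrow> nat). 0 < t \<and> (\<forall>i\<in>{1..t}. 0 < m i) \<and>
    algebra_isomorphic (KP TYPE('f::field) G)
      (direct_sum_algebra {1..t} (\<lambda>i. group_algebra_matrices (m i) :: ('f, ((int ^ 'k) \<Rightarrow>\<^sub>0 'f) mat) module))"
proof -
  have finX: "finite inf_paths" by (rule HNE_finite_inf_paths[OF HNE fin])
  have "inf_paths \<noteq> {}" using inf_path_exists ne by blast
  from tail_lag_coordinates[OF finX this] obtain t :: nat and m :: "nat \<Rightarrow> nat"
    and e :: "nat \<Rightarrow> nat \<Rightarrow> nat ^ 'k \<Rightarrow> 'a" and \<phi> :: "nat \<Rightarrow> int ^ 'k \<Rightarrow> int ^ 'k"
    and l :: "nat \<Rightarrow> nat \<Rightarrow> int ^ 'k" where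
    t: "0 < t" and m: "\<forall>i\<in>{1..t}. 0 < m i"
    and bij: "bij_betw (\<lambda>(i, a). e i a) (Sigma {1..t} (\<lambda>i. {0..<m i})) inf_paths"
    and \<phi>_add': "\<forall>i\<in>{1..t}. \<forall>a b. \<phi> i (a + b) = \<phi> i a + \<phi> i b"
    and \<phi>_inj': "\<forall>i\<in>{1..t}. inj (\<phi> i)"
    and lag': "\<forall>i\<in>{1..t}. \<forall>j\<in>{1..t}. \<forall>a<m i. \<forall>b<m j. \<forall>n.
       tail_lag (e i a) n (e j b) \<longleftrightarrow> i = j \<and> n - l i a + l i b \<in> range (\<phi> i)"
    by (elim exE conjE)
  have \<phi>_add: "\<phi> i (a + b) = \<phi> i a + \<phi> i b" if "i \<in> {1..t}" for i a b
    using \<phi>_add' that by blast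
  have \<phi>_inj: "inj (\<phi> i)" if "i \<in> {1..t}" for i using \<phi>_inj' that by blast
  have lag: "tail_lag (e i a) n (e j b) \<longleftrightarrow> i = j \<and> n - l i a + l i b \<in> range (\<phi> i)"
    if "i \<in> {1..t}" "j \<in> {1..t}" "a < m i" "b < m j" for i j a b n
    using lag' that by blast
  let ?K = "KP TYPE('f) G"
  let ?B = "direct_sum_algebra {1..t} (\<lambda>i. group_algebra_matrices (m i) :: ('f, ((int ^ 'k) \<Rightarrow>\<^sub>0 'f) mat) module)"
  let ?c = "alg_class (kp_gens G) (kp_relations G) :: ('f, 'a kp_gen) alg_term \<Rightarrow> _"
  have \<phi>_0: "\<phi> i 0 = 0" if "i \<in> {1..t}" for i using \<phi>_add[OF that, of 0 0] by simp
  define rep where "rep A = kp_mat (SOME s :: ('f, 'a kp_gen) alg_term. s \<in> A)" for A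
  have rep: "rep (?c s) = kp_mat s" if "gens s \<subseteq> kp_gens G" for s
  proof -
    have "s \<in> ?c s" using that by (simp add: mem_alg_class alg_eq.refl)
    then have "(SOME s'. s' \<in> ?c s) \<in> ?c s" by (rule someI)
    then have "kp_eq s (SOME s'. s' \<in> ?c s)" using that by (simp add: mem_alg_class)
    from kp_mat_cong[OF this] show ?thesis by (simp add: rep_def)
  qed
  have carrierK: "\<exists>s. gens s \<subseteq> kp_gens G \<and> A = ?c s" if "A \<in> carrier ?K" for A
    using that unfolding KP_presented presented_carrier .
  have supp: "tail_lag x n y" if AK: "A \<in> carrier ?K" "n \<in> Poly_Mapping.keys (rep A x y)" for A n x y
  proof -
    obtain s where s: "gens s \<subseteq> kp_gens G" "A = ?c s" using carrierK[OF AK(1)] by blast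
    show ?thesis using AK(2) unfolding s(2) rep[OF s(1)] by (rule kp_mat_support[OF HNE fin s(1)])
  qed
  have e_in: "e i a \<in> inf_paths" if "i \<in> {1..t}" "a < m i" for i a
    using bij_betw_imp_surj_on[OF bij] that by force
  have e_ex: "\<exists>i a. i \<in> {1..t} \<and> a < m i \<and> x = e i a" if "x \<in> inf_paths" for x
  proof -
    have "x \<in> (\<lambda>(i, a). e i a) ` (Sigma {1..t} (\<lambda>i. {0..<m i}))" using bij_betw_imp_surj_on[OF bij] that by simp
    then obtain i a where "i \<in> {1..t}" "a < m i" "x = e i a" by auto
    then show ?thesis by blast
  qed
  \<comment> \<open>No arrow joins different tail classes, so the matrices are block
    diagonal.\<close>
  have rep_0: "rep A (e i a) (e j b) = 0"
    if "A \<in> carrier ?K" "i \<in> {1..t}" "j \<in> {1..t}" "a < m i" "b < m j" "i \<noteq> j" for A i j a b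
  proof -
    have "Poly_Mapping.keys (rep A (e i a) (e j b)) = {}"
      using supp[OF that(1)] lag[OF that(2-5)] that(6) by blast
    then show ?thesis by simp
  qed
  define N where "N A i = Matrix.mat (m i) (m i) (\<lambda>(a, b). Poly_Mapping.map_key (\<phi> i)
      (group_monom (l i b - l i a) * rep A (e i a) (e i b)))" for A i
  define h where "h A = (\<lambda>i\<in>{1..t}. N A i)" for A
  have N_carrier: "N A i \<in> carrier_mat (m i) (m i)" for A i by (simp add: N_def)
  have push_N: "pm_push (\<phi> i) (N A i $$ (a, b)) = group_monom (l i b - l i a) * rep A (e i a) (e i b)"
    if "A \<in> carrier ?K" "i \<in> {1..t}" "a < m i" "b < m i" for A i a b
  proof -
    have "Poly_Mapping.keys (group_monom (l i b - l i a) * rep A (e i a) (e i b)) \<subseteq> range (\<phi> i)"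
    proof
      fix n assume "n \<in> Poly_Mapping.keys (group_monom (l i b - l i a) * rep A (e i a) (e i b))"
      then have "tail_lag (e i a) (n - (l i b - l i a)) (e i b)"
        using supp[OF that(1)] keys_monom_times by blast
      then have "n - (l i b - l i a) - l i a + l i b \<in> range (\<phi> i)"
        using lag[OF that(2,2,3,4)] by blast
      moreover have "n - (l i b - l i a) - l i a + l i b = n" by simp
      ultimately show "n \<in> range (\<phi> i)" by simp
    qed
    then show ?thesis
      using pm_push_map_key[OF \<phi>_inj[OF that(2)]] that(3,4) by (simp add: N_def)
  qed
  \<comment> \<open>Identities for N are checked after the injective map
    \<open>pm_push (\<phi> i)\<close>, which respects sums and products and turns the entries back
    into entries of \<open>rep\<close>.\<close>
  have N_eqI: "N A i = M"
    if "A \<in> carrier ?K" "i \<in> {1..t}" "M \<in> carrier_mat (m i) (m i)"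
      "\<And>a b. a < m i \<Longrightarrow> b < m i \<Longrightarrow>
         pm_push (\<phi> i) (M $$ (a, b)) = group_monom (l i b - l i a) * rep A (e i a) (e i b)" for A i M
  proof (rule eq_matI)
    fix a b assume "a < dim_row M" "b < dim_col M"
    then have ab: "a < m i" "b < m i" using that(3) by auto
    show "N A i $$ (a, b) = M $$ (a, b)"
      by (rule pm_push_inj[OF \<phi>_inj[OF that(2)]])
        (simp only: push_N[OF that(1,2) ab] that(4)[OF ab])
  qed (use that(3) in \<open>auto simp: N_def\<close>)
  have monom_cancel: "group_monom (n - n') * (group_monom (n' - n) * p) = p"
    for n n' :: "int ^ 'k" and p :: "(int ^ 'k) \<Rightarrow>\<^sub>0 'f"
    by (simp add: single_times)
  have carrierB: "x \<in> carrier ?B \<longleftrightarrow> x \<in> (\<Pi>\<^sub>E i\<in>{1..t}. carrier_mat (m i) (m i))" for x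
    by (simp add: direct_sum_algebra_def group_algebra_matrices_def ring_mat_def)
  have h_closed: "h A \<in> carrier ?B" for A
    unfolding carrierB h_def using N_carrier by auto
  have multK: "A \<otimes>\<^bsub>?K\<^esub> B \<in> carrier ?K" "rep (A \<otimes>\<^bsub>?K\<^esub> B) x y = (\<Sum>z\<in>inf_paths. rep A x z * rep B z y)"
    if AB: "A \<in> carrier ?K" "B \<in> carrier ?K" for A B x y
  proof -
    obtain s s' where s: "gens s \<subseteq> kp_gens G" "A = ?c s" "gens s' \<subseteq> kp_gens G" "B = ?c s'"
      using carrierK[OF AB(1)] carrierK[OF AB(2)] by blast
    have g: "gens (Times s s') \<subseteq> kp_gens G" using s by simp
    have eq: "A \<otimes>\<^bsub>?K\<^esub> B = ?c (Times s s')"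
      unfolding s(2,4) KP_presented by (rule presented_mult[OF s(1,3)])
    show "A \<otimes>\<^bsub>?K\<^esub> B \<in> carrier ?K"
      unfolding eq unfolding KP_presented by (rule alg_class_closed[OF g])
    show "rep (A \<otimes>\<^bsub>?K\<^esub> B) x y = (\<Sum>z\<in>inf_paths. rep A x z * rep B z y)"
      unfolding eq rep[OF g] unfolding s(2,4) rep[OF s(1)] rep[OF s(3)] by (rule kp_mat_times[OF finX])
  qed
  have addK: "A \<oplus>\<^bsub>?K\<^esub> B \<in> carrier ?K" "rep (A \<oplus>\<^bsub>?K\<^esub> B) x y = rep A x y + rep B x y"
    if AB: "A \<in> carrier ?K" "B \<in> carrier ?K" for A B x y
  proof -
    obtain s s' where s: "gens s \<subseteq> kp_gens G" "A = ?c s" "gens s' \<subseteq> kp_gens G" "B = ?c s'"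
      using carrierK[OF AB(1)] carrierK[OF AB(2)] by blast
    have g: "gens (Plus s s') \<subseteq> kp_gens G" using s by simp
    have eq: "A \<oplus>\<^bsub>?K\<^esub> B = ?c (Plus s s')"
      unfolding s(2,4) KP_presented by (rule presented_add[OF s(1,3)])
    show "A \<oplus>\<^bsub>?K\<^esub> B \<in> carrier ?K"
      unfolding eq unfolding KP_presented by (rule alg_class_closed[OF g])
    show "rep (A \<oplus>\<^bsub>?K\<^esub> B) x y = rep A x y + rep B x y"
      unfolding eq rep[OF g] unfolding s(2,4) rep[OF s(1)] rep[OF s(3)] by simp
  qed
  have smultK: "c \<odot>\<^bsub>?K\<^esub> A \<in> carrier ?K" "rep (c \<odot>\<^bsub>?K\<^esub> A) x y = Poly_Mapping.single 0 c * rep A x y"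
    if AK: "A \<in> carrier ?K" for c A x y
  proof -
    obtain s where s: "gens s \<subseteq> kp_gens G" "A = ?c s" using carrierK[OF AK] by blast
    have g: "gens (Scale c s) \<subseteq> kp_gens G" using s by simp
    have eq: "c \<odot>\<^bsub>?K\<^esub> A = ?c (Scale c s)"
      unfolding s(2) KP_presented by (rule presented_smult[OF s(1)])
    show "c \<odot>\<^bsub>?K\<^esub> A \<in> carrier ?K"
      unfolding eq unfolding KP_presented by (rule alg_class_closed[OF g])
    show "rep (c \<odot>\<^bsub>?K\<^esub> A) x y = Poly_Mapping.single 0 c * rep A x y"
      unfolding eq rep[OF g] unfolding s(2) rep[OF s(1)] by simp
  qed
  obtain vs where vs: "distinct vs" "set vs = vertices G" using finite_distinct_list[OF fin] by metis
  have gu: "gens (alg_sum (map kp_p vs) :: ('f, 'a kp_gen) alg_term) \<subseteq> kp_gens G"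
    using vs(2) by (auto simp: gens_alg_sum kp_gens_def)
  have oneK_eq: "\<one>\<^bsub>?K\<^esub> = ?c (alg_sum (map kp_p vs))"
    unfolding KP_presented using kp_unit[OF vs] by (intro presented_one gu) blast+
  have oneK: "\<one>\<^bsub>?K\<^esub> \<in> carrier ?K" "rep \<one>\<^bsub>?K\<^esub> x y = (if x \<in> inf_paths \<and> x = y then 1 else 0)" for x y
  proof -
    show "\<one>\<^bsub>?K\<^esub> \<in> carrier ?K" unfolding oneK_eq unfolding KP_presented by (rule alg_class_closed[OF gu])
    show "rep \<one>\<^bsub>?K\<^esub> x y = (if x \<in> inf_paths \<and> x = y then 1 else 0)"
      unfolding oneK_eq rep[OF gu] by (rule kp_mat_unit[OF vs])
  qed
  have h_mult: "h (A \<otimes>\<^bsub>?K\<^esub> B) = h A \<otimes>\<^bsub>?B\<^esub> h B" if AB: "A \<in> carrier ?K" "B \<in> carrier ?K" for A B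
  proof -
    have "N (A \<otimes>\<^bsub>?K\<^esub> B) i = N A i * N B i" if i: "i \<in> {1..t}" for i
    proof (rule N_eqI[OF multK(1)[OF AB] i])
      show "N A i * N B i \<in> carrier_mat (m i) (m i)" using N_carrier by (intro mult_carrier_mat)
      fix a b assume ab: "a < m i" "b < m i"
      have "(\<Sum>z\<in>inf_paths. rep A (e i a) z * rep B z (e i b)) =
        (\<Sum>(j, c)\<in>Sigma {1..t} (\<lambda>i. {0..<m i}). rep A (e i a) (e j c) * rep B (e j c) (e i b))"
        using sum.reindex_bij_betw[OF bij, of "\<lambda>z. rep A (e i a) z * rep B z (e i b)"]
        by (simp add: case_prod_unfold)
      also have "\<dots> = (\<Sum>j\<in>{1..t}. \<Sum>c\<in>{0..<m j}. rep A (e i a) (e j c) * rep B (e j c) (e i b))"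
        by (subst sum.Sigma) auto
      also have "\<dots> = (\<Sum>j\<in>{1..t}. if j = i then \<Sum>c\<in>{0..<m i}. rep A (e i a) (e i c) * rep B (e i c) (e i b) else 0)"
      proof (rule sum.cong[OF HOL.refl])
        fix j assume j: "j \<in> {1..t}"
        have "(\<Sum>c\<in>{0..<m j}. rep A (e i a) (e j c) * rep B (e j c) (e i b)) = 0" if "j \<noteq> i"
          by (rule sum.neutral) (use rep_0[OF AB(1) i j ab(1)] that in auto)
        then show "(\<Sum>c\<in>{0..<m j}. rep A (e i a) (e j c) * rep B (e j c) (e i b)) =
          (if j = i then \<Sum>c\<in>{0..<m i}. rep A (e i a) (e i c) * rep B (e i c) (e i b) else 0)" by auto
      qed
      also have "\<dots> = (\<Sum>c\<in>{0..<m i}. rep A (e i a) (e i c) * rep B (e i c) (e i b))" using i by simp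
      finally have prod: "rep (A \<otimes>\<^bsub>?K\<^esub> B) (e i a) (e i b) =
        (\<Sum>c\<in>{0..<m i}. rep A (e i a) (e i c) * rep B (e i c) (e i b))" unfolding multK(2)[OF AB] .
      have "(N A i * N B i) $$ (a, b) = (\<Sum>c\<in>{0..<m i}. N A i $$ (a, c) * N B i $$ (c, b))"
        using ab N_carrier[of A i] N_carrier[of B i] by (simp add: scalar_prod_def)
      then have "pm_push (\<phi> i) ((N A i * N B i) $$ (a, b)) =
        (\<Sum>c\<in>{0..<m i}. pm_push (\<phi> i) (N A i $$ (a, c)) * pm_push (\<phi> i) (N B i $$ (c, b)))"
        by (simp only: pm_push_sum pm_push_mult[OF \<phi>_add[OF i]])
      also have "\<dots> = (\<Sum>c\<in>{0..<m i}. group_monom (l i b - l i a) * (rep A (e i a) (e i c) * rep B (e i c) (e i b)))"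
      proof (rule sum.cong[OF HOL.refl])
        fix c assume "c \<in> {0..<m i}"
        then have c: "c < m i" by simp
        \<comment> \<open>The shifts telescope through c, as conjugation requires.\<close>
        have "group_monom (l i c - l i a) * group_monom (l i b - l i c) = (group_monom (l i b - l i a) :: (int ^ 'k) \<Rightarrow>\<^sub>0 'f)"
          by (simp add: mult_single)
        from this[symmetric] show "pm_push (\<phi> i) (N A i $$ (a, c)) * pm_push (\<phi> i) (N B i $$ (c, b)) =
          group_monom (l i b - l i a) * (rep A (e i a) (e i c) * rep B (e i c) (e i b))"
          unfolding push_N[OF AB(1) i ab(1) c] push_N[OF AB(2) i c ab(2)]
          by (rule mult_interchange)
      qed
      also have "\<dots> = group_monom (l i b - l i a) * rep (A \<otimes>\<^bsub>?K\<^esub> B) (e i a) (e i b)"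
        unfolding prod by (simp only: sum_distrib_left)
      finally show "pm_push (\<phi> i) ((N A i * N B i) $$ (a, b)) =
        group_monom (l i b - l i a) * rep (A \<otimes>\<^bsub>?K\<^esub> B) (e i a) (e i b)" .
    qed
    then show ?thesis
      unfolding h_def by (auto simp: direct_sum_algebra_def group_algebra_matrices_def ring_mat_def)
  qed
  have h_add: "h (A \<oplus>\<^bsub>?K\<^esub> B) = h A \<oplus>\<^bsub>?B\<^esub> h B" if AB: "A \<in> carrier ?K" "B \<in> carrier ?K" for A B
  proof -
    have "N (A \<oplus>\<^bsub>?K\<^esub> B) i = N A i + N B i" if i: "i \<in> {1..t}" for i
    proof (rule N_eqI[OF addK(1)[OF AB] i])
      show "N A i + N B i \<in> carrier_mat (m i) (m i)" using N_carrier by (intro add_carrier_mat)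
      fix a b assume ab: "a < m i" "b < m i"
      have "(N A i + N B i) $$ (a, b) = N A i $$ (a, b) + N B i $$ (a, b)"
        using ab N_carrier[of B i] by simp
      then show "pm_push (\<phi> i) ((N A i + N B i) $$ (a, b)) =
        group_monom (l i b - l i a) * rep (A \<oplus>\<^bsub>?K\<^esub> B) (e i a) (e i b)"
        by (simp only: pm_push_add push_N[OF AB(1) i ab] push_N[OF AB(2) i ab] addK(2)[OF AB] distrib_left)
    qed
    then show ?thesis
      unfolding h_def by (auto simp: direct_sum_algebra_def group_algebra_matrices_def ring_mat_def)
  qed
  have h_smult: "h (c \<odot>\<^bsub>?K\<^esub> A) = c \<odot>\<^bsub>?B\<^esub> h A" if A: "A \<in> carrier ?K" for c A
  proof -
    have "N (c \<odot>\<^bsub>?K\<^esub> A) i = Poly_Mapping.single 0 c \<cdot>\<^sub>m N A i" if i: "i \<in> {1..t}" for i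
    proof (rule N_eqI[OF smultK(1)[OF A] i])
      show "Poly_Mapping.single 0 c \<cdot>\<^sub>m N A i \<in> carrier_mat (m i) (m i)" using N_carrier by (intro smult_carrier_mat)
      fix a b assume ab: "a < m i" "b < m i"
      have "(Poly_Mapping.single 0 c \<cdot>\<^sub>m N A i) $$ (a, b) = Poly_Mapping.single 0 c * N A i $$ (a, b)"
        using ab N_carrier[of A i] by simp
      then show "pm_push (\<phi> i) ((Poly_Mapping.single 0 c \<cdot>\<^sub>m N A i) $$ (a, b)) =
        group_monom (l i b - l i a) * rep (c \<odot>\<^bsub>?K\<^esub> A) (e i a) (e i b)"
        by (simp only: pm_push_mult[OF \<phi>_add[OF i]] pm_push_single \<phi>_0[OF i] push_N[OF A i ab] smultK(2)[OF A]
            mult.left_commute)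
    qed
    then show ?thesis
      unfolding h_def by (auto simp: direct_sum_algebra_def group_algebra_matrices_def ring_mat_def)
  qed
  have h_one: "h \<one>\<^bsub>?K\<^esub> = \<one>\<^bsub>?B\<^esub>"
  proof -
    have "N \<one>\<^bsub>?K\<^esub> i = 1\<^sub>m (m i)" if i: "i \<in> {1..t}" for i
    proof (rule N_eqI[OF oneK(1) i])
      fix a b assume ab: "a < m i" "b < m i"
      have "e i a = e i b \<longleftrightarrow> a = b"
        using inj_on_eq_iff[OF bij_betw_imp_inj_on[OF bij], of "(i, a)" "(i, b)"] i ab by simp
      moreover have "pm_push (\<phi> i) 1 = (1 :: (int ^ 'k) \<Rightarrow>\<^sub>0 'f)"
        by (simp only: single_one[symmetric] pm_push_single \<phi>_0[OF i])
      ultimately show "pm_push (\<phi> i) (1\<^sub>m (m i) $$ (a, b)) =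
        group_monom (l i b - l i a) * rep \<one>\<^bsub>?K\<^esub> (e i a) (e i b)"
        using ab e_in[OF i ab(1)] by (simp add: oneK(2))
    qed simp
    then show ?thesis
      unfolding h_def by (auto simp: direct_sum_algebra_def group_algebra_matrices_def ring_mat_def)
  qed
  have inj: "inj_on h (carrier ?K)"
  proof (rule inj_onI)
    fix A B assume AB: "A \<in> carrier ?K" "B \<in> carrier ?K" "h A = h B"
    have "rep A x y = rep B x y" for x y
    proof (cases "x \<in> inf_paths \<and> y \<in> inf_paths")
      case True
      then obtain i a j b where ij: "i \<in> {1..t}" "a < m i" "x = e i a" "j \<in> {1..t}" "b < m j" "y = e j b"
        using e_ex by metis
      show ?thesis
      proof (cases "i = j")
        case True
        note ab = ij(2) ij(5)[folded True]
        have "N A i = N B i" using fun_cong[OF AB(3), of i] ij(1) by (simp add: h_def)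
        then have "group_monom (l i b - l i a) * rep A (e i a) (e i b) = group_monom (l i b - l i a) * rep B (e i a) (e i b)"
          using push_N[OF AB(1) ij(1) ab] push_N[OF AB(2) ij(1) ab] by simp
        then have "rep A (e i a) (e i b) = rep B (e i a) (e i b)" using monom_cancel by metis
        then show ?thesis using ij(3,6) True by simp
      next
        case False
        then show ?thesis
          unfolding ij(3,6) using rep_0[OF AB(1) ij(1,4,2,5)] rep_0[OF AB(2) ij(1,4,2,5)] by simp
      qed
    next
      case False
      then have "Poly_Mapping.keys (rep A x y) = {}" "Poly_Mapping.keys (rep B x y) = {}"
        using supp[OF AB(1)] supp[OF AB(2)] unfolding tail_lag_def by blast+
      then show ?thesis by simp
    qed
    then have "rep A = rep B" by blast
    moreover obtain s s' where s: "gens s \<subseteq> kp_gens G" "A = ?c s" "gens s' \<subseteq> kp_gens G" "B = ?c s'"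
      using carrierK[OF AB(1)] carrierK[OF AB(2)] by blast
    ultimately have "kp_eq s s'"
      using kp_mat_inj[OF HNE fin s(1,3)] rep[OF s(1)] rep[OF s(3)] by simp
    then show "A = B" unfolding s(2,4) using alg_class_eq_iff[OF s(1,3)] by blast
  qed
  have surj: "Q \<in> h ` carrier ?K" if Q: "Q \<in> carrier ?B" for Q
  proof -
    have QM: "Q i \<in> carrier_mat (m i) (m i)" if "i \<in> {1..t}" for i using Q that unfolding carrierB by auto
    \<comment> \<open>Recovers the block and the position of an infinite path.\<close>
    define co where "co = inv_into (Sigma {1..t} (\<lambda>i. {0..<m i})) (\<lambda>(i, a). e i a)"
    have co: "co (e i a) = (i, a)" if "i \<in> {1..t}" "a < m i" for i a
      using inv_into_f_f[OF bij_betw_imp_inj_on[OF bij], of "(i, a)"] that by (simp add: co_def)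
    \<comment> \<open>The normalization undone: degrees are mapped into the isotropy group and
      shifted back by \<open>l i a - l i b\<close>; entries between different blocks are 0.\<close>
    define M where "M x y = (if x \<in> inf_paths \<and> y \<in> inf_paths \<and> fst (co x) = fst (co y)
      then group_monom (l (fst (co x)) (snd (co x)) - l (fst (co x)) (snd (co y))) *
        pm_push (\<phi> (fst (co x))) (Q (fst (co x)) $$ (snd (co x), snd (co y))) else 0)" for x y
    have M: "M (e i a) (e i b) = group_monom (l i a - l i b) * pm_push (\<phi> i) (Q i $$ (a, b))"
      if "i \<in> {1..t}" "a < m i" "b < m i" for i a b
      using that e_in by (simp add: M_def co)
    have "tail_lag x n y" if n: "n \<in> Poly_Mapping.keys (M x y)" for x n y
    proof -
      have xy: "x \<in> inf_paths" "y \<in> inf_paths" "fst (co x) = fst (co y)"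
        using n by (auto simp: M_def split: if_splits)
      obtain i a j b where ij: "i \<in> {1..t}" "a < m i" "x = e i a" "j \<in> {1..t}" "b < m j" "y = e j b"
        using e_ex[OF xy(1)] e_ex[OF xy(2)] by metis
      have ij': "i = j" using xy(3) ij co by simp
      have "M x y = group_monom (l i a - l i b) * pm_push (\<phi> i) (Q i $$ (a, b))"
        unfolding ij(3,6) ij'[symmetric] by (rule M[OF ij(1,2) ij(5)[folded ij']])
      then have "n \<in> Poly_Mapping.keys (group_monom (l i a - l i b) * pm_push (\<phi> i) (Q i $$ (a, b)))"
        using n by (simp only:)
      then have "n - (l i a - l i b) \<in> Poly_Mapping.keys (pm_push (\<phi> i) (Q i $$ (a, b)))"
        by (rule keys_monom_times)
      then have "n - (l i a - l i b) \<in> range (\<phi> i)" by (rule subsetD[OF keys_pm_push])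
      moreover have "n - (l i a - l i b) = n - l i a + l i b" by simp
      ultimately have "n - l i a + l i b \<in> range (\<phi> i)" by simp
      then show ?thesis unfolding ij(3,6) using lag[OF ij(1,4,2,5)] ij' by blast
    qed
    from kp_mat_surj[OF HNE fin this] obtain s where s: "gens s \<subseteq> kp_gens G" "kp_mat s = M" by blast
    have cs: "?c s \<in> carrier ?K" unfolding KP_presented by (rule alg_class_closed[OF s(1)])
    have "N (?c s) i = Q i" if i: "i \<in> {1..t}" for i
    proof (rule N_eqI[OF cs i QM[OF i]])
      fix a b assume ab: "a < m i" "b < m i"
      show "pm_push (\<phi> i) (Q i $$ (a, b)) = group_monom (l i b - l i a) * rep (?c s) (e i a) (e i b)"
        unfolding rep[OF s(1)] s(2) M[OF i ab] monom_cancel ..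
    qed
    then have "h (?c s) = Q"
      using Q unfolding carrierB h_def by (auto simp: PiE_def extensional_def restrict_def fun_eq_iff)
    then show ?thesis using cs by blast
  qed
  have "h \<in> ring_iso ?K ?B"
    unfolding ring_iso_def
  proof (rule CollectI, rule conjI)
    show "h \<in> Ring.ring_hom ?K ?B"
      using h_closed h_mult h_add h_one by (intro ring_hom_memI) auto
    show "bij_betw h (carrier ?K) (carrier ?B)"
      using inj surj h_closed by (intro bij_betw_imageI) auto
  qed
  then show ?thesis
    using t m h_smult unfolding algebra_isomorphic_def by blast
qed

end

text \<open>A vertex of E is a path of length 0 = f 0 and so lies in the pullback. This makes the
  number of blocks positive.\<close>

lemma pullback_path_kgraph_nonempty:
  assumes "kgraph_isomorphic G (pullback f (path_kgraph E))" "verts E \<noteq> {}" "f 0 = 0"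
  shows "paths G \<noteq> {}"
proof -
  obtain u where "u \<in> verts E" using assms(2) by blast
  then have "((u, [], u), 0) \<in> paths (pullback f (path_kgraph E))"
    using assms(3) by (simp add: pullback_def path_kgraph_def pre_digraph.awalk_def pre_digraph.cas.simps
        cart_eq_iff)
  then show ?thesis using assms(1) by (auto simp: kgraph_isomorphic_def bij_betw_def)
qed

theorem theorem5p1p4:
  fixes \<Lambda> :: "('a, 'k::finite) kgraph"
  assumes "k_graph \<Lambda>"
    and "row_finite_without_sources \<Lambda>"
    and "finite (vertices \<Lambda>)"
  shows
    "(locally_finite (KP TYPE('f::field) \<Lambda>) (KP_component TYPE('f) \<Lambda>) \<longleftrightarrow> condition_HNE \<Lambda>) \<and>
     (condition_HNE \<Lambda> \<longleftrightarrow> talented_periodic \<Lambda>) \<and>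
     (\<forall>(E :: ('v, 'e) pre_digraph) (f :: nat ^ 'k \<Rightarrow> nat ^ 1).
        wf_digraph E \<and> verts E \<noteq> {} \<and>
        f 0 = 0 \<and> (\<forall>m n. f (m + n) = f m + f n) \<and> surj f \<and>
        kgraph_isomorphic \<Lambda> (pullback f (path_kgraph E)) \<and>
        (locally_finite (KP TYPE('f) \<Lambda>) (KP_component TYPE('f) \<Lambda>) \<or>
           condition_HNE \<Lambda> \<or> talented_periodic \<Lambda>) \<longrightarrow>
        (\<exists>(t :: nat) (m :: nat \<Rightarrow> nat). 0 < t \<and> (\<forall>i \<in> {1..t}. 0 < m i) \<and>
           algebra_isomorphic (KP TYPE('f) \<Lambda>)
             (direct_sum_algebra {1..t}
                (\<lambda>i. group_algebra_matrices (m i) :: ('f, ((int ^ 'k) \<Rightarrow>\<^sub>0 'f) mat) module))))"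
proof -
  interpret row_finite_k_graph \<Lambda>
    by (intro row_finite_k_graph.intro row_finite_k_graph_axioms.intro assms(1,2))
  have 1: "locally_finite (KP TYPE('f) \<Lambda>) (KP_component TYPE('f) \<Lambda>) \<longleftrightarrow> condition_HNE \<Lambda>"
    using HNE_imp_locally_finite[OF _ assms(3)] locally_finite_imp_HNE by blast
  have 2: "condition_HNE \<Lambda> \<longleftrightarrow> talented_periodic \<Lambda>"
    using HNE_imp_talented_periodic[OF _ assms(3)] talented_periodic_imp_HNE by blast
  have 3: "vertices \<Lambda> \<noteq> {}"
    if "kgraph_isomorphic \<Lambda> (pullback f (path_kgraph E))" "verts E \<noteq> {}" "f 0 = 0"
    for E :: "('v, 'e) pre_digraph" and f :: "nat ^ 'k \<Rightarrow> nat ^ 1"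
    using pullback_path_kgraph_nonempty[OF that] rng_vertex by blast
  show ?thesis
    using 1 2 3 kp_algebra_iso[OF _ assms(3)] by blast
qed

end
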